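(* Let $\varphi$ be a PEB-spline of order $m\ge2$ and let $\alpha>0$. Then $\mathcal{G}(\varphi,\alpha\mathbb{Z}\times\mathbb{Z})$ is a Gabor frame (for $L^2(\mathbb{R})$) if and only if $0<\alpha<1$.
   Context: PEB-splines. Let $m\in\mathbb{N}=\{1,2,\dots\}$. For $1\le s\le m$ let $\gamma_s\in\mathbb{R}$, let $r_s\in C^{m-s}(\mathbb{R})$ be strictly positive and $1$-periodic, and put $w_s(x)=e^{\gamma_s x}r_s(x)$. Let $u_1=w_1$ and $u_s(x)=w_1(x)\int_0^x w_2(x_2)\int_0^{x_2}w_3(x_3)\cdots\int_0^{x_{s-1}}w_s(x_s)\,dx_s\cdots dx_2$ for $2\le s\le m$, and $\mathcal{U}_m=\mathrm{span}_{\mathbb{C}}(u_1,\dots,u_m)$. The periodic exponential B-spline (PEB-spline) of order $m$ for these weights is the function $\varphi:\mathbb{R}\to\mathbb{R}$, unique up to a positive scalar factor, with $\varphi\in C^{m-2}(\mathbb{R})$ (no condition if $m=1$), $\mathrm{supp}\,\varphi=[0,m]$, $\varphi>0$ on $(0,m)$, and whose restriction to each interval $(\ell,\ell+1)$, $\ell\in\mathbb{Z}$, is the restriction of an element of $\mathcal{U}_m$. Gabor systems. For $(x,\omega)\in\mathbb{R}^2$ let $\pi(x,\omega)f(t)=e^{2\pi i\omega t}f(t-x)$. For a discrete set $\Lambda\subseteq\mathbb{R}^2$, $\mathcal{G}(\varphi,\Lambda)=\{\pi(\lambda)\varphi:\lambda\in\Lambda\}$. It is a (Gabor) frame if there are constants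 $0<A\le B<\infty$ with $A\|f\|_2^2\le\sum_{\lambda\in\Lambda}|\langle f,\pi(\lambda)\varphi\rangle|^2\le B\|f\|_2^2$ for all $f\in L^2(\mathbb{R})$. *)

theory Defs
  imports "HOL-Analysis.Analysis"
begin

primrec cont_diff :: "nat \<Rightarrow> (real \<Rightarrow> real) \<Rightarrow> bool" where
  "cont_diff 0 f \<longleftrightarrow> continuous_on UNIV f"
| "cont_diff (Suc k) f \<longleftrightarrow>
     (\<exists>f'. (\<forall>x. (f has_real_derivative f' x) (at x)) \<and> cont_diff k f')"

definition weight :: "(nat \<Rightarrow> real) \<Rightarrow> (nat \<Rightarrow> real \<Rightarrow> real) \<Rightarrow> nat \<Rightarrow> real \<Rightarrow> real" where
  "weight \<gamma> r s x = exp (\<gamma> s * x) * r s x"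

definition admissible_weights :: "nat \<Rightarrow> (nat \<Rightarrow> real \<Rightarrow> real) \<Rightarrow> bool" where
  "admissible_weights m r \<longleftrightarrow>
     (\<forall>s\<in>{1..m}. cont_diff (m - s) (r s) \<and> (\<forall>x. r s x > 0) \<and> (\<forall>x. r s (x + 1) = r s x))"

(* nested w i n x = w_i(x) \<integral>_0^x w_{i+1}(x_{i+1}) \<integral>_0^{x_{i+1}} \<dots> w_{i+n}(x_{i+n}) dx_{i+n} \<dots> dx_{i+1}.
   The interval integral is oriented, which matters for x < 0. *)
primrec nested :: "(nat \<Rightarrow> real \<Rightarrow> real) \<Rightarrow> nat \<Rightarrow> nat \<Rightarrow> real \<Rightarrow> real" where
  "nested w i 0 x = w i x"
| "nested w i (Suc n) x = w i x * (LBINT t=ereal 0..ereal x. nested w (Suc i) n t)"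

definition basis_fun :: "(nat \<Rightarrow> real \<Rightarrow> real) \<Rightarrow> nat \<Rightarrow> real \<Rightarrow> real" where
  "basis_fun w s = nested w 1 (s - 1)"

definition spline_space :: "(nat \<Rightarrow> real \<Rightarrow> real) \<Rightarrow> nat \<Rightarrow> (real \<Rightarrow> complex) set" where
  "spline_space w m =
     {p. \<exists>c :: nat \<Rightarrow> complex. \<forall>x. p x = (\<Sum>s=1..m. c s * complex_of_real (basis_fun w s x))}"

(* The PEB-spline is determined only up to a positive scalar factor, hence a predicate. *)
definition is_PEB_spline ::
    "nat \<Rightarrow> (nat \<Rightarrow> real) \<Rightarrow> (nat \<Rightarrow> real \<Rightarrow> real) \<Rightarrow> (real \<Rightarrow> real) \<Rightarrow> bool" where
  "is_PEB_spline m \<gamma> r \<phi> \<longleftrightarrow>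
     m \<ge> 1 \<and> admissible_weights m r \<and>
     (m \<ge> 2 \<longrightarrow> cont_diff (m - 2) \<phi>) \<and>
     closure {x. \<phi> x \<noteq> 0} = {0..real m} \<and>
     (\<forall>x\<in>{0<..<real m}. \<phi> x > 0) \<and>
     (\<forall>l::int. \<exists>p\<in>spline_space (weight \<gamma> r) m.
        \<forall>x\<in>{of_int l<..<of_int l + 1}. complex_of_real (\<phi> x) = p x)"

(* Elements of L^2(R) are represented by Borel functions; every Lebesgue class contains one,
   and everything below is invariant under changes on null sets. *)
definition L2 :: "(real \<Rightarrow> complex) set" where
  "L2 = {f. f \<in> borel_measurable lborel \<and> integrable lborel (\<lambda>t. (cmod (f t))\<^sup>2)}"

definition L2_inner :: "(real \<Rightarrow> complex) \<Rightarrow> (real \<Rightarrow> complex) \<Rightarrow> complex" where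
  "L2_inner f g = (LINT t|lborel. f t * cnj (g t))"

definition L2_norm :: "(real \<Rightarrow> complex) \<Rightarrow> real" where
  "L2_norm f = sqrt (LINT t|lborel. (cmod (f t))\<^sup>2)"

(* Summability is required explicitly because infsum is 0 for non-summable families. *)
definition L2_frame :: "'i set \<Rightarrow> ('i \<Rightarrow> real \<Rightarrow> complex) \<Rightarrow> bool" where
  "L2_frame I e \<longleftrightarrow>
     (\<forall>i\<in>I. e i \<in> L2) \<and>
     (\<exists>A B. 0 < A \<and> A \<le> B \<and>
        (\<forall>f\<in>L2. (\<lambda>i. (cmod (L2_inner f (e i)))\<^sup>2) summable_on I \<and>
           A * (L2_norm f)\<^sup>2 \<le> (\<Sum>\<^sub>\<infinity>i\<in>I. (cmod (L2_inner f (e i)))\<^sup>2) \<and>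
           (\<Sum>\<^sub>\<infinity>i\<in>I. (cmod (L2_inner f (e i)))\<^sup>2) \<le> B * (L2_norm f)\<^sup>2))"

definition tf_shift :: "real \<times> real \<Rightarrow> (real \<Rightarrow> complex) \<Rightarrow> real \<Rightarrow> complex" where
  "tf_shift z f t =
     exp (2 * complex_of_real pi * \<i> * complex_of_real (snd z) * complex_of_real t) * f (t - fst z)"

definition gabor_frame :: "(real \<Rightarrow> complex) \<Rightarrow> (real \<times> real) set \<Rightarrow> bool" where
  "gabor_frame g \<Lambda> \<longleftrightarrow> L2_frame \<Lambda> (\<lambda>z. tf_shift z g)"

definition rect_lattice :: "real \<Rightarrow> (real \<times> real) set" where
  "rect_lattice \<alpha> = {(\<alpha> * of_int k, of_int l) | k l. True}"

end

(* With period-one modulations, expanding in Fourier series on [0,1) turns the frame inequality into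
   uniform l2-bounds for the maps c |-> (S c (t - alpha j))_j, where S c = sum_k c_k phi(. + k) is a
   spline with integer knots. For alpha < 1 the samples of a spline determine it locally: by Rolle's
   theorem, applied to the successive weighted derivatives, a spline that vanishes on no knot interval
   has too few zeros, and a spline that vanishes on one knot interval and at a point of a neighbouring
   one vanishes there too. Compactness of the unit sphere in the finitely many coefficients seen by a
   window makes this uniform in t, and summing over windows gives the lower bound. For alpha > 1 there
   are more coefficients than samples, so some finite c is annihilated; for alpha = 1 the sequence
   (-1)^k is annihilated at a zero of t |-> S((-1)^k)(t), which changes sign between 0 and 1. *)
theory Submission
  imports Defs
begin

text \<open>Counting zeros alone breaks off at the end of the chain of weighted derivatives, where a
  function with arbitrary jumps and arbitrary knot values remains. What is passed down is therefore
  the number of sign changes seen off the integers; zeros enter only at the top. The count wins for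
  the following reason: on (-N, N) a spline of order n + 2 that vanishes on no knot interval has at
  most 2N + n zeros, whereas about 2N / \<alpha> samples fall there, so for \<alpha> < 1 a large N
  suffices whatever the order.

  Uniformity in t meets an obstacle of its own: the set of samples inside an open window jumps as t
  moves, so the samples carry a tent weight before compactness is used. Integer translates of \<phi>
  stay in one spline class because an integer shift merely rescales an exponential times a periodic
  weight.

  For the converse, the frame inequality is an average over t. Continuity of \<phi> turns it into an
  inequality at one chosen t for finitely many coefficients, and there a single (almost) annihilated
  vector contradicts it.\<close>

section \<open>Zeros of splines\<close>

text \<open>Functions are followed through iterated weighted derivatives instead of being expanded
  in a basis: no integration constants appear, and sums, multiples and integer translates are easy
  to handle. The last member, at index \<open>i + n\<close>, is free at the knots; every earlier one
  is continuous.\<close>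

primrec chain_spline :: "(nat \<Rightarrow> real \<Rightarrow> real) \<Rightarrow> nat \<Rightarrow> nat \<Rightarrow> (real \<Rightarrow> real) \<Rightarrow> bool" where
  "chain_spline w i 0 f \<longleftrightarrow> (\<forall>l::int. \<exists>c. \<forall>x\<in>{of_int l<..<of_int l + 1}. f x = c * w i x)"
| "chain_spline w i (Suc n) f \<longleftrightarrow> continuous_on UNIV f \<and>
     (\<exists>g. (\<forall>x. x \<notin> \<int> \<longrightarrow> ((\<lambda>y. f y / w i y) has_real_derivative g x) (at x)) \<and>
          chain_spline w (Suc i) n g)"

definition positive_weights :: "(nat \<Rightarrow> real \<Rightarrow> real) \<Rightarrow> nat \<Rightarrow> nat \<Rightarrow> bool" where
  "positive_weights w i n \<longleftrightarrow> (\<forall>s\<in>{i..i + n}. continuous_on UNIV (w s) \<and> (\<forall>x. 0 < w s x))"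

text \<open>\<open>p\<close> counts sign changes, so there are \<open>p + 1\<close> points. Knots
  are excluded because a discontinuous member of the chain has arbitrary values there;
  \<open>\<sigma>\<close> encodes the sign at the first point.\<close>

definition alternating :: "(real \<Rightarrow> real) \<Rightarrow> nat \<Rightarrow> real \<Rightarrow> real \<Rightarrow> bool" where
  "alternating f p a b \<longleftrightarrow> (\<exists>x \<sigma>. (\<forall>i<p. x i < x (Suc i)) \<and>
     (\<forall>i\<le>p. a < x i \<and> x i < b \<and> x i \<notin> \<int> \<and> 0 < \<sigma> * (-1) ^ i * f (x i)))"

lemma alternatingE:
  assumes "alternating f p a b"
  obtains x \<sigma> where "\<And>j. j < p \<Longrightarrow> x j < x (Suc j)"
    "\<And>j. j \<le> p \<Longrightarrow> a < x j \<and> x j < b \<and> x j \<notin> \<int> \<and> 0 < \<sigma> * (-1) ^ j * f (x j)"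
proof -
  obtain x \<sigma> where "\<forall>j<p. x j < x (Suc j)"
    "\<forall>j\<le>p. a < x j \<and> x j < b \<and> x j \<notin> \<int> \<and> 0 < \<sigma> * (-1) ^ j * f (x j)"
    using assms unfolding alternating_def by (elim exE conjE)
  then show thesis using that[of x \<sigma>] by simp
qed

lemma positive_weights_Suc:
  assumes "positive_weights w i (Suc n)"
  shows "positive_weights w (Suc i) n"
  using assms unfolding positive_weights_def by auto

lemma positive_weightsD:
  assumes "positive_weights w i n"
  shows "continuous_on UNIV (w i)" "0 < w i x"
  using assms unfolding positive_weights_def by auto

text \<open>A mean value argument that tolerates knots: if \<open>s * g\<close> were nonpositive off
  the integers, integrating it over \<open>{x..y}\<close>, which contains finitely many knots, would
  give the increment of \<open>F\<close> the wrong sign.\<close>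

lemma derivative_sign_off_Ints:
  fixes F g :: "real \<Rightarrow> real"
  assumes "continuous_on UNIV F"
    and g: "\<And>x. x \<notin> \<int> \<Longrightarrow> (F has_real_derivative g x) (at x)"
    and "x < y" "0 < s * (F y - F x)"
  shows "\<exists>z\<in>{x<..<y} - \<int>. 0 < s * g z"
proof (rule ccontr)
  assume *: "\<not> ?thesis"
  let ?S = "{z \<in> \<int>. x \<le> z \<and> z \<le> y}"
  have fin: "finite ?S" by (rule finite_int_segment)
  have "(g has_integral (F y - F x)) {x..y}"
    using assms by (intro fundamental_theorem_of_calculus_interior_strong[OF fin])
      (auto simp flip: has_real_derivative_iff_has_vector_derivative intro: continuous_on_subset)
  then have "((\<lambda>z. (- s) * g z) has_integral ((- s) * (F y - F x))) {x..y}"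
    by (rule has_integral_mult_right)
  then have "((\<lambda>z. if z \<in> ?S \<union> {x, y} then 0 else (- s) * g z) has_integral ((- s) * (F y - F x))) {x..y}"
    by (rule has_integral_spike_finite[rotated 2, where S = "?S \<union> {x, y}"]) (use fin in auto)
  then have "0 \<le> (- s) * (F y - F x)"
    by (rule has_integral_nonneg) (use * in \<open>auto simp: not_less\<close>)
  then show False using assms(4) by simp
qed

text \<open>Each increment of \<open>F\<close> yields a point between its end points where
  \<open>g\<close> has the sign of that increment, so \<open>q + 1\<close> increments give
  \<open>q\<close> sign changes. The points \<open>y\<close> may be knots; the points found are
  not.\<close>

lemma alternating_derivative:
  fixes F g :: "real \<Rightarrow> real"
  assumes "continuous_on UNIV F"
    and "\<And>x. x \<notin> \<int> \<Longrightarrow> (F has_real_derivative g x) (at x)"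
    and y: "\<And>k. k \<le> q \<Longrightarrow> y k < y (Suc k)"
    and s: "\<And>k. k \<le> q \<Longrightarrow> 0 < \<sigma> * (-1) ^ k * (F (y (Suc k)) - F (y k))"
    and ab: "a \<le> y 0" "y (Suc q) \<le> b"
  shows "alternating g q a b"
proof -
  have "\<forall>k\<in>{..q}. \<exists>z. z \<in> {y k<..<y (Suc k)} - \<int> \<and> 0 < \<sigma> * (-1) ^ k * g z"
    using derivative_sign_off_Ints[OF assms(1,2)] y s by (metis atMost_iff)
  then obtain z where z: "\<And>k. k \<le> q \<Longrightarrow> z k \<in> {y k<..<y (Suc k)} - \<int> \<and> 0 < \<sigma> * (-1) ^ k * g (z k)"
    by (metis atMost_iff)
  have lo: "a \<le> y k" if "k \<le> q" for k
    using that by (induction k) (use ab y in \<open>auto simp: Suc_le_eq intro: order_trans[OF _ less_imp_le]\<close>)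
  have hi: "y (Suc (q - k)) \<le> b" if "k \<le> q" for k
    using that
  proof (induction k)
    case (Suc k)
    then have "y (Suc (q - Suc k)) < y (Suc (q - k))"
      using y[of "q - k"] by (simp add: Suc_diff_Suc)
    then show ?case using Suc by simp
  qed (use ab in simp)
  have hi': "y (Suc k) \<le> b" if "k \<le> q" for k
    using hi[of "q - k"] that by simp
  have "z k < z (Suc k)" if "k < q" for k
    using z[of k] z[of "Suc k"] that by auto
  moreover have "a < z k \<and> z k < b \<and> z k \<notin> \<int> \<and> 0 < \<sigma> * (-1) ^ k * g (z k)" if "k \<le> q" for k
    using z[OF that] lo[OF that] hi'[OF that] by auto
  ultimately show ?thesis
    unfolding alternating_def by (intro exI[of _ z] exI[of _ \<sigma>]) auto
qed

lemma chain_spline_Suc_quotient: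
  assumes "chain_spline w i (Suc n) f" "positive_weights w i m"
  obtains g where "continuous_on UNIV (\<lambda>y. f y / w i y)"
    "\<And>x. x \<notin> \<int> \<Longrightarrow> ((\<lambda>y. f y / w i y) has_real_derivative g x) (at x)"
    "chain_spline w (Suc i) n g"
proof -
  have "continuous_on UNIV (\<lambda>y. f y / w i y)"
    using assms positive_weightsD[OF assms(2)] by (intro continuous_intros) (auto simp: less_imp_neq[symmetric])
  then show thesis using assms(1) that by auto
qed

lemma not_Ints_unit_interval:
  assumes "x \<in> {of_int l<..<of_int l + 1 :: real}"
  shows "x \<notin> \<int>"
  using assms by (auto elim!: Ints_cases)

lemma derivative_zero_on_piece:
  fixes F :: "real \<Rightarrow> real"
  assumes "\<And>x. x \<notin> \<int> \<Longrightarrow> (F has_real_derivative g x) (at x)"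
    and "\<forall>x\<in>{u<..<v}. F x = 0" "of_int l \<le> u" "v \<le> of_int l + 1" "x \<in> {u<..<v}"
  shows "g x = 0"
proof -
  have "x \<notin> \<int>" using not_Ints_unit_interval[of x l] assms by auto
  then have "(F has_real_derivative g x) (at x)" by (rule assms)
  moreover have "(F has_real_derivative 0) (at x)"
    using assms by (intro DERIV_cong_ev[THEN iffD2, OF refl _ refl DERIV_const[of 0]]
        eventually_mono[OF eventually_nhds_in_open[of "{u<..<v}"]]) auto
  ultimately show ?thesis by (rule DERIV_unique)
qed

lemma continuous_zero_closure:
  fixes f :: "real \<Rightarrow> real"
  assumes "continuous_on UNIV f" "\<forall>x\<in>{a<..<b}. f x = 0" "a < b" "x \<in> {a..b}"
  shows "f x = 0"
proof -
  have "closed {x. f x = 0}"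
    using assms(1) by (simp add: closed_Collect_eq)
  then have "closure {a<..<b} \<subseteq> {x. f x = 0}"
    using assms(2) by (intro closure_minimal) auto
  then show ?thesis using assms by auto
qed

text \<open>Each derivative costs one sign change, but every side on which the spline is extended by
  zero gives one back.\<close>

lemma alternating_bound:
  fixes a b :: int
  assumes "chain_spline w i n f" "positive_weights w i n" "alternating f p a b" "a < b"
    and "L \<Longrightarrow> \<forall>x\<in>{of_int a - 1<..<of_int a}. f x = 0"
    and "R \<Longrightarrow> \<forall>x\<in>{of_int b<..<of_int b + 1}. f x = 0"
  shows "int (p + n * (of_bool L + of_bool R)) + 1 \<le> b - a + int n"
  using assms
proof (induction n arbitrary: i f p)
  case 0
  from 0(3) obtain x :: "nat \<Rightarrow> real" and \<sigma> where inc: "\<And>j. j < p \<Longrightarrow> x j < x (Suc j)"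
    and x: "\<And>j. j \<le> p \<Longrightarrow> a < x j \<and> x j < b \<and> x j \<notin> \<int> \<and> 0 < \<sigma> * (-1) ^ j * f (x j)"
    by (rule alternatingE) blast
  \<comment> \<open>On one knot interval the last member is a constant times a positive weight, so
    points of opposite sign lie in different knot intervals.\<close>
  have step: "\<lfloor>x j\<rfloor> < \<lfloor>x (Suc j)\<rfloor>" if "j < p" for j
  proof (rule ccontr)
    assume "\<not> ?thesis"
    moreover have "\<lfloor>x j\<rfloor> \<le> \<lfloor>x (Suc j)\<rfloor>" using inc[OF that] by (simp add: floor_mono)
    ultimately have eq: "\<lfloor>x j\<rfloor> = \<lfloor>x (Suc j)\<rfloor>" by simp
    obtain c where c: "\<forall>y\<in>{of_int \<lfloor>x j\<rfloor><..<of_int \<lfloor>x j\<rfloor> + 1}. f y = c * w i y"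
      using 0(1) unfolding chain_spline.simps by blast
    have mem: "x k \<in> {of_int \<lfloor>x k\<rfloor><..<of_int \<lfloor>x k\<rfloor> + 1}" if "k \<le> p" for k
    proof -
      have "of_int \<lfloor>x k\<rfloor> \<noteq> x k" using x[OF that] by (metis Ints_of_int)
      then show ?thesis
        using floor_correct[of "x k"] unfolding greaterThanLessThan_iff by linarith
    qed
    have "f (x j) = c * w i (x j)" "f (x (Suc j)) = c * w i (x (Suc j))"
      using c mem[of j] mem[of "Suc j"] that eq by auto
    moreover have "0 < \<sigma> * (-1) ^ j * f (x j)" "0 < \<sigma> * (-1) ^ Suc j * f (x (Suc j))"
      using x that by (meson Suc_leI less_imp_le)+
    ultimately have "0 < (\<sigma> * (-1) ^ j * c) * w i (x j)" "(\<sigma> * (-1) ^ j * c) * w i (x (Suc j)) < 0"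
      by (auto simp: mult.assoc)
    then show False
      using positive_weightsD(2)[OF 0(2)] by (metis mult_pos_pos not_less_iff_gr_or_eq zero_less_mult_pos2)
  qed
  have "\<lfloor>x 0\<rfloor> + int j \<le> \<lfloor>x j\<rfloor>" if "j \<le> p" for j
    using that by (induction j) (use step in \<open>auto simp: Suc_le_eq intro: order_trans[OF _ step[THEN zless_imp_add1_zle]]\<close>)
  from this[of p] have "\<lfloor>x 0\<rfloor> + int p \<le> \<lfloor>x p\<rfloor>" by simp
  moreover have "a \<le> \<lfloor>x 0\<rfloor>" using x[of 0] by (simp add: le_floor_iff)
  moreover have "\<lfloor>x p\<rfloor> < b" using x[of p] by (simp add: floor_less_iff)
  ultimately show ?case by simp
next
  case (Suc n)
  obtain g where F: "continuous_on UNIV (\<lambda>y. f y / w i y)"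
    and g: "\<And>x. x \<notin> \<int> \<Longrightarrow> ((\<lambda>y. f y / w i y) has_real_derivative g x) (at x)"
    and sg: "chain_spline w (Suc i) n g"
    using chain_spline_Suc_quotient[OF Suc.prems(1,2)] by blast
  define F where "F y = f y / w i y" for y
  note wpos = positive_weightsD(2)[OF Suc.prems(2)]
  have contf: "continuous_on UNIV f" using Suc.prems(1) by simp
  have L0: "F a = 0" if L
    using continuous_zero_closure[OF contf Suc.prems(5)[OF that]] by (simp add: F_def)
  have R0: "F b = 0" if R
    using continuous_zero_closure[OF contf Suc.prems(6)[OF that]] by (simp add: F_def)
  have gL: "\<forall>x\<in>{of_int a - 1<..<of_int a}. g x = 0" if L
    using derivative_zero_on_piece[OF g, where l = "a - 1" and u = "of_int a - 1" and v = "of_int a"]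
      Suc.prems(5)[OF that] by auto
  have gR: "\<forall>x\<in>{of_int b<..<of_int b + 1}. g x = 0" if R
    using derivative_zero_on_piece[OF g, where l = b and u = "of_int b" and v = "of_int b + 1"]
      Suc.prems(6)[OF that] by auto
  from Suc.prems(3) obtain x :: "nat \<Rightarrow> real" and \<sigma> where inc: "\<And>j. j < p \<Longrightarrow> x j < x (Suc j)"
    and x: "\<And>j. j \<le> p \<Longrightarrow> a < x j \<and> x j < b \<and> x j \<notin> \<int> \<and> 0 < \<sigma> * (-1) ^ j * f (x j)"
    by (rule alternatingE) blast
  have xF: "0 < \<sigma> * (-1) ^ j * F (x j)" if "j \<le> p" for j
    using x[OF that] wpos[of "x j"] unfolding F_def by (metis times_divide_eq_right zero_less_divide_iff)
  \<comment> \<open>A zero of \<open>F\<close> at \<open>b\<close> serves as one more point after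
    the last: going from a nonzero value to zero is an increment of the required sign. The end
    \<open>a\<close> is treated in the same way by \<open>y'\<close> below.\<close>
  define y where "y j = (if j \<le> p then x j else of_int b)" for j
  have y: "y j < y (Suc j)" "0 < - \<sigma> * (-1) ^ j * (F (y (Suc j)) - F (y j))" if jp: "j < p + of_bool R" for j
  proof -
    consider "j < p" | "j = p" R using jp by (cases R) (auto simp: less_Suc_eq)
    then have "y j < y (Suc j) \<and> 0 < - \<sigma> * (-1) ^ j * (F (y (Suc j)) - F (y j))"
    proof cases
      case 1
      then have "- \<sigma> * (-1) ^ j * (F (y (Suc j)) - F (y j))
          = \<sigma> * (-1) ^ Suc j * F (x (Suc j)) + \<sigma> * (-1) ^ j * F (x j)"
        by (simp add: y_def algebra_simps)
      then show ?thesis using 1 inc[of j] xF[of j] xF[of "Suc j"] by (simp add: y_def)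
    next
      case 2
      then show ?thesis using R0 x[of p] xF[of p] by (simp add: y_def)
    qed
    then show "y j < y (Suc j)" "0 < - \<sigma> * (-1) ^ j * (F (y (Suc j)) - F (y j))" by auto
  qed
  have ylast: "y (p + of_bool R) \<le> b" "a \<le> y 0" using x[of p] x[of 0] by (auto simp: y_def)
  \<comment> \<open>The \<open>p + 1\<close> points and one more for each zero side give
    \<open>p + L + R\<close> increments, hence one sign change fewer.\<close>
  have alt: "alternating g (p + of_bool L + of_bool R - 1) a b" if pos: "0 < p + of_bool L + of_bool R"
  proof (cases L)
    case True
    define y' where "y' = case_nat (of_int a) y"
    show ?thesis
    proof (rule alternating_derivative[OF F g, where y = y' and \<sigma> = \<sigma>])
      fix k assume k: "k \<le> p + of_bool L + of_bool R - 1"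
      have "y' k < y' (Suc k) \<and> 0 < \<sigma> * (-1) ^ k * (F (y' (Suc k)) - F (y' k))"
      proof (cases k)
        case 0
        then show ?thesis using x[of 0] xF[of 0] L0[OF True] by (simp add: y'_def y_def)
      next
        case (Suc j)
        then show ?thesis using y[of j] k True by (auto simp: y'_def)
      qed
      then show "y' k < y' (Suc k)"
        "0 < \<sigma> * (-1) ^ k * (f (y' (Suc k)) / w i (y' (Suc k)) - f (y' k) / w i (y' k))"
        by (auto simp: F_def)
    qed (use True ylast in \<open>auto simp: y'_def\<close>)
  next
    case False
    show ?thesis
      by (rule alternating_derivative[OF F g, where y = y and \<sigma> = "- \<sigma>"])
        (use y pos False ylast in \<open>auto simp: F_def split: if_splits\<close>)
  qed
  show ?case
  \<comment> \<open>Without any increment there is nothing to pass down, and the claim is immediate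
    from \<open>a < b\<close>.\<close>
  proof (cases "p + of_bool L + of_bool R = 0")
    case True
    then show ?thesis using \<open>a < b\<close> by (auto split: if_splits)
  next
    case False
    then have "int (p + of_bool L + of_bool R - 1 + n * (of_bool L + of_bool R)) + 1 \<le> b - a + int n"
      using positive_weights_Suc[OF Suc.prems(2)]
      by (intro Suc.IH[OF sg _ alt \<open>a < b\<close> gL gR]) auto
    then show ?thesis using False by (auto simp: algebra_simps of_nat_diff split: if_splits)
  qed
qed

text \<open>Unique continuation inside a knot interval. Vanishing on a short interval passes down to
  all weighted derivatives; from the last one, a multiple of a positive weight, it comes back up,
  because a vanishing derivative leaves \<open>f / w i\<close> constant on the knot
  interval.\<close>

lemma chain_spline_zero_on_piece:
  assumes "chain_spline w i n f" "positive_weights w i n" "\<forall>x\<in>{u<..<v}. f x = 0"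
    "of_int l \<le> u" "u < v" "v \<le> of_int l + 1"
  shows "\<forall>x\<in>{of_int l<..<of_int l + 1}. f x = 0"
  using assms
proof (induction n arbitrary: i f)
  case 0
  then obtain c where c: "\<forall>x\<in>{of_int l<..<of_int l + 1}. f x = c * w i x"
    unfolding chain_spline.simps by blast
  have "f ((u + v) / 2) = 0" "(u + v) / 2 \<in> {of_int l<..<of_int l + 1}" using 0 by auto
  then have "c = 0" using c positive_weightsD(2)[OF 0(2), of "(u + v) / 2"] by auto
  then show ?case using c by auto
next
  case (Suc n)
  obtain g where F: "continuous_on UNIV (\<lambda>y. f y / w i y)"
    and g: "\<And>x. x \<notin> \<int> \<Longrightarrow> ((\<lambda>y. f y / w i y) has_real_derivative g x) (at x)"
    and sg: "chain_spline w (Suc i) n g"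
    using chain_spline_Suc_quotient[OF Suc.prems(1,2)] by blast
  have "\<forall>x\<in>{u<..<v}. g x = 0"
    using derivative_zero_on_piece[OF g, where u = u and v = v and l = l] Suc.prems by auto
  then have g0: "\<forall>x\<in>{of_int l<..<of_int l + 1}. g x = 0"
    using Suc.IH[OF sg positive_weights_Suc[OF Suc.prems(2)]] Suc.prems by auto
  have "((\<lambda>y. f y / w i y) has_field_derivative 0) (at x within {of_int l<..<of_int l + 1})"
    if "x \<in> {of_int l<..<of_int l + 1}" for x
    using g[OF not_Ints_unit_interval[OF that]] g0 that by (auto intro: DERIV_subset)
  then obtain c where c: "\<And>x. x \<in> {of_int l<..<of_int l + 1} \<Longrightarrow> f x / w i x = c"
    using has_field_derivative_zero_constant[of "{of_int l<..<of_int l + 1 :: real}" "\<lambda>y. f y / w i y"] by auto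
  have "f ((u + v) / 2) = 0" "(u + v) / 2 \<in> {of_int l<..<of_int l + 1}" using Suc.prems by auto
  then have "c = 0" using c by force
  then show ?case using c positive_weightsD(2)[OF Suc.prems(2)] by (metis divide_eq_0_iff less_irrefl)
qed

text \<open>Zeros are traded for sign changes of the first weighted derivative, which
  \<open>alternating_bound\<close> then counts. A nonzero value between two zeros forces the
  derivative to take both signs in that gap, so \<open>q\<close> gaps yield \<open>q\<close> sign
  changes.\<close>

lemma zeros_bound:
  fixes a b :: int
  assumes f: "chain_spline w i (Suc n) f" "positive_weights w i (Suc n)" and "a < b"
    and L: "L \<Longrightarrow> \<forall>x\<in>{of_int a - 1<..<of_int a}. f x = 0"
    and R: "R \<Longrightarrow> \<forall>x\<in>{of_int b<..<of_int b + 1}. f x = 0"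
    and z: "\<And>k. k < q \<Longrightarrow> z k < z (Suc k)" "\<And>k. k \<le> q \<Longrightarrow> f (z k) = 0"
    and ne: "\<And>k. k < q \<Longrightarrow> \<exists>x\<in>{z k<..<z (Suc k)}. f x \<noteq> 0"
    and ab: "\<And>k. k \<le> q \<Longrightarrow> of_int a \<le> z k \<and> z k \<le> of_int b" and "0 < q"
  shows "int (q + n * (of_bool L + of_bool R)) + 1 \<le> b - a + int n"
proof -
  obtain g where F: "continuous_on UNIV (\<lambda>y. f y / w i y)"
    and g: "\<And>x. x \<notin> \<int> \<Longrightarrow> ((\<lambda>y. f y / w i y) has_real_derivative g x) (at x)"
    and sg: "chain_spline w (Suc i) n g"
    using chain_spline_Suc_quotient[OF f] by blast
  define F where "F y = f y / w i y" for y
  note wpos = positive_weightsD(2)[OF f(2)]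
  have gL: "\<forall>x\<in>{of_int a - 1<..<of_int a}. g x = 0" if L
    using derivative_zero_on_piece[OF g, where l = "a - 1" and u = "of_int a - 1" and v = "of_int a"]
      L[OF that] by auto
  have gR: "\<forall>x\<in>{of_int b<..<of_int b + 1}. g x = 0" if R
    using derivative_zero_on_piece[OF g, where l = b and u = "of_int b" and v = "of_int b + 1"]
      R[OF that] by auto
  \<comment> \<open>The derivative takes the sign of \<open>F x\<close> on the way from the left
    zero to \<open>x\<close>, and the opposite sign on the way back to zero.\<close>
  have "\<exists>u v. z k < u \<and> u < v \<and> v < z (Suc k) \<and> u \<notin> \<int> \<and> v \<notin> \<int> \<and> g u * g v < 0" if k: "k < q" for k
  proof -
    obtain x where x: "z k < x" "x < z (Suc k)" "f x \<noteq> 0" using ne[OF k] by auto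
    define s where "s = F x"
    have s: "s \<noteq> 0" using x wpos[of x] by (auto simp: s_def F_def)
    have ss: "0 < s * s" using s by (auto simp: zero_less_mult_iff linorder_neq_iff)
    have F0: "F (z k) = 0" "F (z (Suc k)) = 0" using z(2)[of k] z(2)[of "Suc k"] k by (auto simp: F_def)
    have "0 < s * (F x - F (z k))" unfolding F0 s_def[symmetric] using ss by simp
    then obtain u where u: "u \<in> {z k<..<x} - \<int>" "0 < s * g u"
      using derivative_sign_off_Ints[OF F g x(1), of s] unfolding F_def by auto
    have "0 < (- s) * (F (z (Suc k)) - F x)" unfolding F0 s_def[symmetric] using ss by simp
    then obtain v where v: "v \<in> {x<..<z (Suc k)} - \<int>" "0 < (- s) * g v"
      using derivative_sign_off_Ints[OF F g x(2), of "- s"] unfolding F_def by auto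
    have "g u * g v < 0" using u(2) v(2) by (auto simp: zero_less_mult_iff mult_less_0_iff)
    then show ?thesis using u v by (intro exI[of _ u] exI[of _ v]) auto
  qed
  then obtain u v where uv: "\<And>k. k < q \<Longrightarrow> z k < u k \<and> u k < v k \<and> v k < z (Suc k) \<and> u k \<notin> \<int> \<and> v k \<notin> \<int> \<and> g (u k) * g (v k) < 0"
    by metis
  define \<sigma> where "\<sigma> = g (u 0)"
  have s0: "\<sigma> \<noteq> 0" using uv[OF \<open>0 < q\<close>] by (auto simp: \<sigma>_def)
  \<comment> \<open>The first gap contributes two points, \<open>u 0\<close> and then necessarily
    \<open>v 0\<close>. Every later gap contributes whichever of its two points has the sign that is
    due.\<close>
  define X where "X k = (case k of 0 \<Rightarrow> u 0 | Suc j \<Rightarrow> if 0 < \<sigma> * (-1) ^ k * g (v j) then v j else u j)" for k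
  have XSuc: "z j < X (Suc j) \<and> X (Suc j) < z (Suc j) \<and> X (Suc j) \<notin> \<int> \<and> 0 < \<sigma> * (-1) ^ Suc j * g (X (Suc j))"
    if "j < q" for j
  proof -
    have "0 < \<sigma> * (-1) ^ Suc j * g (u j)" if "\<not> 0 < \<sigma> * (-1) ^ Suc j * g (v j)"
      using that uv[OF \<open>j < q\<close>] s0 by (cases "even j") (auto simp: zero_less_mult_iff mult_less_0_iff not_less)
    then show ?thesis using uv[OF that] by (auto simp: X_def)
  qed
  have X0: "z 0 < X 0 \<and> X 0 < X 1 \<and> X 0 \<notin> \<int> \<and> 0 < \<sigma> * g (X 0)"
    using uv[OF \<open>0 < q\<close>] s0 by (auto simp: X_def \<sigma>_def zero_less_mult_iff mult_less_0_iff)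
  have "X k < X (Suc k)" if "k < q" for k
    using X0 XSuc[OF that] XSuc[of "k - 1"] that by (cases k) auto
  moreover have "a < X k \<and> X k < b \<and> X k \<notin> \<int> \<and> 0 < \<sigma> * (-1) ^ k * g (X k)" if "k \<le> q" for k
  proof (cases k)
    case 0
    then show ?thesis using X0 XSuc[OF \<open>0 < q\<close>] ab[of 0] ab[of 1] \<open>0 < q\<close> by auto
  next
    case (Suc j)
    then show ?thesis using XSuc[of j] ab[of j] ab[of k] that by auto
  qed
  ultimately have "alternating g q a b"
    unfolding alternating_def by (intro exI[of _ X] exI[of _ \<sigma>]) auto
  then show ?thesis
    by (intro alternating_bound[OF sg positive_weights_Suc[OF f(2)] _ \<open>a < b\<close> gL gR])
qed

text \<open>If the piece were not zero, it would offer two zeros, \<open>x\<close> and the end point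
  shared with the neighbouring zero piece. With one zero side, \<open>zeros_bound\<close> would then
  read 1 + n + 1 <= 1 + n.\<close>

lemma zero_extends_to_adjacent_piece:
  fixes a :: int
  assumes f: "chain_spline w i (Suc n) f" "positive_weights w i (Suc n)"
    and adj: "(\<forall>y\<in>{of_int a - 1<..<of_int a}. f y = 0) \<or> (\<forall>y\<in>{of_int a + 1<..<of_int a + 2}. f y = 0)"
    and x: "x \<in> {of_int a<..<of_int a + 1}" "f x = 0"
  shows "\<forall>y\<in>{of_int a<..<of_int a + 1}. f y = 0"
proof (rule ccontr)
  assume non: "\<not> ?thesis"
  have contf: "continuous_on UNIV f" using f(1) by simp
  have ne: "\<exists>y\<in>{u<..<v}. f y \<noteq> 0" if "of_int a \<le> u" "u < v" "v \<le> of_int a + 1" for u v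
    using chain_spline_zero_on_piece[OF f _ that] non by blast
  define L where "L \<longleftrightarrow> (\<forall>y\<in>{of_int a - 1<..<of_int a}. f y = 0)"
  define z where "z k = (if L then if k = 0 then of_int a else x else if k = 0 then x else of_int a + 1)" for k :: nat
  have a0: "f (of_int a) = 0" if L
    using continuous_zero_closure[OF contf that[unfolded L_def]] by simp
  have a1: "f (of_int a + 1) = 0" if "\<not> L"
  proof -
    have "\<forall>y\<in>{of_int a + 1<..<of_int a + 2}. f y = 0" using adj that unfolding L_def by blast
    then show ?thesis using continuous_zero_closure[OF contf, of "of_int a + 1" "of_int a + 2"] by simp
  qed
  have "int (1 + n * (of_bool L + of_bool (\<not> L))) + 1 \<le> (a + 1) - a + int n"
  proof (rule zeros_bound[OF f, where z = z])
    show "\<exists>x\<in>{z k<..<z (Suc k)}. f x \<noteq> 0" if "k < 1" for k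
      using ne[of "of_int a" x] ne[of x "of_int a + 1"] x that by (auto simp: z_def)
    show "\<forall>x\<in>{of_int (a + 1)<..<of_int (a + 1) + 1}. f x = 0" if "\<not> L"
      using that adj by (auto simp: L_def algebra_simps)
  qed (use x a0 a1 in \<open>auto simp: z_def L_def\<close>)
  then show False by (cases L) auto
qed

text \<open>The minimal support property. A nonzero value is an alternation with no sign change, and
  two zero sides turn the count into 2n + 1 <= b - a + n, which fails on at most \<open>n\<close>
  knot intervals.\<close>

lemma zero_on_short_gap:
  fixes a b :: int
  assumes f: "chain_spline w i n f" "positive_weights w i n" and "a < b" "b - a \<le> int n"
    and L: "\<forall>x\<in>{of_int a - 1<..<of_int a}. f x = 0"
    and R: "\<forall>x\<in>{of_int b<..<of_int b + 1}. f x = 0"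
    and x: "of_int a < x" "x < of_int b" "x \<notin> \<int>"
  shows "f x = 0"
proof (rule ccontr)
  assume "f x \<noteq> 0"
  then have "0 < f x * f x" by (simp add: zero_less_mult_iff linorder_neq_iff) blast
  then have "alternating f 0 a b"
    unfolding alternating_def using x by (intro exI[of _ "\<lambda>_. x"] exI[of _ "f x"]) auto
  then have "int (0 + n * (of_bool True + of_bool True)) + 1 \<le> b - a + int n"
    using f assms by (intro alternating_bound[of w i n f 0 a b True True]) auto
  then show False using assms(4) by simp
qed

section \<open>Linear combinations and integer translates of splines\<close>

lemma chain_spline_cmult:
  "chain_spline w i n f \<Longrightarrow> chain_spline w i n (\<lambda>x. c * f x)"
proof (induction n arbitrary: i f)
  case 0
  then show ?case by simp (metis mult.assoc)
next
  case (Suc n)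
  then obtain g where "\<forall>x. x \<notin> \<int> \<longrightarrow> ((\<lambda>y. f y / w i y) has_real_derivative g x) (at x)"
    "chain_spline w (Suc i) n g" by auto
  note g = this
  have "((\<lambda>y. c * f y / w i y) has_real_derivative c * g x) (at x)" if "x \<notin> \<int>" for x
    using DERIV_cmult[OF g(1)[rule_format, OF that], of c] by simp
  moreover have "chain_spline w (Suc i) n (\<lambda>x. c * g x)" by (rule Suc.IH[OF g(2)])
  moreover have "continuous_on UNIV (\<lambda>x. c * f x)"
    using Suc.prems by (auto intro!: continuous_intros)
  ultimately show ?case
    unfolding chain_spline.simps by (intro conjI exI[of _ "\<lambda>x. c * g x"]) auto
qed

lemma chain_spline_add:
  "chain_spline w i n f \<Longrightarrow> chain_spline w i n f' \<Longrightarrow> chain_spline w i n (\<lambda>x. f x + f' x)"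
proof (induction n arbitrary: i f f')
  case 0
  show ?case
    unfolding chain_spline.simps
  proof
    fix l :: int
    obtain c c' where "\<forall>x\<in>{of_int l<..<of_int l + 1}. f x = c * w i x"
      "\<forall>x\<in>{of_int l<..<of_int l + 1}. f' x = c' * w i x"
      using 0 unfolding chain_spline.simps by meson
    then show "\<exists>c. \<forall>x\<in>{of_int l<..<of_int l + 1}. f x + f' x = c * w i x"
      by (intro exI[of _ "c + c'"]) (simp add: distrib_right)
  qed
next
  case (Suc n)
  then obtain g g' where "\<forall>x. x \<notin> \<int> \<longrightarrow> ((\<lambda>y. f y / w i y) has_real_derivative g x) (at x)"
    "chain_spline w (Suc i) n g"
    "\<forall>x. x \<notin> \<int> \<longrightarrow> ((\<lambda>y. f' y / w i y) has_real_derivative g' x) (at x)"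
    "chain_spline w (Suc i) n g'" by auto
  then have "\<forall>x. x \<notin> \<int> \<longrightarrow> ((\<lambda>y. (f y + f' y) / w i y) has_real_derivative g x + g' x) (at x)"
    "chain_spline w (Suc i) n (\<lambda>x. g x + g' x)"
    using Suc.IH by (auto simp: add_divide_distrib intro!: DERIV_add)
  then show ?case using Suc.prems by (auto intro!: continuous_intros)
qed

lemma chain_spline_0: "chain_spline w i n (\<lambda>_. 0)"
  by (induction n arbitrary: i) (auto intro!: exI[of _ "\<lambda>_. 0"] exI[of _ 0])

lemma chain_spline_sum:
  "(\<And>k. k \<in> K \<Longrightarrow> chain_spline w i n (f k)) \<Longrightarrow> chain_spline w i n (\<lambda>x. \<Sum>k\<in>K. f k x)"
  by (induction K rule: infinite_finite_induct) (auto intro: chain_spline_0 chain_spline_add)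

text \<open>An exponential times a 1-periodic function satisfies this with
  \<open>d = exp (\<gamma> s * k)\<close>; this is the form in which the shape of the PEB weights
  enters.\<close>

definition quasi_periodic :: "(nat \<Rightarrow> real \<Rightarrow> real) \<Rightarrow> nat \<Rightarrow> nat \<Rightarrow> bool" where
  "quasi_periodic w i n \<longleftrightarrow> (\<forall>s\<in>{i..i + n}. \<forall>k::int. \<exists>d. \<forall>x. w s (x + of_int k) = d * w s x)"

text \<open>An integer shift maps knots to knots and multiplies the shifted quotient by the factor
  \<open>d\<close> of the weight, so the translate is a spline for the same, unshifted
  weights.\<close>

lemma chain_spline_translate:
  assumes "chain_spline w i n f" "positive_weights w i n" "quasi_periodic w i n"
  shows "chain_spline w i n (\<lambda>x. f (x + of_int k))"
  using assms
proof (induction n arbitrary: i f)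
  case 0
  show ?case
    unfolding chain_spline.simps
  proof
    fix l :: int
    obtain c where c: "\<forall>x\<in>{of_int (l + k)<..<of_int (l + k) + 1}. f x = c * w i x"
      using 0(1) unfolding chain_spline.simps by meson
    obtain d where "\<And>x. w i (x + of_int k) = d * w i x"
      using 0(3) unfolding quasi_periodic_def by (meson atLeastAtMost_iff le_add1 order_refl)
    then show "\<exists>c. \<forall>x\<in>{of_int l<..<of_int l + 1}. f (x + of_int k) = c * w i x"
      using c by (intro exI[of _ "c * d"]) auto
  qed
next
  case (Suc n)
  obtain d where d: "\<And>x. w i (x + of_int k) = d * w i x"
    using Suc.prems(3) unfolding quasi_periodic_def by (meson atLeastAtMost_iff le_add1 order_refl)
  then have "d \<noteq> 0" using positive_weightsD(2)[OF Suc.prems(2)] by (metis less_irrefl mult_zero_left)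
  obtain g where g: "\<And>x. x \<notin> \<int> \<Longrightarrow> ((\<lambda>y. f y / w i y) has_real_derivative g x) (at x)"
    and sg: "chain_spline w (Suc i) n g"
    using chain_spline_Suc_quotient[OF Suc.prems(1,2)] by blast
  have "quasi_periodic w (Suc i) n"
    using Suc.prems(3) unfolding quasi_periodic_def by auto
  then have "chain_spline w (Suc i) n (\<lambda>x. d * g (x + of_int k))"
    by (intro chain_spline_cmult Suc.IH[OF sg positive_weights_Suc[OF Suc.prems(2)]])
  moreover have "((\<lambda>y. f (y + of_int k) / w i y) has_real_derivative d * g (x + of_int k)) (at x)" if "x \<notin> \<int>" for x
  proof -
    have "x + of_int k \<notin> \<int>" using that by (metis Ints_diff Ints_of_int add_diff_cancel_right')
    then have "((\<lambda>y. f (y + of_int k) / w i (y + of_int k)) has_real_derivative g (x + of_int k)) (at x)"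
      using g[of "x + of_int k"] by (simp add: DERIV_shift)
    from DERIV_cmult[OF this, of d] show ?thesis using d \<open>d \<noteq> 0\<close> by simp
  qed
  moreover have "continuous_on UNIV (\<lambda>x. f (x + of_int k))"
    using Suc.prems(1) by (auto intro!: continuous_on_compose2[of UNIV f] continuous_intros)
  ultimately show ?case
    unfolding chain_spline.simps by (intro conjI exI[of _ "\<lambda>x. d * g (x + of_int k)"]) auto
qed

section \<open>Splines determined by their samples on a window\<close>

lemma sample_in_unit_interval:
  fixes t \<alpha> :: real
  assumes "0 < \<alpha>" "\<alpha> < 1"
  shows "\<exists>j::int. a < t - \<alpha> * of_int j \<and> t - \<alpha> * of_int j < a + 1"
proof -
  \<comment> \<open>The largest integer strictly below \<open>(t - a) / \<alpha>\<close>: the sample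
    then lies above \<open>a\<close> by at most \<open>\<alpha>\<close>, hence inside the open unit
    interval.\<close>
  define j where "j = \<lceil>(t - a) / \<alpha>\<rceil> - 1"
  have "of_int j < (t - a) / \<alpha>" "(t - a) / \<alpha> \<le> of_int j + 1"
    unfolding j_def by linarith+
  then have "\<alpha> * of_int j < t - a" "t - a \<le> \<alpha> * of_int j + \<alpha>"
    using assms by (auto simp: field_simps)
  then show ?thesis using assms by (intro exI[of _ j]) linarith
qed

text \<open>The order of the spline is \<open>n + 2\<close>, so its chain has \<open>Suc n\<close>
  derivatives. The sampling and frame arguments work from these properties alone, away from the
  explicit weights.\<close>

locale spline_generator =
  fixes w :: "nat \<Rightarrow> real \<Rightarrow> real" and n :: nat and \<phi> :: "real \<Rightarrow> real"
  assumes chain: "chain_spline w 1 (Suc n) \<phi>"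
    and weights: "positive_weights w 1 (Suc n)" "quasi_periodic w 1 (Suc n)"
    and support: "\<phi> x \<noteq> 0 \<longleftrightarrow> 0 < x \<and> x < real (n + 2)"
begin

lemma continuous: "continuous_on UNIV \<phi>"
  using chain by simp

lemma translates_chain: "chain_spline w 1 (Suc n) (\<lambda>x. \<Sum>k\<in>K. c k * \<phi> (x + of_int k))"
  by (intro chain_spline_sum chain_spline_cmult chain_spline_translate chain weights)

text \<open>\<open>K\<close> lists exactly the translates whose support meets (-N, N). The
  combination lives on [-N - n - 1, N + n + 1], so outside the window two gaps of
  \<open>n + 1\<close> knot intervals remain, too short to carry a nonzero spline. The combination
  thus vanishes off the knots, and its leftmost translate gives a contradiction.\<close>

lemma local_linear_independence:
  fixes N :: nat and c :: "int \<Rightarrow> real"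
  defines "K \<equiv> {1 - int N..int N + int n + 1}"
  defines "f \<equiv> \<lambda>x. \<Sum>k\<in>K. c k * \<phi> (x + of_int k)"
  assumes "1 \<le> N" and zero: "\<And>x. - real N < x \<Longrightarrow> x < real N \<Longrightarrow> f x = 0" and "k \<in> K"
  shows "c k = 0"
proof (rule ccontr)
  assume "c k \<noteq> 0"
  have chf: "chain_spline w 1 (Suc n) f" unfolding f_def by (rule translates_chain)
  have out: "f x = 0" if "real N + real n + 1 \<le> x \<or> x \<le> - real N - real n - 1" for x
    unfolding f_def
  proof (intro sum.neutral ballI)
    fix k assume "k \<in> K"
    then have "real_of_int (1 - int N) \<le> of_int k" "of_int k \<le> real_of_int (int N + int n + 1)"
      unfolding K_def atLeastAtMost_iff of_int_le_iff by auto
    then have "\<not> (0 < x + of_int k \<and> x + of_int k < real (n + 2))"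
      using that by auto
    then show "c k * \<phi> (x + of_int k) = 0" using support by auto
  qed
  have f0: "f x = 0" if "x \<notin> \<int>" for x
  proof -
    have "f x = 0" if "real N < x" "x < real N + real n + 1"
      using zero_on_short_gap[OF chf weights(1), of "int N" "int N + int n + 1" x] zero out that \<open>x \<notin> \<int>\<close> \<open>1 \<le> N\<close>
      by auto
    moreover have "f x = 0" if "x < - real N" "- real N - real n - 1 < x"
      using zero_on_short_gap[OF chf weights(1), of "- int N - int n - 1" "- int N" x] zero out that \<open>x \<notin> \<int>\<close> \<open>1 \<le> N\<close>
      by auto
    moreover have "x \<noteq> real N" "x \<noteq> - real N" using that by auto
    ultimately show ?thesis using out zero by (metis linorder_less_linear not_le)
  qed
  \<comment> \<open>The largest index with a nonzero coefficient belongs to the translate that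
    reaches furthest to the left; at 1/2 - M no other one is alive.\<close>
  define M where "M = Max {k \<in> K. c k \<noteq> 0}"
  have fin: "finite {k \<in> K. c k \<noteq> 0}" by (rule finite_subset[of _ K]) (auto simp: K_def)
  have M: "M \<in> K" "c M \<noteq> 0"
    using Max_in[OF fin] \<open>k \<in> K\<close> \<open>c k \<noteq> 0\<close> unfolding M_def by auto
  have "f (1/2 - of_int M) = (\<Sum>k\<in>{M}. c k * \<phi> (1/2 - of_int M + of_int k))"
    unfolding f_def
  proof (intro sum.mono_neutral_right ballI)
    fix k assume k: "k \<in> K - {M}"
    show "c k * \<phi> (1/2 - of_int M + of_int k) = 0"
    proof (cases "c k = 0")
      case False
      then have "k \<le> M" using Max_ge[OF fin, of k] k unfolding M_def by auto
      then have "real_of_int k \<le> of_int M - 1" using k by auto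
      then show ?thesis using support[of "1/2 - of_int M + of_int k"] by auto
    qed simp
  qed (use M K_def in auto)
  moreover have "\<phi> (1/2) \<noteq> 0" using support[of "1/2"] by simp
  ultimately have "f (1/2 - of_int M) \<noteq> 0" using M by simp
  moreover have "1/2 - of_int M \<notin> (\<int> :: real set)"
    using not_Ints_unit_interval[of "1/2 - of_int M" "- M"] by auto
  ultimately show False using f0 by blast
qed

text \<open>The hypothesis on \<open>N\<close> fits \<open>2 * N + n + 1\<close> consecutive samples
  into the window: the first lies within 1 of the left end, and the steps to the last take up at
  most 2N - 1. That is one zero more than \<open>zeros_bound\<close> permits, so some knot interval
  is zero; from there zero spreads to neighbours, since every knot interval contains a
  sample.\<close>

lemma zero_of_zero_samples:
  fixes N :: nat
  assumes \<alpha>: "0 < \<alpha>" "\<alpha> < 1" and N: "\<alpha> * (2 * real N + real n) \<le> 2 * real N - 1"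
    and f: "chain_spline w 1 (Suc n) f"
    and zero: "\<And>j::int. - real N < t - \<alpha> * of_int j \<Longrightarrow> t - \<alpha> * of_int j < real N \<Longrightarrow> f (t - \<alpha> * of_int j) = 0"
    and x: "- real N < x" "x < real N"
  shows "f x = 0"
proof -
  let ?Z = "\<lambda>l::int. \<forall>x\<in>{of_int l<..<of_int l + 1}. f x = 0"
  have contf: "continuous_on UNIV f" using f by simp
  have "0 \<le> \<alpha> * (2 * real N + real n)" using \<alpha> by simp
  then have N1: "1 \<le> N" using N by linarith
  obtain j0 :: int where j0: "- real N < t - \<alpha> * of_int j0" "t - \<alpha> * of_int j0 < - real N + 1"
    using sample_in_unit_interval[OF \<alpha>] by blast
  define z where "z k = t - \<alpha> * of_int (j0 - int k)" for k :: nat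
  have z: "z k = z 0 + \<alpha> * real k" for k by (simp add: z_def algebra_simps)
  have zin: "- real N < z k \<and> z k < real N" if "k \<le> 2 * N + n" for k
  proof -
    have "\<alpha> * real k \<le> \<alpha> * (2 * real N + real n)" using that \<alpha> by (intro mult_left_mono) auto
    moreover have "0 \<le> \<alpha> * real k" using \<alpha> by simp
    ultimately show ?thesis using z[of k] j0 N by (simp add: z_def)
  qed
  have "\<exists>l. - int N \<le> l \<and> l < int N \<and> ?Z l"
  proof (rule ccontr)
    assume none: "\<not> ?thesis"
    have ne: "\<exists>x\<in>{z k<..<z (Suc k)}. f x \<noteq> 0" if k: "k < 2 * N + n" for k
    proof (rule ccontr)
      assume *: "\<not> ?thesis"
      have zk: "z k < z (Suc k)" using z[of k] z[of "Suc k"] \<alpha> by (simp add: algebra_simps)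
      \<comment> \<open>The gap between two samples may contain a knot, so it is cut off at the
        first one.\<close>
      have "?Z \<lfloor>z k\<rfloor>"
        using * zk by (intro chain_spline_zero_on_piece[OF f weights(1), where u = "z k"
              and v = "min (z (Suc k)) (of_int \<lfloor>z k\<rfloor> + 1)"]) auto
      moreover have "- int N \<le> \<lfloor>z k\<rfloor>" "\<lfloor>z k\<rfloor> < int N"
        using zin[of k] k by (auto simp: le_floor_iff floor_less_iff)
      ultimately show False using none by blast
    qed
    have "int (2 * N + n + n * (of_bool False + of_bool False)) + 1 \<le> int N - (- int N) + int n"
    proof (rule zeros_bound[OF f weights(1), where z = z])
      show "z k < z (Suc k)" for k using z[of k] z[of "Suc k"] \<alpha> by (simp add: algebra_simps)
      show "f (z k) = 0" if "k \<le> 2 * N + n" for k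
        using zero[of "j0 - int k"] zin[OF that] by (auto simp: z_def)
      show "real_of_int (- int N) \<le> z k \<and> z k \<le> real_of_int (int N)" if "k \<le> 2 * N + n" for k
        using zin[OF that] by auto
    qed (use N1 ne in auto)
    then show False by simp
  qed
  then obtain l where l: "- int N \<le> l" "l < int N" "?Z l" by blast
  have sample: "\<exists>y\<in>{of_int k<..<of_int k + 1}. f y = 0" if "- int N \<le> k" "k < int N" for k
  proof -
    obtain j :: int where "of_int k < t - \<alpha> * of_int j" "t - \<alpha> * of_int j < of_int k + 1"
      using sample_in_unit_interval[OF \<alpha>] by blast
    moreover have "- real N \<le> of_int k" "of_int k + 1 \<le> real N" using that by linarith+
    ultimately show ?thesis using zero[of j] by (intro bexI[of _ "t - \<alpha> * of_int j"]) auto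
  qed
  have up: "k < int N \<longrightarrow> ?Z k" if "l \<le> k" for k
    using that
  proof (induction k rule: int_ge_induct)
    case (step k)
    show ?case
    proof
      assume k: "k + 1 < int N"
      obtain y where "y \<in> {of_int (k + 1)<..<of_int (k + 1) + 1}" "f y = 0"
        using sample[of "k + 1"] step l k by auto
      then show "?Z (k + 1)"
        by (rule zero_extends_to_adjacent_piece[OF f weights(1), rotated]) (use step k in auto)
    qed
  qed (use l in simp)
  have down: "- int N \<le> k \<longrightarrow> ?Z k" if "k \<le> l" for k
    using that
  proof (induction k rule: int_le_induct)
    case (step k)
    show ?case
    proof
      assume k: "- int N \<le> k - 1"
      obtain y where "y \<in> {of_int (k - 1)<..<of_int (k - 1) + 1}" "f y = 0"
        using sample[of "k - 1"] step l k by auto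
      then show "?Z (k - 1)"
        by (rule zero_extends_to_adjacent_piece[OF f weights(1), rotated]) (use step k in auto)
    qed
  qed (use l in simp)
  have "- int N \<le> \<lfloor>x\<rfloor>" "\<lfloor>x\<rfloor> < int N" using x by (auto simp: le_floor_iff floor_less_iff)
  then have "?Z \<lfloor>x\<rfloor>" using up[of "\<lfloor>x\<rfloor>"] down[of "\<lfloor>x\<rfloor>"] by linarith
  then show ?thesis
    by (rule continuous_zero_closure[OF contf]) (auto intro: less_imp_le)
qed

end

section \<open>PEB-splines as spline generators\<close>

lemma cont_diff_imp_continuous: "cont_diff k f \<Longrightarrow> continuous_on UNIV f"
proof (cases k)
  case (Suc n)
  moreover assume "cont_diff k f"
  ultimately show ?thesis by (auto intro!: continuous_at_imp_continuous_on) (meson DERIV_isCont)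
qed simp

lemma cont_diff_SucD: "cont_diff (Suc k) f \<Longrightarrow> cont_diff k f"
proof (induction k arbitrary: f)
  case 0
  then show ?case using cont_diff_imp_continuous by (metis cont_diff.simps(1))
qed (metis cont_diff.simps(2))

lemma cont_diff_const: "cont_diff k (\<lambda>_. c)"
  by (induction k arbitrary: c) (auto intro!: exI[of _ "\<lambda>_. 0"])

lemma cont_diff_exp: "cont_diff k (\<lambda>x. c * exp (a * x))"
proof (induction k arbitrary: c)
  case (Suc k)
  have "((\<lambda>x. c * exp (a * x)) has_real_derivative (c * a) * exp (a * x)) (at x)" for x
    by (auto intro!: derivative_eq_intros)
  then show ?case using Suc by (auto intro!: exI[of _ "\<lambda>x. (c * a) * exp (a * x)"])
qed (auto intro!: continuous_intros)

lemma cont_diff_add: "cont_diff k f \<Longrightarrow> cont_diff k g \<Longrightarrow> cont_diff k (\<lambda>x. f x + g x)"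
proof (induction k arbitrary: f g)
  case (Suc k)
  then obtain f' g' where "\<forall>x. (f has_real_derivative f' x) (at x)" "cont_diff k f'"
    "\<forall>x. (g has_real_derivative g' x) (at x)" "cont_diff k g'" by auto
  then show ?case using Suc.IH by (auto intro!: exI[of _ "\<lambda>x. f' x + g' x"] DERIV_add)
qed (auto intro!: continuous_intros)

lemma cont_diff_mult: "cont_diff k f \<Longrightarrow> cont_diff k g \<Longrightarrow> cont_diff k (\<lambda>x. f x * g x)"
proof (induction k arbitrary: f g)
  case (Suc k)
  then obtain f' g' where d: "\<And>x. (f has_real_derivative f' x) (at x)" "cont_diff k f'"
    "\<And>x. (g has_real_derivative g' x) (at x)" "cont_diff k g'" by auto
  have "cont_diff k (\<lambda>x. f x * g' x + f' x * g x)"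
    by (intro cont_diff_add Suc.IH d Suc.prems[THEN cont_diff_SucD])
  then show ?case
    using DERIV_mult'[OF d(1,3)] by (auto intro!: exI[of _ "\<lambda>x. f x * g' x + f' x * g x"])
qed (auto intro!: continuous_intros)

lemma cont_diff_inverse:
  "cont_diff k f \<Longrightarrow> (\<And>x. f x \<noteq> 0) \<Longrightarrow> cont_diff k (\<lambda>x. inverse (f x))"
proof (induction k arbitrary: f)
  case (Suc k)
  then obtain f' where d: "\<And>x. (f has_real_derivative f' x) (at x)" "cont_diff k f'" by auto
  have "cont_diff k (\<lambda>x. (- 1) * (inverse (f x) * f' x * inverse (f x)))"
    by (intro cont_diff_mult cont_diff_const d Suc.IH Suc.prems cont_diff_SucD[OF Suc.prems(1)])
  then show ?case
    using DERIV_inverse'[OF d(1) Suc.prems(2)]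
    by (auto intro!: exI[of _ "\<lambda>x. - (inverse (f x) * f' x * inverse (f x))"])
qed (auto intro!: continuous_intros)

lemma nested_primitive_derivative:
  fixes g :: "real \<Rightarrow> real"
  assumes "continuous_on UNIV g"
  shows "((\<lambda>x. LBINT t=ereal 0..ereal x. g t) has_real_derivative g x) (at x)"
proof -
  \<comment> \<open>An interval with both 0 and \<open>x\<close> in its interior, since the oriented
    integral may run in either direction.\<close>
  let ?a = "- \<bar>x\<bar> - 1" and ?b = "\<bar>x\<bar> + 1"
  have "((\<lambda>x. LBINT t=ereal 0..ereal x. g t) has_vector_derivative g x) (at x within {?a..?b})"
    using assms by (intro interval_integral_FTC2) (auto intro: continuous_on_subset)
  moreover have "at x within {?a..?b} = at x" by (rule at_within_interior) auto
  ultimately show ?thesis by (simp add: has_real_derivative_iff_has_vector_derivative)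
qed

lemma continuous_nested:
  assumes "\<And>j. j \<le> s \<Longrightarrow> continuous_on UNIV (w (i + j))"
  shows "continuous_on UNIV (nested w i s)"
  using assms
proof (induction s arbitrary: i)
  case 0
  from 0[of 0] show ?case by (simp cong: continuous_on_cong)
next
  case (Suc s)
  have "continuous_on UNIV (nested w (Suc i) s)"
    using Suc.prems[of "Suc j" for j] by (intro Suc.IH) auto
  then have "isCont (\<lambda>x. LBINT t=ereal 0..ereal x. nested w (Suc i) s t) x" for x
    by (rule DERIV_isCont[OF nested_primitive_derivative])
  then have "continuous_on UNIV (\<lambda>x. LBINT t=ereal 0..ereal x. nested w (Suc i) s t)"
    by (simp add: continuous_at_imp_continuous_on)
  then show ?case using Suc.prems[of 0] by (auto intro!: continuous_intros cong: continuous_on_cong)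
qed

text \<open>On each piece, dividing by \<open>w i\<close> leaves a constant plus integrals from 0,
  and differentiating strips these integrals: a combination of \<open>nested w (Suc i)\<close> with
  one term fewer remains. The quotient \<open>f / w i\<close> is as smooth as \<open>f\<close>, so
  the smoothness demanded of the next member matches its shorter chain.\<close>

lemma chain_spline_of_pieces:
  assumes "\<And>s. s \<le> n \<Longrightarrow> cont_diff (n - s) (w (i + s))" "\<And>s x. s \<le> n \<Longrightarrow> 0 < w (i + s) x"
    and "0 < n \<Longrightarrow> cont_diff (n - 1) f"
    and "\<And>l::int. \<exists>c. \<forall>x\<in>{of_int l<..<of_int l + 1}. f x = (\<Sum>s\<le>n. c s * nested w i s x)"
  shows "chain_spline w i n f"
  using assms
proof (induction n arbitrary: i f)
  case 0
  show ?case
    unfolding chain_spline.simps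
  proof
    fix l :: int
    show "\<exists>c. \<forall>x\<in>{of_int l<..<of_int l + 1}. f x = c * w i x"
      using 0(4)[of l] by auto
  qed
next
  case (Suc n)
  have wpos: "0 < w i x" for x using Suc.prems(2)[of 0 x] by simp
  have wcd: "cont_diff n (w i)" using Suc.prems(1)[of 0] cont_diff_SucD by simp
  have fcd: "cont_diff n f" using Suc.prems(3) by simp
  define F where "F x = f x / w i x" for x
  have Fcd: "cont_diff n F"
    unfolding F_def[abs_def] divide_inverse
    by (intro cont_diff_mult cont_diff_inverse fcd wcd) (metis wpos less_irrefl)
  have wcont: "continuous_on UNIV (w (Suc i + j))" if "j \<le> n" for j
    using Suc.prems(1)[of "Suc j"] that cont_diff_imp_continuous by auto
  have Fder: "\<exists>c. \<forall>x\<in>{of_int l<..<of_int l + 1}.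
      (F has_real_derivative (\<Sum>s\<le>n. c s * nested w (Suc i) s x)) (at x)" for l :: int
  proof -
    obtain c where c: "\<And>x. x \<in> {of_int l<..<of_int l + 1} \<Longrightarrow> f x = (\<Sum>s\<le>Suc n. c s * nested w i s x)"
      using Suc.prems(4)[of l] by blast
    define G where "G x = c 0 + (\<Sum>s\<le>n. c (Suc s) * (LBINT t=ereal 0..ereal x. nested w (Suc i) s t))" for x
    have FG: "F x = G x" if "x \<in> {of_int l<..<of_int l + 1}" for x
    proof -
      have "f x = w i x * G x"
        unfolding c[OF that] sum.atMost_Suc_shift G_def
        by (simp add: algebra_simps sum_distrib_left)
      then show ?thesis using wpos[of x] by (simp add: F_def)
    qed
    have "(G has_real_derivative 0 + (\<Sum>s\<le>n. c (Suc s) * nested w (Suc i) s x)) (at x)" for x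
      unfolding G_def[abs_def]
      by (intro DERIV_add DERIV_const DERIV_sum DERIV_cmult nested_primitive_derivative continuous_nested wcont) auto
    then have "(G has_real_derivative (\<Sum>s\<le>n. c (Suc s) * nested w (Suc i) s x)) (at x)" for x
      by simp
    then have "(F has_real_derivative (\<Sum>s\<le>n. c (Suc s) * nested w (Suc i) s x)) (at x)"
      if "x \<in> {of_int l<..<of_int l + 1}" for x
      by (rule has_field_derivative_transform_within_open[OF _ open_greaterThanLessThan that]) (simp add: FG)
    then show ?thesis by (intro exI[of _ "\<lambda>s. c (Suc s)"]) blast
  qed
  \<comment> \<open>\<open>deriv\<close> is unspecified where \<open>F\<close> is not
    differentiable, which can happen only at integers. For \<open>0 < n\<close> the quotient is
    differentiable everywhere and \<open>g\<close> is its genuine derivative.\<close>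
  define g where "g x = deriv F x" for x
  have g: "(F has_real_derivative g x) (at x)" if "x \<notin> \<int>" for x
  proof -
    have "of_int \<lfloor>x\<rfloor> \<noteq> x" using that by (metis Ints_of_int)
    then have "x \<in> {of_int \<lfloor>x\<rfloor><..<of_int \<lfloor>x\<rfloor> + 1}"
      using floor_correct[of x] unfolding greaterThanLessThan_iff by linarith
    then obtain D where "(F has_real_derivative D) (at x)" using Fder[of "\<lfloor>x\<rfloor>"] by blast
    then show ?thesis using DERIV_imp_deriv unfolding g_def by metis
  qed
  have "chain_spline w (Suc i) n g"
  proof (rule Suc.IH)
    show "cont_diff (n - s) (w (Suc i + s))" "0 < w (Suc i + s) x" if "s \<le> n" for s x
      using Suc.prems(1,2)[of "Suc s"] that by auto
    show "cont_diff (n - 1) g" if n: "0 < n"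
    proof -
      obtain n' where n': "n = Suc n'" using n by (cases n) auto
      obtain F' where F': "\<And>x. (F has_real_derivative F' x) (at x)" "cont_diff n' F'"
        using Fcd unfolding n' by auto
      have "g = F'" using DERIV_imp_deriv[OF F'(1)] by (auto simp: g_def)
      then show ?thesis using F' n' by simp
    qed
    show "\<exists>c. \<forall>x\<in>{of_int l<..<of_int l + 1}. g x = (\<Sum>s\<le>n. c s * nested w (Suc i) s x)" for l :: int
      using Fder[of l] DERIV_imp_deriv unfolding g_def by metis
  qed
  then show ?case
    using g cont_diff_imp_continuous[OF fcd] unfolding chain_spline.simps F_def[abs_def] by blast
qed

lemma periodic_int_shift:
  fixes f :: "real \<Rightarrow> 'a"
  assumes "\<And>x. f (x + 1) = f x"
  shows "f (x + of_int k) = f x"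
proof (induction k rule: int_induct[where k = 0])
  case (step1 k)
  then show ?case using assms[of "x + of_int k"] by (simp add: add.assoc)
next
  case (step2 k)
  then show ?case using assms[of "x + of_int (k - 1)"] by (simp add: add.assoc)
qed simp

lemma PEB_spline_generator:
  assumes m: "2 \<le> m" and "is_PEB_spline m \<gamma> r \<phi>"
  shows "spline_generator (weight \<gamma> r) (m - 2) \<phi>"
proof -
  define w n where "w = weight \<gamma> r" and "n = m - 2"
  have mn: "m = n + 2" using m by (simp add: n_def)
  have adm: "cont_diff (m - s) (r s)" "0 < r s x" "r s (x + 1) = r s x" if "1 \<le> s" "s \<le> m" for s x
    using assms that unfolding is_PEB_spline_def admissible_weights_def by auto
  have \<phi>: "cont_diff (m - 2) \<phi>" "closure {x. \<phi> x \<noteq> 0} = {0..real m}" "\<And>x. 0 < x \<Longrightarrow> x < real m \<Longrightarrow> 0 < \<phi> x"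
    "\<And>l::int. \<exists>p\<in>spline_space w m. \<forall>x\<in>{of_int l<..<of_int l + 1}. complex_of_real (\<phi> x) = p x"
    using assms unfolding is_PEB_spline_def w_def by auto
  have wcd: "cont_diff (m - s) (w s)" if "1 \<le> s" "s \<le> m" for s
    using cont_diff_mult[OF cont_diff_exp[of "m - s" 1 "\<gamma> s"] adm(1)[OF that]]
    by (simp add: w_def weight_def[abs_def])
  have wpos: "0 < w s x" if "1 \<le> s" "s \<le> m" for s x
    using adm(2)[OF that] by (simp add: w_def weight_def)
  have "chain_spline w 1 (Suc n) \<phi>"
  proof (rule chain_spline_of_pieces)
    show "cont_diff (Suc n - s) (w (1 + s))" if "s \<le> Suc n" for s
      using wcd[of "1 + s"] that mn by simp
    show "0 < w (1 + s) x" if "s \<le> Suc n" for s x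
      using wpos[of "1 + s"] that mn by simp
    show "cont_diff (Suc n - 1) \<phi>" using \<phi>(1) mn by simp
    show "\<exists>c. \<forall>x\<in>{of_int l<..<of_int l + 1}. \<phi> x = (\<Sum>s\<le>Suc n. c s * nested w 1 s x)" for l :: int
    proof -
      obtain c where c: "\<And>x. x \<in> {of_int l<..<of_int l + 1} \<Longrightarrow>
          complex_of_real (\<phi> x) = (\<Sum>s=1..m. c s * complex_of_real (basis_fun w s x))"
        using \<phi>(4)[of l] unfolding spline_space_def by fastforce
      \<comment> \<open>Real coefficients are obtained by taking real parts, as \<phi> and the basis
        functions are real.\<close>
      have "\<phi> x = (\<Sum>s\<le>Suc n. Re (c (Suc s)) * nested w 1 s x)" if "x \<in> {of_int l<..<of_int l + 1}" for x
      proof -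
        have "\<phi> x = (\<Sum>s=1..m. Re (c s) * basis_fun w s x)"
          using arg_cong[OF c[OF that], of Re] by simp
        also have "\<dots> = (\<Sum>s\<le>Suc n. Re (c (Suc s)) * nested w 1 s x)"
          by (rule sum.reindex_bij_witness[where i = Suc and j = "\<lambda>s. s - 1"])
            (auto simp: basis_fun_def mn)
        finally show ?thesis .
      qed
      then show ?thesis by (intro exI[of _ "\<lambda>s. Re (c (Suc s))"]) blast
    qed
  qed
  moreover have "positive_weights w 1 (Suc n)"
    unfolding positive_weights_def
    by (intro ballI conjI allI cont_diff_imp_continuous[OF wcd] wpos) (auto simp: mn)
  moreover have "quasi_periodic w 1 (Suc n)"
    unfolding quasi_periodic_def
  proof (intro ballI allI)
    fix s k assume "s \<in> {1..1 + Suc n}"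
    then have "r s (x + of_int k) = r s x" for x
      using adm(3)[of s] mn by (intro periodic_int_shift) auto
    then show "\<exists>d. \<forall>x. w s (x + of_int k) = d * w s x"
      by (intro exI[of _ "exp (\<gamma> s * of_int k)"]) (simp add: w_def weight_def distrib_left exp_add)
  qed
  moreover have "\<phi> x \<noteq> 0 \<longleftrightarrow> 0 < x \<and> x < real (n + 2)" for x
  proof -
    have out: "\<phi> x = 0" if "x \<notin> {0..real m}" for x
      using that \<phi>(2) closure_subset[of "{x. \<phi> x \<noteq> 0}"] by auto
    have cont: "continuous_on UNIV \<phi>" using \<phi>(1) by (rule cont_diff_imp_continuous)
    \<comment> \<open>The closure of the nonvanishing set says nothing about the values at 0 and m;
      continuity from outside makes them zero.\<close>
    have "\<phi> 0 = 0" using out by (intro continuous_zero_closure[OF cont, of "-1" 0]) auto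
    moreover have "\<phi> (real m) = 0"
      using out by (intro continuous_zero_closure[OF cont, of "real m" "real m + 1"]) auto
    ultimately show ?thesis
      using \<phi>(3)[of x] out[of x] mn
      by (metis atLeastAtMost_iff less_irrefl order_le_less)
  qed
  ultimately show ?thesis
    unfolding w_def[symmetric] n_def[symmetric] by unfold_locales
qed

section \<open>Stable sampling of spline series\<close>

text \<open>For compactly supported \<phi> the sum over the translates alive at \<open>y\<close> is
  finite for every sequence \<open>c\<close>, so sequences that are not square-summable, such as the
  alternating one, are covered as well.\<close>

definition synth :: "(real \<Rightarrow> real) \<Rightarrow> (int \<Rightarrow> complex) \<Rightarrow> real \<Rightarrow> complex" where
  "synth \<phi> c y = (\<Sum>k | \<phi> (y + of_int k) \<noteq> 0. c k * of_real (\<phi> (y + of_int k)))"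

lemma synth_eq_sum:
  assumes "finite K" "\<And>k. \<phi> (y + of_int k) \<noteq> 0 \<Longrightarrow> k \<in> K"
  shows "synth \<phi> c y = (\<Sum>k\<in>K. c k * of_real (\<phi> (y + of_int k)))"
  unfolding synth_def using assms by (intro sum.mono_neutral_left) auto

lemma synth_translate: "synth \<phi> (\<lambda>k. c (k + l)) y = synth \<phi> c (y - of_int l)"
  unfolding synth_def
  by (rule sum.reindex_bij_witness[where i = "\<lambda>k. k - l" and j = "\<lambda>k. k + l"]) (auto simp: algebra_simps)

lemma nn_integral_count_space_int_shift:
  "(\<integral>\<^sup>+j. f (j + d) \<partial>count_space UNIV) = (\<integral>\<^sup>+j. f j \<partial>count_space (UNIV :: int set))"
  by (rule nn_integral_bij_count_space) (rule bij_betwI[where g = "\<lambda>j. j - d"], auto)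

lemma nn_integral_count_space_swap:
  "(\<integral>\<^sup>+j. \<integral>\<^sup>+k. f j k \<partial>count_space UNIV \<partial>count_space UNIV) = (\<integral>\<^sup>+k. \<integral>\<^sup>+j. f j k \<partial>count_space UNIV \<partial>count_space UNIV)"
  using nn_integral_fst_count_space[of "\<lambda>(j, k). f j k"] nn_integral_snd_count_space[of "\<lambda>(j, k). f j k"]
  by simp

lemma lattice_points_in_interval:
  fixes \<alpha> a b :: real
  assumes "0 < \<alpha>" "a \<le> b"
  shows "finite {j::int. a < \<alpha> * of_int j \<and> \<alpha> * of_int j < b}"
    and "real (card {j::int. a < \<alpha> * of_int j \<and> \<alpha> * of_int j < b}) \<le> (b - a) / \<alpha> + 1"
proof -
  have sub: "{j::int. a < \<alpha> * of_int j \<and> \<alpha> * of_int j < b} \<subseteq> {\<lfloor>a / \<alpha>\<rfloor> + 1..\<lceil>b / \<alpha>\<rceil> - 1}"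
  proof
    fix j :: int assume "j \<in> {j. a < \<alpha> * of_int j \<and> \<alpha> * of_int j < b}"
    then have "a / \<alpha> < of_int j" "of_int j < b / \<alpha>" using assms by (auto simp: field_simps)
    then have "\<lfloor>a / \<alpha>\<rfloor> < j" "j < \<lceil>b / \<alpha>\<rceil>" by (auto simp: floor_less_iff less_ceiling_iff)
    then show "j \<in> {\<lfloor>a / \<alpha>\<rfloor> + 1..\<lceil>b / \<alpha>\<rceil> - 1}" by auto
  qed
  show "finite {j::int. a < \<alpha> * of_int j \<and> \<alpha> * of_int j < b}"
    using sub by (rule finite_subset) simp
  have "card {j::int. a < \<alpha> * of_int j \<and> \<alpha> * of_int j < b} \<le> card {\<lfloor>a / \<alpha>\<rfloor> + 1..\<lceil>b / \<alpha>\<rceil> - 1}"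
    using sub by (intro card_mono) auto
  also have "\<dots> = nat (\<lceil>b / \<alpha>\<rceil> - 1 - \<lfloor>a / \<alpha>\<rfloor>)" by simp
  finally have *: "card {j::int. a < \<alpha> * of_int j \<and> \<alpha> * of_int j < b} \<le> nat (\<lceil>b / \<alpha>\<rceil> - 1 - \<lfloor>a / \<alpha>\<rfloor>)" .
  have "real (nat (\<lceil>b / \<alpha>\<rceil> - 1 - \<lfloor>a / \<alpha>\<rfloor>)) \<le> b / \<alpha> - a / \<alpha> + 1"
  proof (cases "0 \<le> \<lceil>b / \<alpha>\<rceil> - 1 - \<lfloor>a / \<alpha>\<rfloor>")
    case True
    then have "real (nat (\<lceil>b / \<alpha>\<rceil> - 1 - \<lfloor>a / \<alpha>\<rfloor>)) = of_int (\<lceil>b / \<alpha>\<rceil> - 1 - \<lfloor>a / \<alpha>\<rfloor>)" by simp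
    then show ?thesis by linarith
  next
    case False
    have "a / \<alpha> \<le> b / \<alpha>" using assms by (simp add: divide_right_mono)
    then show ?thesis using False by simp
  qed
  then show "real (card {j::int. a < \<alpha> * of_int j \<and> \<alpha> * of_int j < b}) \<le> (b - a) / \<alpha> + 1"
    using * by (simp add: diff_divide_distrib)
qed

lemma nn_integral_lattice_points:
  fixes \<alpha> a b :: real
  assumes "0 < \<alpha>" "a \<le> b"
  shows "(\<integral>\<^sup>+j. indicator {j::int. a < \<alpha> * of_int j \<and> \<alpha> * of_int j < b} j \<partial>count_space UNIV)
    \<le> ennreal ((b - a) / \<alpha> + 1)"
proof -
  let ?S = "{j::int. a < \<alpha> * of_int j \<and> \<alpha> * of_int j < b}"
  have "(\<integral>\<^sup>+j. indicator ?S j \<partial>count_space UNIV) = ennreal (real (card ?S))"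
    using lattice_points_in_interval(1)[OF assms] by (simp add: ennreal_of_nat_eq_real_of_nat)
  then show ?thesis using lattice_points_in_interval(2)[OF assms] by (simp add: ennreal_leI)
qed

text \<open>Coefficient vectors stay functions on the whole index type with the product topology.
  Tychonoff's theorem for the box with factors [-1, 1] on \<open>K\<close> and {0} elsewhere, cut by
  a closed condition, replaces the compactness of a Euclidean unit sphere.\<close>

lemma compact_coefficient_sphere:
  assumes "finite K"
  shows "compact {c :: 'a \<Rightarrow> real. (\<forall>k. k \<notin> K \<longrightarrow> c k = 0) \<and> (\<Sum>k\<in>K. (c k)\<^sup>2) = 1}" (is "compact ?C")
proof -
  define P :: "('a \<Rightarrow> real) set" where "P = PiE UNIV (\<lambda>k. if k \<in> K then {-1..1} else {0})"
  have "compactin (product_topology (\<lambda>i. euclidean) UNIV) P"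
    unfolding P_def compactin_PiE by auto
  then have "compact P" by (simp add: euclidean_product_topology)
  have clo: "closed {c :: 'a \<Rightarrow> real. (\<Sum>k\<in>K. (c k)\<^sup>2) = 1}"
    by (intro closed_Collect_eq continuous_intros) auto
  have "?C = P \<inter> {c. (\<Sum>k\<in>K. (c k)\<^sup>2) = 1}"
  proof (intro equalityI subsetI)
    fix c assume c: "c \<in> ?C"
    have "(c k)\<^sup>2 \<le> 1" if "k \<in> K" for k
      using member_le_sum[OF that, of "\<lambda>k. (c k)\<^sup>2"] assms c by auto
    then have "\<bar>c k\<bar> \<le> 1" if "k \<in> K" for k
      using that by (simp add: abs_le_square_iff[of _ 1, simplified])
    then show "c \<in> P \<inter> {c. (\<Sum>k\<in>K. (c k)\<^sup>2) = 1}" using c by (auto simp: P_def abs_le_iff)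
  qed (auto simp: P_def PiE_def Pi_def split: if_splits)
  then show ?thesis using compact_Int_closed[OF \<open>compact P\<close> clo] by simp
qed

section \<open>Two-sided bounds for sampled spline series\<close>

context spline_generator
begin

lemma continuous_compose:
  "continuous_on S g \<Longrightarrow> continuous_on S (\<lambda>x. \<phi> (g x))"
  using continuous by (rule continuous_on_compose2) auto

lemma finite_support_translates: "finite {k. \<phi> (y + of_int k) \<noteq> 0}"
proof (rule finite_subset)
  show "{k. \<phi> (y + of_int k) \<noteq> 0} \<subseteq> {k. - y < 1 * of_int k \<and> 1 * of_int k < - y + real (n + 2)}"
    unfolding support by auto
qed (rule lattice_points_in_interval, auto)

text \<open>The tent weight makes the quadratic form jointly continuous in \<open>t\<close> and
  \<open>c\<close>, although the set of samples inside (-N, N) jumps with \<open>t\<close>;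
  \<open>J\<close> is large enough for every \<open>t\<close> in \<open>{0..\<alpha>}\<close>. Were
  the minimum over the compact set zero, all samples in the window would vanish, hence the spline on
  the window, hence all coefficients.\<close>

lemma window_bound:
  assumes \<alpha>: "0 < \<alpha>" "\<alpha> < 1" and N: "\<alpha> * (2 * real N + real n) \<le> 2 * real N - 1"
  defines "K \<equiv> {1 - int N..int N + int n + 1}"
  defines "J \<equiv> {- \<lceil>real N / \<alpha>\<rceil>..\<lceil>real N / \<alpha>\<rceil> + 1}"
  shows "\<exists>A>0. \<forall>t\<in>{0..\<alpha>}. \<forall>c :: int \<Rightarrow> real. A * (\<Sum>k\<in>K. (c k)\<^sup>2) \<le>
    (\<Sum>j\<in>J. max 0 (1 - \<bar>t - \<alpha> * of_int j\<bar> / real N) * (\<Sum>k\<in>K. c k * \<phi> (t - \<alpha> * of_int j + of_int k))\<^sup>2)"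
proof -
  define Q where "Q t c = (\<Sum>j\<in>J. max 0 (1 - \<bar>t - \<alpha> * of_int j\<bar> / real N) *
    (\<Sum>k\<in>K. c k * \<phi> (t - \<alpha> * of_int j + of_int k))\<^sup>2)" for t and c :: "int \<Rightarrow> real"
  have "0 \<le> \<alpha> * (2 * real N + real n)" using \<alpha> by simp
  then have N1: "1 \<le> N" using N by linarith
  define C where "C = {c :: int \<Rightarrow> real. (\<forall>k. k \<notin> K \<longrightarrow> c k = 0) \<and> (\<Sum>k\<in>K. (c k)\<^sup>2) = 1}"
  have finK: "finite K" by (simp add: K_def)
  have "compact C" unfolding C_def by (rule compact_coefficient_sphere[OF finK])
  have nonneg: "0 \<le> Q t c" for t c unfolding Q_def by (intro sum_nonneg) auto
  have cont: "continuous_on UNIV (\<lambda>p. Q (fst p) (snd p))"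
    unfolding Q_def using N1
    by (intro continuous_intros continuous_compose continuous_on_compose2[OF continuous_on_product_coordinates]) auto
  have "(\<lambda>k. if k = 0 then 1 else 0) \<in> C"
    using N1 finK by (auto simp: C_def K_def if_distrib[of "\<lambda>x. x\<^sup>2"] cong: if_cong)
  then have "{0..\<alpha>} \<times> C \<noteq> {}" using \<alpha> by auto
  moreover have "compact ({0..\<alpha>} \<times> C)" using \<open>compact C\<close> by (intro compact_Times) auto
  moreover have "continuous_on ({0..\<alpha>} \<times> C) (\<lambda>p. Q (fst p) (snd p))"
    by (rule continuous_on_subset[OF cont]) simp
  ultimately have "\<exists>p\<in>{0..\<alpha>} \<times> C. \<forall>q\<in>{0..\<alpha>} \<times> C. Q (fst p) (snd p) \<le> Q (fst q) (snd q)"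
    by (intro continuous_attains_inf)
  then obtain p where p: "p \<in> {0..\<alpha>} \<times> C" "\<And>q. q \<in> {0..\<alpha>} \<times> C \<Longrightarrow> Q (fst p) (snd p) \<le> Q (fst q) (snd q)"
    by blast
  define A where "A = Q (fst p) (snd p)"
  have "A \<noteq> 0"
  proof
    assume "A = 0"
    define t c f where "t = fst p" and "c = snd p" and "f x = (\<Sum>k\<in>K. c k * \<phi> (x + of_int k))" for x
    have t: "0 \<le> t" "t \<le> \<alpha>" and c: "c \<in> C" using p by (auto simp: t_def c_def)
    have terms: "max 0 (1 - \<bar>t - \<alpha> * of_int j\<bar> / real N) * (f (t - \<alpha> * of_int j))\<^sup>2 = 0" if "j \<in> J" for j
      using \<open>A = 0\<close> that unfolding A_def Q_def t_def c_def f_def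
      by (subst (asm) sum_nonneg_eq_0_iff) (auto simp: J_def)
    have z: "f (t - \<alpha> * of_int j) = 0" if j: "- real N < t - \<alpha> * of_int j" "t - \<alpha> * of_int j < real N" for j :: int
    proof -
      have "\<alpha> * of_int j < real N + \<alpha>" "- real N < \<alpha> * of_int j" using j t by auto
      then have "of_int j < real N / \<alpha> + 1" "- (real N / \<alpha>) < of_int j" using \<alpha> by (auto simp: field_simps)
      then have "j \<in> J" unfolding J_def atLeastAtMost_iff by linarith
      then have 0: "max 0 (1 - \<bar>t - \<alpha> * of_int j\<bar> / real N) * (f (t - \<alpha> * of_int j))\<^sup>2 = 0"
        by (rule terms)
      have "\<bar>t - \<alpha> * of_int j\<bar> / real N < 1" using j N1 by (auto simp: field_simps)
      then have "max 0 (1 - \<bar>t - \<alpha> * of_int j\<bar> / real N) \<noteq> 0" by linarith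
      then show ?thesis using 0 unfolding mult_eq_0_iff power_eq_0_iff by blast
    qed
    have chf: "chain_spline w 1 (Suc n) f"
      unfolding f_def[abs_def] by (rule translates_chain)
    have "f x = 0" if "- real N < x" "x < real N" for x
      using that z chf by (intro zero_of_zero_samples[OF \<alpha> N, of f t x]) (auto simp del: chain_spline.simps)
    then have "c k = 0" if "k \<in> K" for k
      using local_linear_independence[OF N1, of c k] that unfolding f_def K_def by blast
    then have "(\<Sum>k\<in>K. (c k)\<^sup>2) = 0" by simp
    then show False using c by (simp add: C_def)
  qed
  then have "0 < A" using nonneg[of "fst p" "snd p"] unfolding A_def by linarith
  \<comment> \<open>Homogeneity of degree two carries the bound from the unit sphere to all
    coefficients.\<close>
  moreover have "A * (\<Sum>k\<in>K. (c k)\<^sup>2) \<le> Q t c" if t: "t \<in> {0..\<alpha>}" for t c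
  proof (cases "(\<Sum>k\<in>K. (c k)\<^sup>2) = 0")
    case False
    define s where "s = sqrt (\<Sum>k\<in>K. (c k)\<^sup>2)"
    have s2: "s\<^sup>2 = (\<Sum>k\<in>K. (c k)\<^sup>2)" by (simp add: s_def sum_nonneg)
    then have s: "s \<noteq> 0" using False by auto
    define d where "d k = (if k \<in> K then c k / s else 0)" for k
    have "(\<Sum>k\<in>K. (d k)\<^sup>2) = (\<Sum>k\<in>K. (c k)\<^sup>2) / s\<^sup>2"
      by (simp add: d_def power_divide sum_divide_distrib)
    then have "d \<in> C" using s s2 by (auto simp: C_def d_def)
    then have "A \<le> Q t d" using p(2)[of "(t, d)"] t by (auto simp: A_def)
    have "(\<Sum>k\<in>K. d k * \<phi> (x + of_int k)) = (\<Sum>k\<in>K. c k * \<phi> (x + of_int k)) / s" for x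
      by (simp add: d_def sum_divide_distrib)
    note scaled = this
    have "Q t d = Q t c / s\<^sup>2"
      unfolding Q_def scaled by (subst sum_divide_distrib) (simp only: power_divide times_divide_eq_right)
    then show ?thesis
      using mult_right_mono[OF \<open>A \<le> Q t d\<close>, of "s\<^sup>2"] s unfolding s2[symmetric] by simp
  qed (use nonneg in simp)
  ultimately show ?thesis unfolding Q_def by blast
qed

text \<open>Only the coefficient with index 0 is kept, as translated windows are summed afterwards.
  The tent weight is enlarged to an indicator, real and imaginary parts are bounded separately, and
  an arbitrary \<open>t\<close> is moved into \<open>{0..\<alpha>}\<close> by renumbering the
  samples.\<close>

lemma local_lower_bound:
  assumes \<alpha>: "0 < \<alpha>" "\<alpha> < 1"
  shows "\<exists>A>0. \<exists>N\<ge>1. \<forall>t. \<forall>c. ennreal (A * (cmod (c (0::int)))\<^sup>2) \<le>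
    (\<integral>\<^sup>+j. indicator {j. \<bar>t - \<alpha> * of_int j\<bar> < real N} j * ennreal ((cmod (synth \<phi> c (t - \<alpha> * of_int j)))\<^sup>2)
      \<partial>count_space UNIV)"
proof -
  \<comment> \<open>This solves \<open>\<alpha> * (2 * N0 + n) <= 2 * N0 - 1\<close> for
    \<open>N0\<close>; the divisor is positive because \<open>\<alpha> < 1\<close>.\<close>
  obtain N0 :: nat where "(\<alpha> * real n + 1) / (2 - 2 * \<alpha>) \<le> real N0"
    using real_arch_simple by blast
  then have N: "\<alpha> * (2 * real N0 + real n) \<le> 2 * real N0 - 1"
    using \<alpha> by (simp add: field_simps)
  have "0 \<le> \<alpha> * (2 * real N0 + real n)" using \<alpha> by simp
  then have N1: "1 \<le> N0" using N by linarith
  define K where "K = {1 - int N0..int N0 + int n + 1}"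
  define J where "J = {- \<lceil>real N0 / \<alpha>\<rceil>..\<lceil>real N0 / \<alpha>\<rceil> + 1}"
  have KJ: "finite K" "finite J" "0 \<in> K" using N1 by (auto simp: K_def J_def)
  obtain A where A: "0 < A" "\<And>t c. t \<in> {0..\<alpha>} \<Longrightarrow> A * (\<Sum>k\<in>K. (c k)\<^sup>2) \<le>
    (\<Sum>j\<in>J. max 0 (1 - \<bar>t - \<alpha> * of_int j\<bar> / real N0) * (\<Sum>k\<in>K. c k * \<phi> (t - \<alpha> * of_int j + of_int k))\<^sup>2)"
    using window_bound[OF \<alpha> N] unfolding K_def J_def by blast
  let ?g = "\<lambda>t c j. indicator {j. \<bar>t - \<alpha> * of_int j\<bar> < real N0} j * (cmod (synth \<phi> c (t - \<alpha> * of_int j)))\<^sup>2"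
  have base: "A * (cmod (c 0))\<^sup>2 \<le> (\<Sum>j\<in>J. ?g t c j)" if t: "t \<in> {0..\<alpha>}" for t and c :: "int \<Rightarrow> complex"
  proof -
    let ?\<psi> = "\<lambda>j. max 0 (1 - \<bar>t - \<alpha> * of_int j\<bar> / real N0)"
    let ?S = "\<lambda>c j. \<Sum>k\<in>K. c k * \<phi> (t - \<alpha> * of_int j + of_int k)"
    have "(cmod (c 0))\<^sup>2 \<le> (\<Sum>k\<in>K. (cmod (c k))\<^sup>2)"
      using member_le_sum[OF KJ(3), of "\<lambda>k. (cmod (c k))\<^sup>2"] KJ by simp
    also have "\<dots> = (\<Sum>k\<in>K. (Re (c k))\<^sup>2) + (\<Sum>k\<in>K. (Im (c k))\<^sup>2)"
      by (simp add: cmod_power2 sum.distrib)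
    finally have "A * (cmod (c 0))\<^sup>2 \<le> A * (\<Sum>k\<in>K. (Re (c k))\<^sup>2) + A * (\<Sum>k\<in>K. (Im (c k))\<^sup>2)"
      using A(1) by (simp flip: distrib_left)
    also have "\<dots> \<le> (\<Sum>j\<in>J. ?\<psi> j * (?S (\<lambda>k. Re (c k)) j)\<^sup>2) + (\<Sum>j\<in>J. ?\<psi> j * (?S (\<lambda>k. Im (c k)) j)\<^sup>2)"
      by (intro add_mono A t)
    also have "\<dots> = (\<Sum>j\<in>J. ?\<psi> j * ((?S (\<lambda>k. Re (c k)) j)\<^sup>2 + (?S (\<lambda>k. Im (c k)) j)\<^sup>2))"
      by (simp add: sum.distrib distrib_left)
    also have "\<dots> \<le> (\<Sum>j\<in>J. ?g t c j)"
    proof (rule sum_mono)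
      fix j
      show "?\<psi> j * ((?S (\<lambda>k. Re (c k)) j)\<^sup>2 + (?S (\<lambda>k. Im (c k)) j)\<^sup>2) \<le> ?g t c j"
      proof (cases "\<bar>t - \<alpha> * of_int j\<bar> < real N0")
        case True
        have "synth \<phi> c (t - \<alpha> * of_int j) = (\<Sum>k\<in>K. c k * of_real (\<phi> (t - \<alpha> * of_int j + of_int k)))"
        proof (rule synth_eq_sum[OF KJ(1)])
          fix k :: int assume "\<phi> (t - \<alpha> * of_int j + of_int k) \<noteq> 0"
          then have "of_int k < real N0 + real n + 2" "- real N0 < of_int k"
            using support True by (auto simp: abs_less_iff)
          then show "k \<in> K" unfolding K_def atLeastAtMost_iff by linarith
        qed
        then have "(cmod (synth \<phi> c (t - \<alpha> * of_int j)))\<^sup>2 = (?S (\<lambda>k. Re (c k)) j)\<^sup>2 + (?S (\<lambda>k. Im (c k)) j)\<^sup>2"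
          by (simp add: cmod_power2)
        moreover have "?\<psi> j \<le> 1" by auto
        ultimately show ?thesis
          using True by (auto intro!: mult_left_le_one_le)
      next
        case False
        then show ?thesis using N1 by (auto simp: field_simps)
      qed
    qed
    finally show ?thesis .
  qed
  have shifted: "ennreal (A * (cmod (c 0))\<^sup>2) \<le> (\<integral>\<^sup>+j. ennreal (?g t c j) \<partial>count_space UNIV)" for t c
  proof -
    define i where "i = \<lfloor>t / \<alpha>\<rfloor>"
    define t' where "t' = t - \<alpha> * of_int i"
    have "of_int i \<le> t / \<alpha>" "t / \<alpha> < of_int i + 1" unfolding i_def by linarith+
    then have "t' \<in> {0..\<alpha>}" using \<alpha> by (auto simp: t'_def field_simps)
    have "ennreal (A * (cmod (c 0))\<^sup>2) \<le> ennreal (\<Sum>j\<in>J. ?g t' c j)"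
      by (intro ennreal_leI base \<open>t' \<in> {0..\<alpha>}\<close>)
    also have "\<dots> = (\<Sum>j\<in>J. ennreal (?g t' c j))"
      by (rule sum_ennreal[symmetric]) auto
    also have "\<dots> = (\<integral>\<^sup>+j. ennreal (?g t' c j) \<partial>count_space J)"
      using KJ by (simp add: nn_integral_count_space_finite)
    also have "\<dots> \<le> (\<integral>\<^sup>+j. ennreal (?g t' c j) \<partial>count_space UNIV)"
      by (subst nn_integral_count_space_indicator) (auto intro!: nn_integral_mono simp: indicator_def)
    also have "\<dots> = (\<integral>\<^sup>+j. ennreal (?g t c (j + i)) \<partial>count_space UNIV)"
      by (simp add: t'_def algebra_simps indicator_def)
    also have "\<dots> = (\<integral>\<^sup>+j. ennreal (?g t c j) \<partial>count_space UNIV)"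
      by (rule nn_integral_count_space_int_shift)
    finally show ?thesis .
  qed
  have "ennreal (?g t c j) = indicator {j. \<bar>t - \<alpha> * of_int j\<bar> < real N0} j * ennreal ((cmod (synth \<phi> c (t - \<alpha> * of_int j)))\<^sup>2)"
    for t c j by (simp add: indicator_def)
  then show ?thesis using A(1) N1 shifted by (intro exI[of _ A] exI[of _ N0]) auto
qed

text \<open>The local bound, applied to the sequence shifted by \<open>k\<close> at the point
  \<open>t + k\<close>, controls \<open>c k\<close> by the samples within \<open>N\<close> of
  \<open>- k\<close>. Summed over \<open>k\<close>, each sample is used at most
  \<open>D = 2 * N + 1\<close> times.\<close>

lemma synthesis_lower_bound:
  assumes \<alpha>: "0 < \<alpha>" "\<alpha> < 1"
  shows "\<exists>A>0. \<forall>t. \<forall>c. ennreal A * (\<integral>\<^sup>+k. ennreal ((cmod (c k))\<^sup>2) \<partial>count_space UNIV) \<le>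
    (\<integral>\<^sup>+j. ennreal ((cmod (synth \<phi> c (t - \<alpha> * of_int j)))\<^sup>2) \<partial>count_space UNIV)"
proof -
  obtain A N where A: "0 < A" "1 \<le> N" and loc: "\<And>t c. ennreal (A * (cmod (c (0::int)))\<^sup>2) \<le>
    (\<integral>\<^sup>+j. indicator {j. \<bar>t - \<alpha> * of_int j\<bar> < real N} j * ennreal ((cmod (synth \<phi> c (t - \<alpha> * of_int j)))\<^sup>2)
      \<partial>count_space UNIV)"
    using local_lower_bound[OF \<alpha>] by blast
  define D where "D = 2 * real N + 1"
  have D: "0 < D" by (simp add: D_def)
  have "ennreal A * (\<integral>\<^sup>+k. ennreal ((cmod (c k))\<^sup>2) \<partial>count_space UNIV) \<le>
    ennreal D * (\<integral>\<^sup>+j. ennreal ((cmod (synth \<phi> c (t - \<alpha> * of_int j)))\<^sup>2) \<partial>count_space UNIV)" for t c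
  proof -
    let ?s = "\<lambda>j. ennreal ((cmod (synth \<phi> c (t - \<alpha> * of_int j)))\<^sup>2)"
    have "ennreal A * (\<integral>\<^sup>+k. ennreal ((cmod (c k))\<^sup>2) \<partial>count_space UNIV)
        = (\<integral>\<^sup>+k. ennreal (A * (cmod (c k))\<^sup>2) \<partial>count_space UNIV)"
      using A by (subst nn_integral_cmult[symmetric]) (auto simp: ennreal_mult)
    also have "\<dots> \<le> (\<integral>\<^sup>+k. \<integral>\<^sup>+j. indicator {k. \<bar>t + of_int k - \<alpha> * of_int j\<bar> < real N} k * ?s j
        \<partial>count_space UNIV \<partial>count_space UNIV)"
    proof (rule nn_integral_mono)
      fix k :: int
      have "ennreal (A * (cmod (c k))\<^sup>2) = ennreal (A * (cmod ((\<lambda>l. c (l + k)) 0))\<^sup>2)" by simp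
      also have "\<dots> \<le> (\<integral>\<^sup>+j. indicator {j. \<bar>t + of_int k - \<alpha> * of_int j\<bar> < real N} j *
          ennreal ((cmod (synth \<phi> (\<lambda>l. c (l + k)) (t + of_int k - \<alpha> * of_int j)))\<^sup>2) \<partial>count_space UNIV)"
        by (rule loc)
      finally show "ennreal (A * (cmod (c k))\<^sup>2) \<le> (\<integral>\<^sup>+j. indicator {k. \<bar>t + of_int k - \<alpha> * of_int j\<bar> < real N} k * ?s j \<partial>count_space UNIV)"
        by (simp add: synth_translate indicator_def algebra_simps)
    qed
    also have "\<dots> = (\<integral>\<^sup>+j. (\<integral>\<^sup>+k. indicator {k. \<bar>t + of_int k - \<alpha> * of_int j\<bar> < real N} k
        \<partial>count_space UNIV) * ?s j \<partial>count_space UNIV)"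
      by (subst nn_integral_count_space_swap) (intro nn_integral_cong nn_integral_multc, simp)
    also have "\<dots> \<le> (\<integral>\<^sup>+j. ennreal D * ?s j \<partial>count_space UNIV)"
    proof (intro nn_integral_mono mult_right_mono)
      fix j
      have "{k. \<bar>t + of_int k - \<alpha> * of_int j\<bar> < real N} =
        {k. \<alpha> * of_int j - t - real N < 1 * of_int k \<and> 1 * of_int k < \<alpha> * of_int j - t + real N}"
        by (auto simp: abs_less_iff)
      then show "(\<integral>\<^sup>+k. indicator {k. \<bar>t + of_int k - \<alpha> * of_int j\<bar> < real N} k \<partial>count_space UNIV) \<le> ennreal D"
        using nn_integral_lattice_points[of 1 "\<alpha> * of_int j - t - real N" "\<alpha> * of_int j - t + real N"]
        by (simp add: D_def)
    qed simp
    finally show ?thesis by (simp add: nn_integral_cmult)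
  qed
  note main = this
  have "ennreal (A / D) * (\<integral>\<^sup>+k. ennreal ((cmod (c k))\<^sup>2) \<partial>count_space UNIV) \<le>
    (\<integral>\<^sup>+j. ennreal ((cmod (synth \<phi> c (t - \<alpha> * of_int j)))\<^sup>2) \<partial>count_space UNIV)" (is "_ * ?x \<le> ?y") for t c
  proof -
    have "ennreal (A / D) * ?x = ennreal (1 / D) * (ennreal A * ?x)"
      using A D by (simp add: mult.assoc[symmetric] ennreal_mult[symmetric])
    also have "\<dots> \<le> ennreal (1 / D) * (ennreal D * ?y)"
      by (intro mult_left_mono main) simp
    also have "\<dots> = ?y"
      using D by (simp add: mult.assoc[symmetric] ennreal_mult[symmetric])
    finally show ?thesis .
  qed
  then show ?thesis using A D by (intro exI[of _ "A / D"]) auto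
qed

lemma bounded: "\<exists>C>0. \<forall>x. \<bar>\<phi> x\<bar> \<le> C"
proof -
  have "compact (\<phi> ` {0..real (n + 2)})"
    using continuous by (intro compact_continuous_image continuous_on_subset[OF continuous]) auto
  then obtain C where C: "\<And>x. x \<in> {0..real (n + 2)} \<Longrightarrow> \<bar>\<phi> x\<bar> \<le> C"
    by (metis bounded_iff compact_imp_bounded imageI real_norm_def)
  have "\<bar>\<phi> x\<bar> \<le> max 1 C" for x
  proof (cases "\<phi> x = 0")
    case False
    then show ?thesis using C[of x] support[of x] by auto
  qed simp
  then show ?thesis by (intro exI[of _ "max 1 C"]) auto
qed

text \<open>Cauchy-Schwarz over the active translates; \<open>n + 3\<close> bounds the number of
  integers in an open interval of length \<open>n + 2\<close>.\<close>

lemma synth_bound: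
  assumes C: "\<And>x. \<bar>\<phi> x\<bar> \<le> C"
  shows "(cmod (synth \<phi> c y))\<^sup>2 \<le> real (n + 3) * C\<^sup>2 * (\<Sum>k | \<phi> (y + of_int k) \<noteq> 0. (cmod (c k))\<^sup>2)"
proof -
  let ?S = "{k. \<phi> (y + of_int k) \<noteq> 0}"
  have sub: "?S = {k. - y < 1 * of_int k \<and> 1 * of_int k < - y + real (n + 2)}"
    unfolding support by auto
  have "real (card ?S) \<le> real (n + 3)"
    using lattice_points_in_interval(2)[of 1 "- y" "- y + real (n + 2)"] unfolding sub by auto
  have "cmod (synth \<phi> c y) \<le> (\<Sum>k\<in>?S. cmod (c k) * \<bar>\<phi> (y + of_int k)\<bar>)"
    unfolding synth_def by (rule order_trans[OF norm_sum]) (simp add: norm_mult)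
  then have "(cmod (synth \<phi> c y))\<^sup>2 \<le> (\<Sum>k\<in>?S. cmod (c k) * \<bar>\<phi> (y + of_int k)\<bar>)\<^sup>2"
    by (intro power_mono) auto
  also have "\<dots> \<le> (\<Sum>k\<in>?S. (cmod (c k))\<^sup>2) * (\<Sum>k\<in>?S. \<bar>\<phi> (y + of_int k)\<bar>\<^sup>2)"
    by (rule Cauchy_Schwarz_ineq_sum)
  also have "\<dots> \<le> (\<Sum>k\<in>?S. (cmod (c k))\<^sup>2) * (\<Sum>k\<in>?S. C\<^sup>2)"
    using C by (intro mult_left_mono sum_mono power_mono sum_nonneg) auto
  also have "\<dots> \<le> (\<Sum>k\<in>?S. (cmod (c k))\<^sup>2) * (real (n + 3) * C\<^sup>2)"
    using \<open>real (card ?S) \<le> real (n + 3)\<close> by (intro mult_left_mono sum_nonneg) (auto intro: mult_right_mono)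
  finally show ?thesis by (simp add: mult_ac)
qed

text \<open>Double counting of the pairs (j, k) for which translate k is alive at sample j: the
  indices per sample enter through \<open>E\<close>, the samples per index through \<open>D\<close>.
  Neither depends on \<open>t\<close>, so the bound can be integrated over \<open>t\<close>.\<close>

lemma synthesis_upper_bound:
  assumes \<alpha>: "0 < \<alpha>"
  shows "\<exists>B>0. \<forall>t. \<forall>c. (\<integral>\<^sup>+j. ennreal ((cmod (synth \<phi> c (t - \<alpha> * of_int j)))\<^sup>2) \<partial>count_space UNIV)
    \<le> ennreal B * (\<integral>\<^sup>+k. ennreal ((cmod (c k))\<^sup>2) \<partial>count_space UNIV)"
proof -
  obtain C where C: "0 < C" "\<And>x. \<bar>\<phi> x\<bar> \<le> C" using bounded by blast
  define E D where "E = real (n + 3) * C\<^sup>2" and "D = real (n + 2) / \<alpha> + 1"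
  have ED: "0 < E" "0 < D" using C \<alpha> by (auto simp: E_def D_def add_nonneg_pos)
  have "(\<integral>\<^sup>+j. ennreal ((cmod (synth \<phi> c (t - \<alpha> * of_int j)))\<^sup>2) \<partial>count_space UNIV)
    \<le> ennreal (E * D) * (\<integral>\<^sup>+k. ennreal ((cmod (c k))\<^sup>2) \<partial>count_space UNIV)" for t c
  proof -
    let ?S = "\<lambda>j. {k. \<phi> (t - \<alpha> * of_int j + of_int k) \<noteq> 0}"
    let ?c = "\<lambda>k. ennreal ((cmod (c k))\<^sup>2)"
    have "(\<integral>\<^sup>+j. ennreal ((cmod (synth \<phi> c (t - \<alpha> * of_int j)))\<^sup>2) \<partial>count_space UNIV)
      \<le> (\<integral>\<^sup>+j. ennreal E * (\<integral>\<^sup>+k. ?c k * indicator (?S j) k \<partial>count_space UNIV) \<partial>count_space UNIV)"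
    proof (rule nn_integral_mono)
      fix j
      have "ennreal ((cmod (synth \<phi> c (t - \<alpha> * of_int j)))\<^sup>2) \<le> ennreal (E * (\<Sum>k\<in>?S j. (cmod (c k))\<^sup>2))"
        unfolding E_def by (intro ennreal_leI synth_bound C)
      also have "\<dots> = ennreal E * (\<Sum>k\<in>?S j. ?c k)"
        using ED by (simp add: ennreal_mult sum_nonneg sum_ennreal)
      also have "(\<Sum>k\<in>?S j. ?c k) = (\<integral>\<^sup>+k. ?c k * indicator (?S j) k \<partial>count_space UNIV)"
        using finite_support_translates[of "t - \<alpha> * of_int j"]
        by (subst nn_integral_count_space'[where A = "?S j"]) auto
      finally show "ennreal ((cmod (synth \<phi> c (t - \<alpha> * of_int j)))\<^sup>2)
        \<le> ennreal E * (\<integral>\<^sup>+k. ?c k * indicator (?S j) k \<partial>count_space UNIV)" .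
    qed
    also have "\<dots> = ennreal E * (\<integral>\<^sup>+k. ?c k * (\<integral>\<^sup>+j. indicator (?S j) k \<partial>count_space UNIV) \<partial>count_space UNIV)"
      by (subst nn_integral_cmult, simp, subst nn_integral_count_space_swap) (simp add: nn_integral_cmult)
    also have "\<dots> \<le> ennreal E * (\<integral>\<^sup>+k. ?c k * ennreal D \<partial>count_space UNIV)"
    proof (intro mult_left_mono nn_integral_mono)
      fix k
      have "indicator (?S j) k = (indicator {j. t + of_int k - real (n + 2) < \<alpha> * of_int j \<and> \<alpha> * of_int j < t + of_int k} j :: ennreal)" for j
        unfolding indicator_def mem_Collect_eq support by auto
      then show "(\<integral>\<^sup>+j. indicator (?S j) k \<partial>count_space UNIV) \<le> ennreal D"
        using nn_integral_lattice_points[OF \<alpha>, of "t + of_int k - real (n + 2)" "t + of_int k"]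
        by (simp add: D_def)
    qed auto
    also have "\<dots> = ennreal (E * D) * (\<integral>\<^sup>+k. ?c k \<partial>count_space UNIV)"
      using ED by (simp add: nn_integral_multc ennreal_mult) (simp add: mult_ac)
    finally show ?thesis .
  qed
  then show ?thesis using ED by (intro exI[of _ "E * D"]) auto
qed

end

section \<open>Parseval's identity on the unit interval\<close>

definition unit_lborel :: "real measure" where
  "unit_lborel = restrict_space lborel {0..<1}"

definition character :: "int \<Rightarrow> real \<Rightarrow> complex" where
  "character l t = cis (2 * pi * of_int l * t)"

definition trig_poly :: "(real \<Rightarrow> complex) \<Rightarrow> bool" where
  "trig_poly P \<longleftrightarrow> (\<exists>L p. finite L \<and> P = (\<lambda>t. \<Sum>l\<in>L. p l * character l t))"

lemma space_unit_lborel [simp]: "space unit_lborel = {0..<1}"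
  by (simp add: unit_lborel_def space_restrict_space)

lemma borel_measurable_unit_lborel: "f \<in> borel_measurable borel \<Longrightarrow> f \<in> borel_measurable unit_lborel"
  unfolding unit_lborel_def by (rule measurable_restrict_space1) simp

lemma emeasure_unit_lborel: "emeasure unit_lborel {0..<1} = 1"
  by (simp add: unit_lborel_def emeasure_restrict_space)

interpretation unit_lborel: finite_measure unit_lborel
  by (rule finite_measureI) (simp add: emeasure_unit_lborel)

lemma character_mult: "character (k + l) t = character k t * character l t"
  by (simp add: character_def cis_mult algebra_simps)

lemma cnj_character: "cnj (character l t) = character (- l) t"
  by (simp add: character_def cis_cnj)

lemma norm_character [simp]: "cmod (character l t) = 1"
  by (simp add: character_def)

lemma continuous_character: "continuous_on S (character l)"
  unfolding character_def[abs_def] by (intro continuous_intros)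

lemma measurable_character [measurable]: "character l \<in> borel_measurable borel"
  by (intro borel_measurable_continuous_onI continuous_character)

lemma integral_character: "(LINT t|unit_lborel. character l t) = of_bool (l = 0)"
proof (cases "l = 0")
  case True
  then show ?thesis by (simp add: character_def measure_def emeasure_unit_lborel)
next
  case False
  have "(LINT t|unit_lborel. character l t) = (LINT t|lborel. indicator {0..<1} t *\<^sub>R character l t)"
    unfolding unit_lborel_def by (rule integral_restrict_space) simp
  also have "\<dots> = (LINT t|lborel. indicator {0..1} t *\<^sub>R character l t)"
  proof (rule integral_cong_AE)
    show "AE t in lborel. indicator {0..<1} t *\<^sub>R character l t = indicator {0..1} t *\<^sub>R character l t"
      using AE_lborel_singleton[of "1::real"] by eventually_elim (auto split: split_indicator)
  qed auto
  also have "\<dots> = character l 1 / (2 * pi * of_int l * \<i>) - character l 0 / (2 * pi * of_int l * \<i>)"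
  proof (rule integral_FTC_Icc)
    fix t
    have "((\<lambda>t. exp (\<i> * of_real (2 * pi * of_int l * t)) / (2 * pi * of_int l * \<i>)) has_vector_derivative
      exp (\<i> * of_real (2 * pi * of_int l * t))) (at t within {0..1})"
      unfolding of_real_mult
      by (rule has_vector_derivative_real_field)
        (use False in \<open>auto intro!: derivative_eq_intros simp: field_simps\<close>)
    then show "((\<lambda>t. character l t / (2 * pi * of_int l * \<i>)) has_vector_derivative character l t) (at t within {0..1})"
      by (simp add: character_def cis_conv_exp)
  qed (use continuous_character in auto)
  also have "\<dots> = 0"
    using cis_multiple_2pi[of "of_int l"] by (simp add: character_def mult.assoc)
  finally show ?thesis using False by simp
qed

lemma integrable_unit_square_integrable:
  fixes H :: "real \<Rightarrow> complex"
  assumes [measurable]: "H \<in> borel_measurable unit_lborel" "integrable unit_lborel (\<lambda>t. (cmod (H t))\<^sup>2)"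
  shows "integrable unit_lborel H"
proof (rule Bochner_Integration.integrable_bound)
  show "integrable unit_lborel (\<lambda>t. 1 + (cmod (H t))\<^sup>2)"
    using assms by (intro Bochner_Integration.integrable_add) auto
  have "x \<le> 1 + x\<^sup>2" for x :: real
    using zero_le_power2[of "x - 1 / 2"] by (simp add: power2_eq_square algebra_simps)
  then show "AE t in unit_lborel. norm (H t) \<le> norm (1 + (cmod (H t))\<^sup>2)"
    by (intro AE_I2) (simp add: abs_of_nonneg)
qed fact

definition fourier_coeff :: "(real \<Rightarrow> complex) \<Rightarrow> int \<Rightarrow> complex" where
  "fourier_coeff H l = (LINT t|unit_lborel. H t * cnj (character l t))"

text \<open>Completing the square against an orthonormal family. Taking \<open>p\<close> to be the
  Fourier coefficients gives Bessel's inequality; dropping the last sum shows that any good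
  trigonometric approximation forces the sum of squared coefficients up.\<close>

lemma approximation_error:
  assumes H: "H \<in> borel_measurable unit_lborel" "integrable unit_lborel (\<lambda>t. (cmod (H t))\<^sup>2)"
    and "finite L"
  shows "(LINT t|unit_lborel. (cmod (H t - (\<Sum>l\<in>L. p l * character l t)))\<^sup>2) =
    (LINT t|unit_lborel. (cmod (H t))\<^sup>2) - (\<Sum>l\<in>L. (cmod (fourier_coeff H l))\<^sup>2)
      + (\<Sum>l\<in>L. (cmod (fourier_coeff H l - p l))\<^sup>2)"
proof -
  note [measurable] = H(1) borel_measurable_unit_lborel[OF measurable_character]
  have iH: "integrable unit_lborel H" by (rule integrable_unit_square_integrable[OF H])
  have i1: "integrable unit_lborel (\<lambda>t. H t * cnj (character l t))" for l
    unfolding cnj_character by (rule Bochner_Integration.integrable_bound[OF iH]) (auto simp: norm_mult)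
  have i2: "integrable unit_lborel (\<lambda>t. cnj (H t) * character l t)" for l
    using integrable_cnj[OF i1[of l]] by simp
  have i3: "integrable unit_lborel (\<lambda>t. character l t * cnj (character k t))" for l k
    unfolding cnj_character by (rule unit_lborel.integrable_const_bound[where B = 1]) (auto simp: norm_mult)
  have v2: "(LINT t|unit_lborel. cnj (H t) * character l t) = cnj (fourier_coeff H l)" for l
    using Bochner_Integration.integral_cnj[of unit_lborel "\<lambda>t. H t * cnj (character l t)"] by (simp add: fourier_coeff_def)
  have v3: "(LINT t|unit_lborel. character l t * cnj (character k t)) = of_bool (l = k)" for l k
    unfolding cnj_character character_mult[symmetric] integral_character by simp
  have i0: "integrable unit_lborel (\<lambda>t. H t * cnj (H t))"
    using integrable_of_real[OF H(2), where 'a = complex] unfolding complex_norm_square .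
  let ?P = "\<lambda>t. \<Sum>l\<in>L. p l * character l t"
  have expand: "(H t - ?P t) * cnj (H t - ?P t) = H t * cnj (H t) - (\<Sum>l\<in>L. cnj (p l) * (H t * cnj (character l t)))
     - (\<Sum>l\<in>L. p l * (cnj (H t) * character l t))
     + (\<Sum>l\<in>L. \<Sum>k\<in>L. p l * cnj (p k) * (character l t * cnj (character k t)))" for t
  proof -
    have "H t * cnj (?P t) = (\<Sum>l\<in>L. cnj (p l) * (H t * cnj (character l t)))"
      by (simp add: sum_distrib_left mult_ac)
    moreover have "?P t * cnj (H t) = (\<Sum>l\<in>L. p l * (cnj (H t) * character l t))"
      by (simp add: sum_distrib_left sum_distrib_right mult_ac)
    moreover have "?P t * cnj (?P t) = (\<Sum>l\<in>L. \<Sum>k\<in>L. p l * cnj (p k) * (character l t * cnj (character k t)))"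
      by (simp add: sum_product mult_ac)
    moreover have "(a - b) * cnj (a - b) = a * cnj a - a * cnj b - b * cnj a + b * cnj b" for a b
      by (simp add: algebra_simps)
    ultimately show ?thesis by metis
  qed
  have "complex_of_real (LINT t|unit_lborel. (cmod (H t - ?P t))\<^sup>2)
    = (LINT t|unit_lborel. complex_of_real ((cmod (H t - ?P t))\<^sup>2))"
    by (rule integral_complex_of_real[symmetric])
  also have "\<dots> = (LINT t|unit_lborel. H t * cnj (H t) - (\<Sum>l\<in>L. cnj (p l) * (H t * cnj (character l t)))
     - (\<Sum>l\<in>L. p l * (cnj (H t) * character l t))
     + (\<Sum>l\<in>L. \<Sum>k\<in>L. p l * cnj (p k) * (character l t * cnj (character k t))))"
    unfolding complex_norm_square expand ..
  also have "\<dots> = (LINT t|unit_lborel. H t * cnj (H t)) - (\<Sum>l\<in>L. cnj (p l) * fourier_coeff H l)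
     - (\<Sum>l\<in>L. p l * cnj (fourier_coeff H l)) + (\<Sum>l\<in>L. \<Sum>k\<in>L. p l * cnj (p k) * of_bool (l = k))"
    using i0 i1 i2 i3
    by (simp add: Bochner_Integration.integral_sum v2 v3 flip: fourier_coeff_def)
  also have "(\<Sum>l\<in>L. \<Sum>k\<in>L. p l * cnj (p k) * of_bool (l = k)) = (\<Sum>l\<in>L. p l * cnj (p l))"
    using \<open>finite L\<close> by (simp add: of_bool_def if_distrib[of "\<lambda>x. _ * x"] cong: if_cong)
  also have "(LINT t|unit_lborel. H t * cnj (H t)) = of_real (LINT t|unit_lborel. (cmod (H t))\<^sup>2)"
    unfolding complex_norm_square[symmetric] by (rule integral_complex_of_real)
  also have "of_real (LINT t|unit_lborel. (cmod (H t))\<^sup>2) - (\<Sum>l\<in>L. cnj (p l) * fourier_coeff H l)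
     - (\<Sum>l\<in>L. p l * cnj (fourier_coeff H l)) + (\<Sum>l\<in>L. p l * cnj (p l))
    = complex_of_real ((LINT t|unit_lborel. (cmod (H t))\<^sup>2) - (\<Sum>l\<in>L. (cmod (fourier_coeff H l))\<^sup>2)
      + (\<Sum>l\<in>L. (cmod (fourier_coeff H l - p l))\<^sup>2))"
    unfolding of_real_add of_real_diff of_real_sum complex_norm_square
    by (simp add: algebra_simps sum.distrib sum_subtractf)
  finally show ?thesis unfolding of_real_eq_iff .
qed

section \<open>Density of trigonometric polynomials in the square-integrable functions\<close>

lemma trig_poly_monomial: "trig_poly (\<lambda>t. c * character l t)"
  unfolding trig_poly_def by (intro exI[of _ "{l}"] exI[of _ "\<lambda>_. c"]) auto

lemma trig_poly_add:
  assumes "trig_poly P" "trig_poly Q"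
  shows "trig_poly (\<lambda>t. P t + Q t)"
proof -
  obtain L p where L: "finite L" "P = (\<lambda>t. \<Sum>l\<in>L. p l * character l t)" using assms(1) unfolding trig_poly_def by blast
  obtain K q where K: "finite K" "Q = (\<lambda>t. \<Sum>l\<in>K. q l * character l t)" using assms(2) unfolding trig_poly_def by blast
  have "P t + Q t = (\<Sum>l\<in>L \<union> K. (p l * of_bool (l \<in> L) + q l * of_bool (l \<in> K)) * character l t)" for t
  proof -
    have "P t = (\<Sum>l\<in>L \<union> K. p l * of_bool (l \<in> L) * character l t)"
      unfolding L using L K by (intro sum.mono_neutral_cong_left) auto
    moreover have "Q t = (\<Sum>l\<in>L \<union> K. q l * of_bool (l \<in> K) * character l t)"
      unfolding K using L K by (intro sum.mono_neutral_cong_left) auto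
    ultimately show ?thesis by (simp add: distrib_right sum.distrib)
  qed
  then show ?thesis
    unfolding trig_poly_def using L(1) K(1)
    by (intro exI[of _ "L \<union> K"] exI[of _ "\<lambda>l. p l * of_bool (l \<in> L) + q l * of_bool (l \<in> K)"]) auto
qed

lemma trig_poly_sum: "(\<And>i. i \<in> I \<Longrightarrow> trig_poly (P i)) \<Longrightarrow> trig_poly (\<lambda>t. \<Sum>i\<in>I. P i t)"
proof (induction I rule: infinite_finite_induct)
  case (insert i I)
  then show ?case by (simp add: trig_poly_add)
qed (use trig_poly_monomial[of 0] in auto)

lemma trig_poly_mult:
  assumes "trig_poly P" "trig_poly Q"
  shows "trig_poly (\<lambda>t. P t * Q t)"
proof -
  obtain L p where L: "P = (\<lambda>t. \<Sum>l\<in>L. p l * character l t)" using assms(1) unfolding trig_poly_def by blast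
  obtain K q where K: "Q = (\<lambda>t. \<Sum>l\<in>K. q l * character l t)" using assms(2) unfolding trig_poly_def by blast
  have "(\<lambda>t. P t * Q t) = (\<lambda>t. \<Sum>l\<in>L. \<Sum>k\<in>K. (p l * q k) * character (l + k) t)"
    unfolding L K by (simp add: sum_product character_mult mult_ac)
  then show ?thesis by (simp add: trig_poly_sum trig_poly_monomial)
qed

lemma trig_poly_const: "trig_poly (\<lambda>t. c)"
  using trig_poly_monomial[of c 0] by (simp add: character_def)

text \<open>A real-linear functional restricted to the circle is a combination of cosine and sine,
  hence of the characters with index 1 and -1; sums and products follow the construction of
  polynomial functions.\<close>

lemma trig_poly_real_polynomial_on_circle:
  fixes g :: "complex \<Rightarrow> real"
  assumes "real_polynomial_function g"
  shows "trig_poly (\<lambda>t. of_real (g (cis (2 * pi * t))))"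
  using assms
proof (induction g rule: real_polynomial_function.induct)
  case (linear f)
  then interpret bounded_linear f .
  have f: "f z = Re z * f 1 + Im z * f \<i>" for z
  proof -
    have "z = Re z *\<^sub>R 1 + Im z *\<^sub>R \<i>" by (simp add: complex_eq_iff)
    then have "f z = f (Re z *\<^sub>R 1 + Im z *\<^sub>R \<i>)" by (rule arg_cong)
    then show ?thesis unfolding add scaleR by simp
  qed
  have "complex_of_real (f (cis (2 * pi * t))) =
    ((f 1 - \<i> * f \<i>) / 2) * character 1 t + ((f 1 + \<i> * f \<i>) / 2) * character (-1) t" for t
    by (subst f) (simp add: character_def complex_eq_iff field_simps)
  then show ?case by (simp only: trig_poly_add trig_poly_monomial)
qed (simp_all add: trig_poly_const trig_poly_add trig_poly_mult)

lemma trig_poly_uniform_approximation: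
  fixes G :: "real \<Rightarrow> complex"
  assumes G: "continuous_on {0..1} G" "G 0 = G 1" and "0 < e"
  shows "\<exists>P. trig_poly P \<and> (\<forall>t\<in>{0..<1}. cmod (G t - P t) < e)"
proof -
  \<comment> \<open>\<open>h\<close> is \<open>G\<close> transplanted to the circle. Continuity
    across angle 0 is the point at issue; it is read off from the circle map attached to the loop
    \<open>G\<close>, taken as homotopic to itself.\<close>
  define h where "h = G \<circ> (\<lambda>z. Arg2pi z / (2 * pi))"
  have "homotopic_loops UNIV G G"
    using G by (simp add: homotopic_loops_refl path_def pathstart_def pathfinish_def)
  then have "continuous_on (sphere 0 1) h"
    unfolding h_def
    by (rule homotopic_with_imp_continuous[OF homotopic_loops_imp_homotopic_circlemaps, THEN conjunct1])
  then obtain g where g: "polynomial_function g" "\<And>z. z \<in> sphere 0 1 \<Longrightarrow> cmod (h z - g z) < e"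
    using Stone_Weierstrass_polynomial_function[OF compact_sphere _ \<open>0 < e\<close>] by metis
  have "real_polynomial_function (\<lambda>z. Re (g z))" "real_polynomial_function (\<lambda>z. Im (g z))"
    using g(1) bounded_linear_Re bounded_linear_Im unfolding polynomial_function_def o_def by blast+
  then have "trig_poly (\<lambda>t. of_real (Re (g (cis (2 * pi * t)))) + \<i> * of_real (Im (g (cis (2 * pi * t)))))"
    by (intro trig_poly_add trig_poly_mult[OF trig_poly_const] trig_poly_real_polynomial_on_circle)
  then have "trig_poly (\<lambda>t. g (cis (2 * pi * t)))"
    by (simp flip: complex_eq)
  moreover have "h (cis (2 * pi * t)) = G t" if "t \<in> {0..<1}" for t
  proof -
    have "Arg2pi (cis (2 * pi * t)) = 2 * pi * t"
      by (rule Arg2pi_unique[where r = 1]) (use that in \<open>auto simp: cis_conv_exp\<close>)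
    then show ?thesis by (simp add: h_def)
  qed
  ultimately show ?thesis
    using g(2) by (intro exI[of _ "\<lambda>t. g (cis (2 * pi * t))"]) (metis dist_0_norm mem_sphere norm_cis)
qed

lemma square_error_triangle:
  fixes f g h :: "real \<Rightarrow> complex"
  assumes [measurable]: "f \<in> borel_measurable unit_lborel" "g \<in> borel_measurable unit_lborel" "h \<in> borel_measurable unit_lborel"
  shows "(\<integral>\<^sup>+t. ennreal ((cmod (f t - h t))\<^sup>2) \<partial>unit_lborel) \<le>
    2 * (\<integral>\<^sup>+t. ennreal ((cmod (f t - g t))\<^sup>2) \<partial>unit_lborel) + 2 * (\<integral>\<^sup>+t. ennreal ((cmod (g t - h t))\<^sup>2) \<partial>unit_lborel)"
proof -
  have sq: "(cmod (a + b))\<^sup>2 \<le> 2 * (cmod a)\<^sup>2 + 2 * (cmod b)\<^sup>2" for a b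
  proof -
    have "(cmod (a + b))\<^sup>2 \<le> (cmod a + cmod b)\<^sup>2" by (intro power_mono norm_triangle_ineq) auto
    also have "\<dots> \<le> 2 * (cmod a)\<^sup>2 + 2 * (cmod b)\<^sup>2"
      using zero_le_power2[of "cmod a - cmod b"] by (simp add: power2_eq_square algebra_simps)
    finally show ?thesis .
  qed
  have "(\<integral>\<^sup>+t. ennreal ((cmod (f t - h t))\<^sup>2) \<partial>unit_lborel) \<le>
    (\<integral>\<^sup>+t. 2 * ennreal ((cmod (f t - g t))\<^sup>2) + 2 * ennreal ((cmod (g t - h t))\<^sup>2) \<partial>unit_lborel)"
    using sq[of "f t - g t" "g t - h t" for t]
    by (intro nn_integral_mono) (simp add: ennreal_mult[symmetric] ennreal_plus[symmetric] flip: ennreal_numeral del: ennreal_plus)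
  then show ?thesis by (simp add: nn_integral_add nn_integral_cmult)
qed

text \<open>Membership in the L2-closure of the trigonometric polynomials. The nonnegative integral
  keeps this meaningful before the difference is known to be square-integrable.\<close>

definition trig_closure :: "(real \<Rightarrow> complex) \<Rightarrow> bool" where
  "trig_closure H \<longleftrightarrow> (\<forall>e>0. \<exists>P. trig_poly P \<and> (\<integral>\<^sup>+t. ennreal ((cmod (H t - P t))\<^sup>2) \<partial>unit_lborel) < ennreal e)"

lemma measurable_trig_poly: "trig_poly P \<Longrightarrow> P \<in> borel_measurable borel"
  unfolding trig_poly_def by auto

lemma trig_closure_limit:
  assumes [measurable]: "H \<in> borel_measurable unit_lborel" "\<And>n. G n \<in> borel_measurable unit_lborel"
    and clo: "\<And>n. trig_closure (G n)"
    and lim: "(\<lambda>n. \<integral>\<^sup>+t. ennreal ((cmod (H t - G n t))\<^sup>2) \<partial>unit_lborel) \<longlonglongrightarrow> 0"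
  shows "trig_closure H"
  unfolding trig_closure_def
proof (intro allI impI)
  fix e :: real assume "0 < e"
  then have "eventually (\<lambda>n. (\<integral>\<^sup>+t. ennreal ((cmod (H t - G n t))\<^sup>2) \<partial>unit_lborel) < ennreal (e / 4)) sequentially"
    using lim by (intro order_tendstoD) auto
  then obtain n where n: "(\<integral>\<^sup>+t. ennreal ((cmod (H t - G n t))\<^sup>2) \<partial>unit_lborel) < ennreal (e / 4)"
    by (auto simp: eventually_sequentially)
  obtain P where P: "trig_poly P" "(\<integral>\<^sup>+t. ennreal ((cmod (G n t - P t))\<^sup>2) \<partial>unit_lborel) < ennreal (e / 4)"
    using clo[of n] \<open>0 < e\<close> unfolding trig_closure_def by (metis divide_pos_pos zero_less_numeral)
  have [measurable]: "P \<in> borel_measurable unit_lborel"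
    by (intro borel_measurable_unit_lborel measurable_trig_poly P)
  have "(\<integral>\<^sup>+t. ennreal ((cmod (H t - P t))\<^sup>2) \<partial>unit_lborel) \<le>
    2 * (\<integral>\<^sup>+t. ennreal ((cmod (H t - G n t))\<^sup>2) \<partial>unit_lborel) + 2 * (\<integral>\<^sup>+t. ennreal ((cmod (G n t - P t))\<^sup>2) \<partial>unit_lborel)"
    by (rule square_error_triangle) measurable
  also have "\<dots> < 2 * ennreal (e / 4) + 2 * ennreal (e / 4)"
    using n P(2) by (intro add_strict_mono ennreal_mult_strict_left_mono) auto
  also have "\<dots> = ennreal e"
    using \<open>0 < e\<close> by (simp add: ennreal_mult[symmetric] ennreal_plus[symmetric] flip: ennreal_numeral del: ennreal_plus)
  finally show "\<exists>P. trig_poly P \<and> (\<integral>\<^sup>+t. ennreal ((cmod (H t - P t))\<^sup>2) \<partial>unit_lborel) < ennreal e"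
    using P(1) by blast
qed

lemma trig_closure_dominated_limit:
  fixes H :: "real \<Rightarrow> complex"
  assumes [measurable]: "H \<in> borel_measurable unit_lborel" "\<And>n. G n \<in> borel_measurable unit_lborel"
    and clo: "\<And>n. trig_closure (G n)"
    and lim: "AE t in unit_lborel. (\<lambda>n. G n t) \<longlonglongrightarrow> H t"
    and bound: "\<And>n t. (cmod (H t - G n t))\<^sup>2 \<le> w t" "integrable unit_lborel w"
  shows "trig_closure H"
proof (rule trig_closure_limit[OF assms(1,2) clo])
  have [measurable]: "w \<in> borel_measurable unit_lborel" using bound(2) by auto
  have w0: "0 \<le> w t" for t using bound(1)[of t 0] by (meson order_trans zero_le_power2)
  have "(\<lambda>n. \<integral>\<^sup>+t. ennreal ((cmod (H t - G n t))\<^sup>2) \<partial>unit_lborel) \<longlonglongrightarrow> (\<integral>\<^sup>+t. 0 \<partial>unit_lborel)"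
  proof (rule nn_integral_dominated_convergence[where w = "\<lambda>t. ennreal (w t)"])
    show "(\<integral>\<^sup>+t. ennreal (w t) \<partial>unit_lborel) < \<infinity>"
      using bound(2) w0 by (simp add: nn_integral_eq_integral)
    show "AE t in unit_lborel. (\<lambda>n. ennreal ((cmod (H t - G n t))\<^sup>2)) \<longlonglongrightarrow> 0"
      using lim
    proof eventually_elim
      case (elim t)
      have "(\<lambda>n. (cmod (H t - G n t))\<^sup>2) \<longlonglongrightarrow> (cmod (H t - H t))\<^sup>2"
        by (intro tendsto_intros elim)
      then show ?case using tendsto_ennrealI by fastforce
    qed
  qed (auto intro!: ennreal_leI bound)
  then show "(\<lambda>n. \<integral>\<^sup>+t. ennreal ((cmod (H t - G n t))\<^sup>2) \<partial>unit_lborel) \<longlonglongrightarrow> 0" by simp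
qed

lemma trig_closure_continuous:
  assumes "continuous_on {0..1} G" "G 0 = G 1"
  shows "trig_closure G"
  unfolding trig_closure_def
proof (intro allI impI)
  fix e :: real assume e: "0 < e"
  obtain P where P: "trig_poly P" "\<And>t. t \<in> {0..<1} \<Longrightarrow> cmod (G t - P t) < sqrt (e / 2)"
    using trig_poly_uniform_approximation[OF assms, of "sqrt (e / 2)"] e by auto
  have "(\<integral>\<^sup>+t. ennreal ((cmod (G t - P t))\<^sup>2) \<partial>unit_lborel) \<le> (\<integral>\<^sup>+t. ennreal (e / 2) \<partial>unit_lborel)"
  proof (intro nn_integral_mono ennreal_leI)
    fix t assume "t \<in> space unit_lborel"
    then have "(cmod (G t - P t))\<^sup>2 \<le> (sqrt (e / 2))\<^sup>2" using P(2)[of t] by (intro power_mono) auto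
    then show "(cmod (G t - P t))\<^sup>2 \<le> e / 2" using e by simp
  qed
  also have "\<dots> = ennreal (e / 2)" by (simp add: emeasure_unit_lborel)
  also have "\<dots> < ennreal e" using e by (simp add: ennreal_lessI)
  finally show "\<exists>P. trig_poly P \<and> (\<integral>\<^sup>+t. ennreal ((cmod (G t - P t))\<^sup>2) \<partial>unit_lborel) < ennreal e"
    using P(1) by blast
qed

text \<open>A measurable function is an almost everywhere limit of continuous functions. Two
  corrections in \<open>G\<close> make these usable: scaling back to modulus at most
  \<open>B\<close>, which provides domination, and the factor \<open>cut\<close>, which vanishes at
  0 and 1 and so makes the end values agree.\<close>

lemma trig_closure_bounded:
  fixes H :: "real \<Rightarrow> complex"
  assumes H [measurable]: "H \<in> borel_measurable borel" and bound: "\<And>t. cmod (H t) \<le> B"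
  shows "trig_closure H"
proof -
  have B: "0 \<le> B" using bound[of 0] norm_ge_zero order_trans by blast
  have "H measurable_on UNIV"
    by (rule lebesgue_measurable_imp_measurable_on) (auto intro: measurable_completion)
  then obtain N g where N: "negligible N" and g: "\<And>n. continuous_on UNIV (g n)"
    and lim: "\<And>x. x \<notin> N \<Longrightarrow> (\<lambda>n. g n x) \<longlonglongrightarrow> H x"
    unfolding measurable_on_def by auto
  define cut where "cut n t = min 1 (min (real n * t) (real n * (1 - t)))" for n and t :: real
  define G where "G n t = of_real (cut n t) * (B / max B (cmod (g n t))) * g n t" for n t
  show ?thesis
  proof (cases "B = 0")
    case True
    then have "H = (\<lambda>_. 0)" using bound by auto
    then show ?thesis using trig_closure_continuous[of "\<lambda>_. 0"] by simp
  next
    case False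
    then have B: "0 < B" using B by simp
    then have mx: "max B x \<noteq> 0" for x by auto
    have contG: "continuous_on UNIV (G n)" for n
      unfolding G_def[abs_def] cut_def using mx g by (intro continuous_intros) auto
    have bG: "cmod (G n t) \<le> B" if "t \<in> {0..<1}" for n t
    proof -
      have "0 \<le> cut n t" "cut n t \<le> 1" using that by (auto simp: cut_def)
      moreover have "B / max B (cmod (g n t)) * cmod (g n t) \<le> B"
        using B by (simp add: field_simps max_def)
      moreover have "0 \<le> B / max B (cmod (g n t)) * cmod (g n t)" using B by (simp add: max_def)
      ultimately have "cut n t * (B / max B (cmod (g n t)) * cmod (g n t)) \<le> 1 * B"
        by (intro mult_mono) auto
      then show ?thesis using B \<open>0 \<le> cut n t\<close> by (simp add: G_def norm_mult norm_divide abs_of_nonneg mult.assoc)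
    qed
    \<comment> \<open>Outside [0, 1) the factor \<open>cut\<close> becomes large and negative,
      whereas the dominated limit asks for a bound at every real point; there \<open>H\<close>
      itself is used.\<close>
    define G' where "G' n t = (if t \<in> {0..<1} then G n t else H t)" for n t
    show ?thesis
    proof (rule trig_closure_dominated_limit[where G = G' and w = "\<lambda>_. (2 * B)\<^sup>2"])
      show "H \<in> borel_measurable unit_lborel" by (intro borel_measurable_unit_lborel H)
      have [measurable]: "G n \<in> borel_measurable borel" for n
        by (intro borel_measurable_continuous_onI contG)
      show "G' n \<in> borel_measurable unit_lborel" for n
        by (rule borel_measurable_unit_lborel) (unfold G'_def[abs_def], measurable)
      have "trig_closure (G n)" for n
        by (rule trig_closure_continuous[OF continuous_on_subset[OF contG]]) (auto simp: G_def cut_def)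
      moreover have "(\<integral>\<^sup>+t. ennreal ((cmod (G n t - P t))\<^sup>2) \<partial>unit_lborel) = (\<integral>\<^sup>+t. ennreal ((cmod (G' n t - P t))\<^sup>2) \<partial>unit_lborel)" for n P
        by (intro nn_integral_cong) (auto simp: G'_def)
      ultimately show "trig_closure (G' n)" for n unfolding trig_closure_def by metis
      show "(cmod (H t - G' n t))\<^sup>2 \<le> (2 * B)\<^sup>2" for n t
      proof (rule power_mono)
        show "cmod (H t - G' n t) \<le> 2 * B"
          using norm_triangle_ineq4[of "H t" "G n t"] bound[of t] bG[of t n] B by (auto simp: G'_def)
      qed simp
      have "AE t in lborel. t \<notin> N"
      proof -
        have "N \<in> null_sets lebesgue" using N by (simp add: negligible_iff_null_sets)
        then have "AE t in lebesgue. t \<notin> N" by (rule AE_not_in)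
        then show ?thesis by (simp add: AE_completion_iff)
      qed
      then have "AE t in lborel. t \<in> {0..<1} \<longrightarrow> (\<lambda>n. G' n t) \<longlonglongrightarrow> H t"
        using AE_lborel_singleton[of 0]
      proof eventually_elim
        case (elim t)
        show ?case
        proof
          assume t: "t \<in> {0..<1}"
          have "eventually (\<lambda>n. 1 / t < real n \<and> 1 / (1 - t) < real n) sequentially"
            by (intro eventually_conj) (metis eventually_at_top_dense filterlim_iff filterlim_real_sequentially)+
          then have "eventually (\<lambda>n. cut n t = 1) sequentially"
            by eventually_elim (use t elim in \<open>auto simp: cut_def field_simps min_def\<close>)
          then have "(\<lambda>n. cut n t) \<longlonglongrightarrow> 1" by (rule tendsto_eventually)
          then have "(\<lambda>n. G n t) \<longlonglongrightarrow> of_real 1 * (B / max B (cmod (H t))) * H t"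
            unfolding G_def using mx[of "cmod (H t)"] elim by (intro tendsto_intros lim tendsto_of_real) auto
          moreover have "max B (cmod (H t)) = B" using bound[of t] by simp
          ultimately show "(\<lambda>n. G' n t) \<longlonglongrightarrow> H t" using t B by (simp add: G'_def)
        qed
      qed
      then show "AE t in unit_lborel. (\<lambda>n. G' n t) \<longlonglongrightarrow> H t"
        unfolding unit_lborel_def by (subst AE_restrict_space_iff) auto
    qed auto
  qed
qed

lemma trig_closure_square_integrable:
  fixes H :: "real \<Rightarrow> complex"
  assumes H [measurable]: "H \<in> borel_measurable borel" and int: "integrable unit_lborel (\<lambda>t. (cmod (H t))\<^sup>2)"
  shows "trig_closure H"
proof (rule trig_closure_dominated_limit)
  let ?G = "\<lambda>n t. if cmod (H t) \<le> real n then H t else 0"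
  show "trig_closure (?G n)" for n
    by (rule trig_closure_bounded[where B = "real n"]) auto
  show "?G n \<in> borel_measurable unit_lborel" for n
    by (rule borel_measurable_unit_lborel) measurable
  show "H \<in> borel_measurable unit_lborel" by (rule borel_measurable_unit_lborel) measurable
  show "AE t in unit_lborel. (\<lambda>n. ?G n t) \<longlonglongrightarrow> H t"
  proof (rule AE_I2)
    fix t
    obtain n0 where "cmod (H t) \<le> real n0" using real_arch_simple by blast
    then have "eventually (\<lambda>n. ?G n t = H t) sequentially"
      by (auto simp: eventually_sequentially intro!: exI[of _ n0])
    then show "(\<lambda>n. ?G n t) \<longlonglongrightarrow> H t" by (rule tendsto_eventually)
  qed
  show "(cmod (H t - ?G n t))\<^sup>2 \<le> (cmod (H t))\<^sup>2" for n t by auto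
qed (rule int)

theorem parseval_unit_interval:
  fixes H :: "real \<Rightarrow> complex"
  assumes H: "H \<in> borel_measurable borel" "integrable unit_lborel (\<lambda>t. (cmod (H t))\<^sup>2)"
  shows "((\<lambda>l. (cmod (fourier_coeff H l))\<^sup>2) has_sum (LINT t|unit_lborel. (cmod (H t))\<^sup>2)) UNIV"
proof -
  let ?c = "\<lambda>l. (cmod (fourier_coeff H l))\<^sup>2" and ?I = "LINT t|unit_lborel. (cmod (H t))\<^sup>2"
  have Hm: "H \<in> borel_measurable unit_lborel" by (rule borel_measurable_unit_lborel[OF H(1)])
  note err = approximation_error[OF Hm H(2)]
  have bessel: "sum ?c L \<le> ?I" if "finite L" for L
  proof -
    have "0 \<le> (LINT t|unit_lborel. (cmod (H t - (\<Sum>l\<in>L. fourier_coeff H l * character l t)))\<^sup>2)" by simp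
    then show ?thesis unfolding err[OF that] by simp
  qed
  have "(sum ?c \<longlongrightarrow> ?I) (finite_subsets_at_top UNIV)"
  proof (rule order_tendstoI)
    \<comment> \<open>A trigonometric polynomial with squared error below \<open>?I - a\<close>
      forces the partial sum over its spectrum above \<open>a\<close>, and larger index sets only
      add nonnegative terms.\<close>
    fix a assume "a < ?I"
    then obtain P where P: "trig_poly P"
      "(\<integral>\<^sup>+t. ennreal ((cmod (H t - P t))\<^sup>2) \<partial>unit_lborel) < ennreal (?I - a)"
      using trig_closure_square_integrable[OF H] unfolding trig_closure_def by (metis diff_gt_0_iff_gt)
    obtain L p where L: "finite L" "P = (\<lambda>t. \<Sum>l\<in>L. p l * character l t)"
      using P(1) unfolding trig_poly_def by blast
    have [measurable]: "P \<in> borel_measurable unit_lborel" "H \<in> borel_measurable unit_lborel"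
      by (auto intro: borel_measurable_unit_lborel measurable_trig_poly P H)
    have "integrable unit_lborel (\<lambda>t. (cmod (H t - P t))\<^sup>2)"
      using P(2) by (intro integrableI_bounded) (auto intro: order.strict_trans)
    then have "(LINT t|unit_lborel. (cmod (H t - P t))\<^sup>2) < ?I - a"
      using P(2) \<open>a < ?I\<close> by (simp add: nn_integral_eq_integral ennreal_less_iff)
    then have "a < sum ?c L"
      using err[OF L(1), of p] L(2) sum_nonneg[of L "\<lambda>l. (cmod (fourier_coeff H l - p l))\<^sup>2"] by simp
    then have "a < sum ?c K" if "finite K" "L \<subseteq> K" for K
      using sum_mono2[OF that, of ?c] by simp
    then show "eventually (\<lambda>K. a < sum ?c K) (finite_subsets_at_top UNIV)"
      unfolding eventually_finite_subsets_at_top using L(1) by blast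
  next
    fix a assume "?I < a"
    then have "sum ?c K < a" if "finite K" for K using bessel[OF that] by simp
    then show "eventually (\<lambda>K. sum ?c K < a) (finite_subsets_at_top UNIV)"
      unfolding eventually_finite_subsets_at_top by blast
  qed
  then show ?thesis by (simp add: has_sum_def)
qed

lemma nn_integral_count_space_has_sum:
  fixes f :: "'a \<Rightarrow> real"
  assumes "(f has_sum s) A" "\<And>x. x \<in> A \<Longrightarrow> 0 \<le> f x"
  shows "(\<integral>\<^sup>+x. ennreal (f x) \<partial>count_space A) = ennreal s"
proof -
  have "f summable_on A" using assms(1) by (rule has_sum_imp_summable)
  then have "(\<lambda>x. norm (f x)) summable_on A"
    using assms(2) by (simp cong: summable_on_cong)
  then have "Infinite_Set_Sum.abs_summable_on f A" by (rule abs_summable_equivalent[THEN iffD1])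
  then show ?thesis
    using assms by (simp add: nn_integral_conv_infsetsum infsetsum_infsum infsumI)
qed

section \<open>Fiberization of the Gabor frame operator\<close>

lemma nn_integral_count_space_int:
  fixes g :: "int \<Rightarrow> ennreal"
  shows "(\<integral>\<^sup>+k. g k \<partial>count_space UNIV) = (\<Sum>i. g (int_decode i))"
  using nn_integral_bij_count_space[OF bij_int_decode, of g] by (simp add: nn_integral_count_space_nat)

lemma nn_integral_count_space_int_exchange:
  fixes f :: "int \<Rightarrow> 'a \<Rightarrow> ennreal"
  assumes "\<And>k. f k \<in> borel_measurable M"
  shows "(\<integral>\<^sup>+x. \<integral>\<^sup>+k. f k x \<partial>count_space UNIV \<partial>M) = (\<integral>\<^sup>+k. \<integral>\<^sup>+x. f k x \<partial>M \<partial>count_space UNIV)"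
  unfolding nn_integral_count_space_int using assms by (rule nn_integral_suminf)

lemma nn_integral_periodization:
  fixes F :: "real \<Rightarrow> ennreal"
  assumes [measurable]: "F \<in> borel_measurable borel"
  shows "(\<integral>\<^sup>+x. F x \<partial>lborel) = (\<integral>\<^sup>+t. \<integral>\<^sup>+k. F (t + of_int k) \<partial>count_space UNIV \<partial>unit_lborel)"
proof -
  have cover: "F x = (\<integral>\<^sup>+k. F x * indicator {of_int k..<of_int k + 1} x \<partial>count_space UNIV)" for x
  proof -
    have "(\<integral>\<^sup>+k. F x * indicator {of_int k..<of_int k + 1} x \<partial>count_space UNIV)
        = (\<Sum>k\<in>{\<lfloor>x\<rfloor>}. F x * indicator {of_int k..<of_int k + 1} x)"
      by (rule nn_integral_count_space') (auto split: split_indicator dest: floor_unique)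
    then show ?thesis by (simp add: indicator_def)
  qed
  have "(\<integral>\<^sup>+x. F x \<partial>lborel) = (\<integral>\<^sup>+k. \<integral>\<^sup>+x. F x * indicator {of_int k..<of_int k + 1} x \<partial>lborel \<partial>count_space UNIV)"
    by (subst cover, rule nn_integral_count_space_int_exchange) measurable
  also have "\<dots> = (\<integral>\<^sup>+k. \<integral>\<^sup>+t. F (t + of_int k) \<partial>unit_lborel \<partial>count_space UNIV)"
  proof (rule nn_integral_cong)
    fix k :: int
    have "(\<integral>\<^sup>+x. F x * indicator {of_int k..<of_int k + 1} x \<partial>lborel)
       = (\<integral>\<^sup>+t. F (of_int k + 1 * t) * indicator {of_int k..<of_int k + 1} (of_int k + 1 * t) \<partial>lborel)"
      by (subst nn_integral_real_affine[where c = 1 and t = "of_int k"]) simp_all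
    also have "\<dots> = (\<integral>\<^sup>+t. F (t + of_int k) * indicator {0..<1} t \<partial>lborel)"
      by (intro nn_integral_cong) (auto simp: add.commute split: split_indicator)
    also have "\<dots> = (\<integral>\<^sup>+t. F (t + of_int k) \<partial>unit_lborel)"
      unfolding unit_lborel_def by (rule nn_integral_restrict_space[symmetric]) simp
    finally show "(\<integral>\<^sup>+x. F x * indicator {of_int k..<of_int k + 1} x \<partial>lborel) = (\<integral>\<^sup>+t. F (t + of_int k) \<partial>unit_lborel)" .
  qed
  also have "\<dots> = (\<integral>\<^sup>+t. \<integral>\<^sup>+k. F (t + of_int k) \<partial>count_space UNIV \<partial>unit_lborel)"
    by (intro nn_integral_count_space_int_exchange[symmetric] borel_measurable_unit_lborel) measurable
  finally show ?thesis .
qed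

text \<open>The bridge from nonnegative integrals, in which sums are interchanged freely, to the
  unconditional sums in the definition of a frame.\<close>

lemma has_sum_of_nn_integral:
  fixes f :: "'a \<Rightarrow> real"
  assumes "\<And>x. x \<in> A \<Longrightarrow> 0 \<le> f x" "(\<integral>\<^sup>+x. ennreal (f x) \<partial>count_space A) < \<infinity>"
  shows "f summable_on A" "ennreal (infsum f A) = (\<integral>\<^sup>+x. ennreal (f x) \<partial>count_space A)"
proof -
  have "(\<integral>\<^sup>+x. ennreal (norm (f x)) \<partial>count_space A) = (\<integral>\<^sup>+x. ennreal (f x) \<partial>count_space A)"
    using assms(1) by (intro nn_integral_cong) auto
  then have "Infinite_Set_Sum.abs_summable_on f A"
    unfolding Infinite_Set_Sum.abs_summable_on_def using assms(2) by (intro integrableI_bounded) auto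
  then have "(\<lambda>x. norm (f x)) summable_on A" by (rule abs_summable_equivalent[THEN iffD2])
  then show s: "f summable_on A" using assms(1) by (simp cong: summable_on_cong)
  show "ennreal (infsum f A) = (\<integral>\<^sup>+x. ennreal (f x) \<partial>count_space A)"
    using nn_integral_count_space_has_sum[OF has_sum_infsum[OF s]] assms(1) by simp
qed

lemma nn_integral_of_L2:
  assumes "f \<in> L2"
  shows "(\<integral>\<^sup>+t. ennreal ((cmod (f t))\<^sup>2) \<partial>lborel) = ennreal ((L2_norm f)\<^sup>2)"
  using assms unfolding L2_def L2_norm_def by (simp add: nn_integral_eq_integral)

context spline_generator
begin

abbreviation window :: "real \<Rightarrow> complex" where
  "window \<equiv> \<lambda>t. complex_of_real (\<phi> t)"

lemma measurable_window [measurable]: "\<phi> \<in> borel_measurable borel"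
  by (intro borel_measurable_continuous_onI continuous)

lemma tf_shift_eq: "tf_shift (\<alpha> * of_int j, of_int l) window t = character l t * of_real (\<phi> (t - \<alpha> * of_int j))"
  by (simp add: tf_shift_def character_def cis_conv_exp mult_ac)

lemma tf_shift_in_L2: "tf_shift (\<alpha> * of_int j, of_int l) window \<in> L2"
proof -
  obtain C where C: "\<And>x. \<bar>\<phi> x\<bar> \<le> C" using bounded by blast
  have "integrable lborel (\<lambda>t. (cmod (tf_shift (\<alpha> * of_int j, of_int l) window t))\<^sup>2)"
  proof (rule Bochner_Integration.integrable_bound)
    show "integrable lborel (\<lambda>t. C\<^sup>2 * indicator {\<alpha> * of_int j..\<alpha> * of_int j + real (n + 2)} t)"
      by (intro integrable_mult_right integrable_real_indicator) auto
    show "AE t in lborel. norm ((cmod (tf_shift (\<alpha> * of_int j, of_int l) window t))\<^sup>2)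
        \<le> norm (C\<^sup>2 * indicator {\<alpha> * of_int j..\<alpha> * of_int j + real (n + 2)} t)"
    proof (rule AE_I2)
      fix t
      have "(\<phi> (t - \<alpha> * of_int j))\<^sup>2 \<le> C\<^sup>2 * indicator {\<alpha> * of_int j..\<alpha> * of_int j + real (n + 2)} t"
      proof (cases "\<phi> (t - \<alpha> * of_int j) = 0")
        case False
        then have "t \<in> {\<alpha> * of_int j..\<alpha> * of_int j + real (n + 2)}" using support[of "t - \<alpha> * of_int j"] by auto
        then show ?thesis using power_mono[OF C[of "t - \<alpha> * of_int j"], of 2] by simp
      qed simp
      then show "norm ((cmod (tf_shift (\<alpha> * of_int j, of_int l) window t))\<^sup>2)
        \<le> norm (C\<^sup>2 * indicator {\<alpha> * of_int j..\<alpha> * of_int j + real (n + 2)} t)"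
        by (simp add: tf_shift_eq norm_mult)
    qed
  qed (unfold tf_shift_eq, measurable)
  moreover have "tf_shift (\<alpha> * of_int j, of_int l) window \<in> borel_measurable lborel"
    unfolding tf_shift_eq[abs_def] by measurable
  ultimately show ?thesis by (simp add: L2_def)
qed

lemma integrable_L2_times_window:
  assumes "f \<in> L2"
  shows "integrable lborel (\<lambda>t. f t * of_real (\<phi> (t - a)))"
proof -
  have [measurable]: "f \<in> borel_measurable borel" and fint: "integrable lborel (\<lambda>t. (cmod (f t))\<^sup>2)"
    using assms by (auto simp: L2_def)
  obtain C where C: "0 < C" "\<And>x. \<bar>\<phi> x\<bar> \<le> C" using bounded by blast
  have xx: "x \<le> 1 + x\<^sup>2" for x :: real
    using zero_le_power2[of "x - 1 / 2"] by (simp add: power2_eq_square algebra_simps)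
  show ?thesis
  proof (rule Bochner_Integration.integrable_bound)
    show "integrable lborel (\<lambda>t. C * (indicator {a..a + real (n + 2)} t + (cmod (f t))\<^sup>2))"
      by (intro integrable_mult_right Bochner_Integration.integrable_add integrable_real_indicator fint) auto
    show "AE t in lborel. norm (f t * of_real (\<phi> (t - a))) \<le> norm (C * (indicator {a..a + real (n + 2)} t + (cmod (f t))\<^sup>2))"
    proof (rule AE_I2)
      fix t
      have "cmod (f t) * \<bar>\<phi> (t - a)\<bar> \<le> (indicator {a..a + real (n + 2)} t + (cmod (f t))\<^sup>2) * C"
      proof (cases "\<phi> (t - a) = 0")
        case False
        then have "t \<in> {a..a + real (n + 2)}" using support[of "t - a"] by auto
        then have "cmod (f t) \<le> indicator {a..a + real (n + 2)} t + (cmod (f t))\<^sup>2" using xx by simp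
        then show ?thesis using C by (intro mult_mono) auto
      qed (use C in auto)
      then show "norm (f t * of_real (\<phi> (t - a))) \<le> norm (C * (indicator {a..a + real (n + 2)} t + (cmod (f t))\<^sup>2))"
        using C by (simp add: norm_mult abs_mult abs_of_nonneg mult.commute)
    qed
  qed measurable
qed

text \<open>The modulation has period one, so cutting the line into unit intervals folds the inner
  product into an integral over [0, 1). The fixed finite set \<open>K\<close> contains every active
  index for all \<open>t\<close> in [0, 1); it yields a finite sum of Borel functions, whereas
  \<open>synth\<close> sums over a set that varies with \<open>t\<close>.\<close>

lemma L2_inner_eq_fourier_coeff:
  fixes \<alpha> :: real and j l :: int
  assumes "f \<in> L2"
  defines "K \<equiv> {\<lfloor>\<alpha> * of_int j\<rfloor> - 1..\<lceil>\<alpha> * of_int j\<rceil> + int n + 2}"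
  shows "L2_inner f (tf_shift (\<alpha> * of_int j, of_int l) window)
    = fourier_coeff (\<lambda>t. \<Sum>k\<in>K. f (t + of_int k) * of_real (\<phi> (t - \<alpha> * of_int j + of_int k))) l"
    and "t \<in> {0..<1} \<Longrightarrow> (\<Sum>k\<in>K. f (t + of_int k) * of_real (\<phi> (t - \<alpha> * of_int j + of_int k)))
      = synth \<phi> (\<lambda>k. f (t + of_int k)) (t - \<alpha> * of_int j)"
proof -
  have [measurable]: "f \<in> borel_measurable borel" using assms by (auto simp: L2_def)
  have inK: "k \<in> K" if "\<phi> (t - \<alpha> * of_int j + of_int k) \<noteq> 0" "t \<in> {0..<1}" for t k
    using that support[of "t - \<alpha> * of_int j + of_int k"] unfolding K_def atLeastAtMost_iff atLeastLessThan_iff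
    by (auto; linarith)
  show "t \<in> {0..<1} \<Longrightarrow> (\<Sum>k\<in>K. f (t + of_int k) * of_real (\<phi> (t - \<alpha> * of_int j + of_int k)))
      = synth \<phi> (\<lambda>k. f (t + of_int k)) (t - \<alpha> * of_int j)"
    using inK by (intro synth_eq_sum[symmetric]) (auto simp: K_def)
  define h where "h t = f t * of_real (\<phi> (t - \<alpha> * of_int j)) * cnj (character l t)" for t
  have [measurable]: "h \<in> borel_measurable borel" unfolding h_def[abs_def] cnj_character by measurable
  have hint: "integrable lborel h"
    by (rule Bochner_Integration.integrable_bound[OF integrable_L2_times_window[OF assms(1), of "\<alpha> * of_int j"]])
      (auto simp: h_def norm_mult)
  have cover: "h x = (\<Sum>k\<in>K. indicator {of_int k..<of_int k + 1} x *\<^sub>R h x)" for x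
  proof (cases "\<phi> (x - \<alpha> * of_int j) = 0")
    case False
    have "\<lfloor>x\<rfloor> \<in> K"
      using inK[of "x - of_int \<lfloor>x\<rfloor>" "\<lfloor>x\<rfloor>"] False floor_correct[of x] by (auto simp: algebra_simps)
    then have "(\<Sum>k\<in>K. indicator {of_int k..<of_int k + 1} x *\<^sub>R h x) = (\<Sum>k\<in>{\<lfloor>x\<rfloor>}. indicator {of_int k..<of_int k + 1} x *\<^sub>R h x)"
      by (intro sum.mono_neutral_right) (auto simp: K_def dest: floor_unique split: split_indicator)
    then show ?thesis by (simp add: indicator_def)
  qed (simp add: h_def)
  have piece: "(LINT x|lborel. indicator {of_int k..<of_int k + 1} x *\<^sub>R h x) = (LINT t|unit_lborel. h (t + of_int k))"
    and ipiece: "integrable unit_lborel (\<lambda>t. h (t + of_int k))" for k :: int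
  proof -
    have ind: "indicator {of_int k..<of_int k + 1} (of_int k + 1 * x) *\<^sub>R h (of_int k + 1 * x)
        = indicator {0..<1} x *\<^sub>R h (x + of_int k)" for x
      by (auto simp: add.commute split: split_indicator)
    have "(LINT x|lborel. indicator {of_int k..<of_int k + 1} x *\<^sub>R h x)
       = (LINT x|lborel. indicator {of_int k..<of_int k + 1} (of_int k + 1 * x) *\<^sub>R h (of_int k + 1 * x))"
      by (subst lborel_integral_real_affine[where c = 1 and t = "of_int k"]) simp_all
    also have "\<dots> = (LINT t|unit_lborel. h (t + of_int k))"
      unfolding ind unit_lborel_def by (rule integral_restrict_space[symmetric]) simp
    finally show "(LINT x|lborel. indicator {of_int k..<of_int k + 1} x *\<^sub>R h x) = (LINT t|unit_lborel. h (t + of_int k))" .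
    have "integrable lborel (\<lambda>x. indicator {of_int k..<of_int k + 1} x *\<^sub>R h x)"
      by (intro integrable_mult_indicator hint) auto
    then have "integrable lborel (\<lambda>x. indicator {of_int k..<of_int k + 1} (of_int k + 1 * x) *\<^sub>R h (of_int k + 1 * x))"
      by (rule lborel_integrable_real_affine) simp
    then show "integrable unit_lborel (\<lambda>t. h (t + of_int k))"
      unfolding ind unit_lborel_def by (subst integrable_restrict_space) auto
  qed
  have "L2_inner f (tf_shift (\<alpha> * of_int j, of_int l) window) = (LINT t|lborel. h t)"
    unfolding L2_inner_def tf_shift_eq h_def by (simp add: mult_ac)
  also have "\<dots> = (LINT x|lborel. (\<Sum>k\<in>K. indicator {of_int k..<of_int k + 1} x *\<^sub>R h x))"
    by (subst cover) (rule refl)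
  also have "\<dots> = (\<Sum>k\<in>K. (LINT x|lborel. indicator {of_int k..<of_int k + 1} x *\<^sub>R h x))"
    by (intro Bochner_Integration.integral_sum integrable_mult_indicator hint) auto
  also have "\<dots> = (\<Sum>k\<in>K. (LINT t|unit_lborel. h (t + of_int k)))" by (simp only: piece)
  also have "\<dots> = (LINT t|unit_lborel. (\<Sum>k\<in>K. h (t + of_int k)))"
    by (intro Bochner_Integration.integral_sum[symmetric] ipiece)
  also have "\<dots> = fourier_coeff (\<lambda>t. \<Sum>k\<in>K. f (t + of_int k) * of_real (\<phi> (t - \<alpha> * of_int j + of_int k))) l"
  proof -
    have "character l (t + of_int k) = character l t" for t k
    proof -
      have "cis (2 * pi * of_int (l * k)) = 1" using cis_multiple_2pi[of "of_int (l * k)"] by simp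
      then show ?thesis by (simp add: character_def distrib_left mult.assoc flip: cis_mult)
    qed
    then show ?thesis
      unfolding fourier_coeff_def h_def sum_distrib_right by (simp add: algebra_simps)
  qed
  finally show "L2_inner f (tf_shift (\<alpha> * of_int j, of_int l) window)
    = fourier_coeff (\<lambda>t. \<Sum>k\<in>K. f (t + of_int k) * of_real (\<phi> (t - \<alpha> * of_int j + of_int k))) l" .
qed

lemma measurable_fiber_norm:
  fixes f :: "real \<Rightarrow> complex"
  assumes "f \<in> L2"
  shows "(\<lambda>t. \<integral>\<^sup>+k. ennreal ((cmod (f (t + of_int k)))\<^sup>2) \<partial>count_space UNIV) \<in> borel_measurable unit_lborel"
proof -
  have [measurable]: "f \<in> borel_measurable borel" using assms by (auto simp: L2_def)
  show ?thesis
    unfolding nn_integral_count_space_int by (rule borel_measurable_unit_lborel) measurable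
qed

lemma fiber_norm:
  assumes "f \<in> L2"
  shows "(\<integral>\<^sup>+t. \<integral>\<^sup>+k. ennreal ((cmod (f (t + of_int k)))\<^sup>2) \<partial>count_space UNIV \<partial>unit_lborel) = ennreal ((L2_norm f)\<^sup>2)"
proof -
  have [measurable]: "f \<in> borel_measurable borel" using assms by (auto simp: L2_def)
  show ?thesis using nn_integral_periodization[of "\<lambda>t. ennreal ((cmod (f t))\<^sup>2)"] nn_integral_of_L2[OF assms] by simp
qed

lemma measurable_synth_fiber:
  assumes "f \<in> L2"
  shows "(\<lambda>t. ennreal ((cmod (synth \<phi> (\<lambda>k. f (t + of_int k)) (t - \<alpha> * of_int j)))\<^sup>2)) \<in> borel_measurable unit_lborel"
proof -
  have [measurable]: "f \<in> borel_measurable borel" using assms by (auto simp: L2_def)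
  have "(\<lambda>t. ennreal ((cmod (\<Sum>k\<in>{\<lfloor>\<alpha> * of_int j\<rfloor> - 1..\<lceil>\<alpha> * of_int j\<rceil> + int n + 2}.
      f (t + of_int k) * of_real (\<phi> (t - \<alpha> * of_int j + of_int k))))\<^sup>2)) \<in> borel_measurable unit_lborel"
    by (rule borel_measurable_unit_lborel) measurable
  then show ?thesis
    by (rule measurable_cong[THEN iffD1, rotated]) (use L2_inner_eq_fourier_coeff(2)[OF assms] in auto)
qed

text \<open>For fixed \<open>j\<close> the inner products over \<open>l\<close> are the Fourier
  coefficients of one function, and Parseval sums their squares; the sum over \<open>j\<close> moves
  inside by Tonelli's theorem. The square-integrability that Parseval requires comes from the upper
  synthesis bound.\<close>

lemma gabor_fiberization:
  assumes \<alpha>: "0 < \<alpha>" and f: "f \<in> L2"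
  shows "(\<integral>\<^sup>+z. ennreal ((cmod (L2_inner f (tf_shift z window)))\<^sup>2) \<partial>count_space (rect_lattice \<alpha>))
    = (\<integral>\<^sup>+t. \<integral>\<^sup>+j. ennreal ((cmod (synth \<phi> (\<lambda>k. f (t + of_int k)) (t - \<alpha> * of_int j)))\<^sup>2)
        \<partial>count_space UNIV \<partial>unit_lborel)"
proof -
  have [measurable]: "f \<in> borel_measurable borel" using f by (auto simp: L2_def)
  let ?s = "\<lambda>j t. ennreal ((cmod (synth \<phi> (\<lambda>k. f (t + of_int k)) (t - \<alpha> * of_int j)))\<^sup>2)"
  let ?g = "\<lambda>(j, l). ennreal ((cmod (L2_inner f (tf_shift (\<alpha> * of_int j, of_int l) window)))\<^sup>2)"
  have row: "(\<integral>\<^sup>+l. ?g (j, l) \<partial>count_space UNIV) = (\<integral>\<^sup>+t. ?s j t \<partial>unit_lborel)" for j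
  proof -
    define H where "H t = (\<Sum>k\<in>{\<lfloor>\<alpha> * of_int j\<rfloor> - 1..\<lceil>\<alpha> * of_int j\<rceil> + int n + 2}.
      f (t + of_int k) * of_real (\<phi> (t - \<alpha> * of_int j + of_int k)))" for t
    have [measurable]: "H \<in> borel_measurable borel" unfolding H_def[abs_def] by measurable
    have Hs: "(\<integral>\<^sup>+t. ennreal ((cmod (H t))\<^sup>2) \<partial>unit_lborel) = (\<integral>\<^sup>+t. ?s j t \<partial>unit_lborel)"
      unfolding H_def using L2_inner_eq_fourier_coeff(2)[OF f] by (intro nn_integral_cong) auto
    obtain B where B: "\<And>t c. (\<integral>\<^sup>+j. ennreal ((cmod (synth \<phi> c (t - \<alpha> * of_int j)))\<^sup>2) \<partial>count_space UNIV)
      \<le> ennreal B * (\<integral>\<^sup>+k. ennreal ((cmod (c k))\<^sup>2) \<partial>count_space UNIV)"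
      using synthesis_upper_bound[OF \<alpha>] by blast
    have "(\<integral>\<^sup>+t. ?s j t \<partial>unit_lborel)
      \<le> (\<integral>\<^sup>+t. ennreal B * (\<integral>\<^sup>+k. ennreal ((cmod (f (t + of_int k)))\<^sup>2) \<partial>count_space UNIV) \<partial>unit_lborel)"
    proof (intro nn_integral_mono)
      fix t
      have "?s j t = (\<integral>\<^sup>+i. ?s i t \<partial>count_space {j})" by (simp add: nn_integral_count_space_finite)
      also have "\<dots> \<le> (\<integral>\<^sup>+i. ?s i t \<partial>count_space UNIV)"
        by (subst nn_integral_count_space_indicator) (auto intro!: nn_integral_mono simp: indicator_def)
      also have "\<dots> \<le> ennreal B * (\<integral>\<^sup>+k. ennreal ((cmod (f (t + of_int k)))\<^sup>2) \<partial>count_space UNIV)" by (rule B)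
      finally show "?s j t \<le> ennreal B * (\<integral>\<^sup>+k. ennreal ((cmod (f (t + of_int k)))\<^sup>2) \<partial>count_space UNIV)" .
    qed
    also have "\<dots> \<le> ennreal B * (\<integral>\<^sup>+t. (\<integral>\<^sup>+k. ennreal ((cmod (f (t + of_int k)))\<^sup>2) \<partial>count_space UNIV) \<partial>unit_lborel)"
      by (subst nn_integral_cmult) (auto intro: measurable_fiber_norm f)
    also have "\<dots> < \<infinity>" unfolding fiber_norm[OF f] by (simp add: ennreal_mult_less_top)
    finally have fin: "(\<integral>\<^sup>+t. ennreal ((cmod (H t))\<^sup>2) \<partial>unit_lborel) < \<infinity>" unfolding Hs .
    have int: "integrable unit_lborel (\<lambda>t. (cmod (H t))\<^sup>2)"
      using fin by (intro integrableI_bounded borel_measurable_unit_lborel) auto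
    have "(\<integral>\<^sup>+l. ?g (j, l) \<partial>count_space UNIV) = (\<integral>\<^sup>+l. ennreal ((cmod (fourier_coeff H l))\<^sup>2) \<partial>count_space UNIV)"
      unfolding H_def[abs_def] by (simp add: L2_inner_eq_fourier_coeff(1)[OF f])
    also have "\<dots> = ennreal (LINT t|unit_lborel. (cmod (H t))\<^sup>2)"
      by (rule nn_integral_count_space_has_sum[OF parseval_unit_interval[OF _ int]]) auto
    also have "\<dots> = (\<integral>\<^sup>+t. ennreal ((cmod (H t))\<^sup>2) \<partial>unit_lborel)"
      using int by (simp add: nn_integral_eq_integral)
    finally show ?thesis unfolding Hs .
  qed
  have bij: "bij_betw (\<lambda>(j, l). (\<alpha> * of_int j, of_int l)) UNIV (rect_lattice \<alpha>)"
    using \<alpha> by (auto simp: bij_betw_def inj_on_def rect_lattice_def)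
  have "(\<integral>\<^sup>+z. ennreal ((cmod (L2_inner f (tf_shift z window)))\<^sup>2) \<partial>count_space (rect_lattice \<alpha>))
    = (\<integral>\<^sup>+p. ?g p \<partial>count_space UNIV)"
    by (subst nn_integral_bij_count_space[OF bij, symmetric]) (simp add: case_prod_unfold)
  also have "\<dots> = (\<integral>\<^sup>+j. \<integral>\<^sup>+l. ?g (j, l) \<partial>count_space UNIV \<partial>count_space UNIV)"
    by (rule nn_integral_fst_count_space[symmetric])
  also have "\<dots> = (\<integral>\<^sup>+j. \<integral>\<^sup>+t. ?s j t \<partial>unit_lborel \<partial>count_space UNIV)"
    by (simp only: row)
  also have "\<dots> = (\<integral>\<^sup>+t. \<integral>\<^sup>+j. ?s j t \<partial>count_space UNIV \<partial>unit_lborel)"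
    by (rule nn_integral_count_space_int_exchange[symmetric]) (rule measurable_synth_fiber[OF f])
  finally show ?thesis .
qed

text \<open>The synthesis bounds hold at every \<open>t\<close> with the same constants, so they
  integrate over the fibers to frame bounds. The upper constant is \<open>max A B\<close> because
  the definition asks for \<open>A <= B\<close>.\<close>

lemma gabor_frame_if:
  assumes \<alpha>: "0 < \<alpha>" "\<alpha> < 1"
  shows "gabor_frame window (rect_lattice \<alpha>)"
proof -
  obtain A where A: "0 < A" "\<And>t c. ennreal A * (\<integral>\<^sup>+k. ennreal ((cmod (c k))\<^sup>2) \<partial>count_space UNIV) \<le>
    (\<integral>\<^sup>+j. ennreal ((cmod (synth \<phi> c (t - \<alpha> * of_int j)))\<^sup>2) \<partial>count_space UNIV)"
    using synthesis_lower_bound[OF \<alpha>] by blast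
  obtain B where B: "0 < B" "\<And>t c. (\<integral>\<^sup>+j. ennreal ((cmod (synth \<phi> c (t - \<alpha> * of_int j)))\<^sup>2) \<partial>count_space UNIV)
      \<le> ennreal B * (\<integral>\<^sup>+k. ennreal ((cmod (c k))\<^sup>2) \<partial>count_space UNIV)"
    using synthesis_upper_bound[OF \<alpha>(1)] by blast
  have bounds: "ennreal (A * (L2_norm f)\<^sup>2) \<le> (\<integral>\<^sup>+z. ennreal ((cmod (L2_inner f (tf_shift z window)))\<^sup>2) \<partial>count_space (rect_lattice \<alpha>))"
    "(\<integral>\<^sup>+z. ennreal ((cmod (L2_inner f (tf_shift z window)))\<^sup>2) \<partial>count_space (rect_lattice \<alpha>)) \<le> ennreal (max A B * (L2_norm f)\<^sup>2)"
    if f: "f \<in> L2" for f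
  proof -
    have [measurable]: "f \<in> borel_measurable borel" using f by (auto simp: L2_def)
    let ?n = "\<lambda>t. \<integral>\<^sup>+k. ennreal ((cmod (f (t + of_int k)))\<^sup>2) \<partial>count_space UNIV"
    have [measurable]: "?n \<in> borel_measurable unit_lborel" by (rule measurable_fiber_norm[OF f])
    have "ennreal (A * (L2_norm f)\<^sup>2) = (\<integral>\<^sup>+t. ennreal A * ?n t \<partial>unit_lborel)"
      using A(1) by (simp add: nn_integral_cmult fiber_norm[OF f] ennreal_mult)
    then show "ennreal (A * (L2_norm f)\<^sup>2) \<le> (\<integral>\<^sup>+z. ennreal ((cmod (L2_inner f (tf_shift z window)))\<^sup>2) \<partial>count_space (rect_lattice \<alpha>))"
      unfolding gabor_fiberization[OF \<alpha>(1) f] by (simp add: nn_integral_mono A)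
    have "(\<integral>\<^sup>+z. ennreal ((cmod (L2_inner f (tf_shift z window)))\<^sup>2) \<partial>count_space (rect_lattice \<alpha>)) \<le> (\<integral>\<^sup>+t. ennreal B * ?n t \<partial>unit_lborel)"
      unfolding gabor_fiberization[OF \<alpha>(1) f] by (intro nn_integral_mono B)
    also have "\<dots> = ennreal (B * (L2_norm f)\<^sup>2)"
      using B(1) by (simp add: nn_integral_cmult fiber_norm[OF f] ennreal_mult)
    also have "\<dots> \<le> ennreal (max A B * (L2_norm f)\<^sup>2)"
      by (intro ennreal_leI mult_right_mono) auto
    finally show "(\<integral>\<^sup>+z. ennreal ((cmod (L2_inner f (tf_shift z window)))\<^sup>2) \<partial>count_space (rect_lattice \<alpha>)) \<le> ennreal (max A B * (L2_norm f)\<^sup>2)" .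
  qed
  show ?thesis
    unfolding gabor_frame_def L2_frame_def
  proof (rule conjI, use tf_shift_in_L2 in \<open>force simp: rect_lattice_def\<close>,
      rule exI[of _ A], rule exI[of _ "max A B"], intro conjI ballI)
    fix f assume f: "f \<in> L2"
    let ?c = "\<lambda>z. (cmod (L2_inner f (tf_shift z window)))\<^sup>2"
    have "(\<integral>\<^sup>+z. ennreal (?c z) \<partial>count_space (rect_lattice \<alpha>)) < \<infinity>"
      using bounds(2)[OF f] by (rule le_less_trans) simp
    note s = has_sum_of_nn_integral[of "rect_lattice \<alpha>" ?c, OF _ this]
    show "?c summable_on rect_lattice \<alpha>" by (rule s) simp
    have "infsum ?c (rect_lattice \<alpha>) \<ge> 0" by (intro infsum_nonneg) simp
    then show "A * (L2_norm f)\<^sup>2 \<le> infsum ?c (rect_lattice \<alpha>)"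
      "infsum ?c (rect_lattice \<alpha>) \<le> max A B * (L2_norm f)\<^sup>2"
      using bounds[OF f] A(1) unfolding s(2)[OF zero_le_power2, symmetric]
      by (auto simp: ennreal_le_iff)
  qed (use A in auto)
qed

lemma gabor_frameD:
  assumes "0 < \<alpha>" "gabor_frame window (rect_lattice \<alpha>)"
  shows "\<exists>A>0. \<forall>f\<in>L2. ennreal (A * (L2_norm f)\<^sup>2) \<le>
    (\<integral>\<^sup>+t. \<integral>\<^sup>+j. ennreal ((cmod (synth \<phi> (\<lambda>k. f (t + of_int k)) (t - \<alpha> * of_int j)))\<^sup>2)
        \<partial>count_space UNIV \<partial>unit_lborel)"
proof -
  obtain A where A: "0 < A" "\<And>f. f \<in> L2 \<Longrightarrow> (\<lambda>z. (cmod (L2_inner f (tf_shift z window)))\<^sup>2) summable_on rect_lattice \<alpha> \<and>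
    A * (L2_norm f)\<^sup>2 \<le> (\<Sum>\<^sub>\<infinity>z\<in>rect_lattice \<alpha>. (cmod (L2_inner f (tf_shift z window)))\<^sup>2)"
    using assms(2) unfolding gabor_frame_def L2_frame_def by blast
  have "ennreal (A * (L2_norm f)\<^sup>2) \<le>
    (\<integral>\<^sup>+z. ennreal ((cmod (L2_inner f (tf_shift z window)))\<^sup>2) \<partial>count_space (rect_lattice \<alpha>))" if "f \<in> L2" for f
    using A(2)[OF that] nn_integral_count_space_has_sum[OF has_sum_infsum, of "\<lambda>z. (cmod (L2_inner f (tf_shift z window)))\<^sup>2" "rect_lattice \<alpha>"]
    by (simp add: ennreal_leI)
  then show ?thesis using A(1) gabor_fiberization[OF assms(1)] by auto
qed

end

section \<open>Necessity of the density condition\<close>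

text \<open>Gaussian elimination, one equation at a time: an unknown \<open>k0\<close> with nonzero
  coefficient in row \<open>j\<close> is solved for and substituted into the other rows, which
  preserves the surplus of unknowns.\<close>

lemma underdetermined_homogeneous_system:
  fixes a :: "'j \<Rightarrow> 'k \<Rightarrow> real"
  assumes "finite J" "finite K" "card J < card K"
  shows "\<exists>c. (\<exists>k\<in>K. c k \<noteq> 0) \<and> (\<forall>j\<in>J. (\<Sum>k\<in>K. c k * a j k) = 0)"
  using assms
proof (induction J arbitrary: K a rule: finite_induct)
  case empty
  then show ?case by (intro exI[of _ "\<lambda>_. 1"]) (auto simp: card_gt_0_iff)
next
  case (insert j J)
  show ?case
  proof (cases "\<forall>k\<in>K. a j k = 0")
    case True
    have "\<exists>c. (\<exists>k\<in>K. c k \<noteq> 0) \<and> (\<forall>j\<in>J. (\<Sum>k\<in>K. c k * a j k) = 0)"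
      using insert.prems insert.hyps by (intro insert.IH) auto
    then show ?thesis using True by auto
  next
    case False
    then obtain k0 where k0: "k0 \<in> K" "a j k0 \<noteq> 0" by blast
    define K' where "K' = K - {k0}"
    have K': "finite K'" "card J < card K'" "K = insert k0 K'" "k0 \<notin> K'"
      using insert.prems insert.hyps k0 by (auto simp: K'_def)
    obtain c where c: "\<exists>k\<in>K'. c k \<noteq> 0"
      "\<And>i. i \<in> J \<Longrightarrow> (\<Sum>k\<in>K'. c k * (a i k - a i k0 * a j k / a j k0)) = 0"
      using insert.IH[OF K'(1,2), of "\<lambda>i k. a i k - a i k0 * a j k / a j k0"] by blast
    define s where "s = (\<Sum>k\<in>K'. c k * a j k)"
    define d where "d = c(k0 := - s / a j k0)"
    have sum_d: "(\<Sum>k\<in>K. d k * a i k) = (\<Sum>k\<in>K'. c k * a i k) - s / a j k0 * a i k0" for i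
    proof -
      have "(\<Sum>k\<in>K'. d k * a i k) = (\<Sum>k\<in>K'. c k * a i k)"
        using K'(4) by (intro sum.cong) (auto simp: d_def)
      then show ?thesis using K' by (simp add: d_def)
    qed
    have "(\<Sum>k\<in>K. d k * a i k) = 0" if "i \<in> insert j J" for i
    proof (cases "i = j")
      case True
      then show ?thesis using k0 by (simp add: sum_d s_def)
    next
      case False
      then have "0 = (\<Sum>k\<in>K'. c k * (a i k - a i k0 * a j k / a j k0))" using c(2) that by simp
      also have "\<dots> = (\<Sum>k\<in>K'. c k * a i k) - (\<Sum>k\<in>K'. c k * a j k * (a i k0 / a j k0))"
        by (simp add: right_diff_distrib sum_subtractf mult_ac)
      also have "\<dots> = (\<Sum>k\<in>K'. c k * a i k) - s * (a i k0 / a j k0)"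
        unfolding s_def sum_distrib_right ..
      finally show ?thesis by (simp add: sum_d)
    qed
    moreover have "\<exists>k\<in>K. d k \<noteq> 0" using c(1) K' by (auto simp: d_def)
    ultimately show ?thesis by blast
  qed
qed

context spline_generator
begin

text \<open>Concentrating \<open>f\<close> on translates of a short interval at \<open>t0\<close> turns the lower frame bound
  into a bound at the single point \<open>t0\<close>.\<close>

lemma pointwise_lower_bound:
  fixes c :: "int \<Rightarrow> complex"
  assumes bound: "\<And>f. f \<in> L2 \<Longrightarrow> ennreal (A * (L2_norm f)\<^sup>2) \<le>
      (\<integral>\<^sup>+t. \<integral>\<^sup>+j. ennreal ((cmod (synth \<phi> (\<lambda>k. f (t + of_int k)) (t - \<alpha> * of_int j)))\<^sup>2)
        \<partial>count_space UNIV \<partial>unit_lborel)"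
    and "0 < A" and t0: "t0 \<in> {0..<1}" and K: "finite K" and J: "finite J"
    and JK: "\<And>t j k. t \<in> {0..<1} \<Longrightarrow> k \<in> K \<Longrightarrow> \<phi> (t - \<alpha> * of_int j + of_int k) \<noteq> 0 \<Longrightarrow> j \<in> J"
  shows "A * (\<Sum>k\<in>K. (cmod (c k))\<^sup>2) \<le>
    (\<Sum>j\<in>J. (cmod (\<Sum>k\<in>K. c k * of_real (\<phi> (t0 - \<alpha> * of_int j + of_int k))))\<^sup>2)"
proof (rule ccontr)
  define G where "G t = (\<Sum>j\<in>J. (cmod (\<Sum>k\<in>K. c k * of_real (\<phi> (t - \<alpha> * of_int j + of_int k))))\<^sup>2)" for t
  define X where "X = A * (\<Sum>k\<in>K. (cmod (c k))\<^sup>2)"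
  assume "\<not> ?thesis"
  then have "G t0 < X" by (simp add: G_def X_def)
  \<comment> \<open>\<open>b\<close> lies strictly between the value at \<open>t0\<close> and the
    claimed lower bound, leaving room for continuity to keep \<open>G\<close> below it on a short
    interval.\<close>
  then obtain b where b: "G t0 < b" "b < X" using dense by blast
  have "0 \<le> G t0" unfolding G_def by (intro sum_nonneg) auto
  then have b0: "0 < b" using b by simp
  have "continuous_on UNIV G"
    unfolding G_def[abs_def] by (intro continuous_intros continuous_compose)
  then have "isCont G t0" by (simp add: continuous_on_eq_continuous_at)
  then obtain d where d: "0 < d" "\<And>t. dist t t0 < d \<Longrightarrow> dist (G t) (G t0) < b - G t0"
    using b unfolding continuous_at_eps_delta by (metis diff_gt_0_iff_gt)
  \<comment> \<open>The interval \<open>{t0..<t0 + e}\<close> stays inside [0, 1), so its integer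
    translates are disjoint and every fiber over it carries exactly the coefficients
    \<open>c\<close>.\<close>
  define e where "e = min (d / 2) (1 - t0)"
  have e: "0 < e" "t0 + e \<le> 1" "e < d" using d t0 by (auto simp: e_def)
  have Gb: "G t \<le> b" if "t \<in> {t0..<t0 + e}" for t
    using d(2)[of t] that e by (auto simp: dist_real_def)
  define f where "f x = (\<Sum>k\<in>K. c k * indicator {t0 + of_int k..<t0 + of_int k + e} x)" for x
  have [measurable]: "f \<in> borel_measurable borel" unfolding f_def[abs_def] by measurable
  have fib: "f (t + of_int k) = (if k \<in> K then c k else 0) * indicator {t0..<t0 + e} t" if "t \<in> {0..<1}" for t k
  proof -
    have "indicator {t0 + of_int i..<t0 + of_int i + e} (t + of_int k) = (if i = k then indicator {t0..<t0 + e} t else 0 :: complex)" for i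
    proof (cases "i = k")
      case False
      then have "of_int i + 1 \<le> real_of_int k \<or> of_int k + 1 \<le> real_of_int i" by linarith
      then show ?thesis using that t0 e False by (auto split: split_indicator)
    qed (auto split: split_indicator)
    then show ?thesis using K by (simp add: f_def if_distrib[of "\<lambda>x. _ * x"] sum.delta' cong: if_cong)
  qed
  have S: "(\<integral>\<^sup>+k. ennreal ((cmod (f (t + of_int k)))\<^sup>2) \<partial>count_space UNIV)
    = ennreal (\<Sum>k\<in>K. (cmod (c k))\<^sup>2) * indicator {t0..<t0 + e} t" if "t \<in> {0..<1}" for t
  proof -
    have "(\<integral>\<^sup>+k. ennreal ((cmod (f (t + of_int k)))\<^sup>2) \<partial>count_space UNIV) = (\<Sum>k\<in>K. ennreal ((cmod (f (t + of_int k)))\<^sup>2))"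
      using K by (intro nn_integral_count_space') (auto simp: fib[OF that])
    also have "\<dots> = (\<Sum>k\<in>K. ennreal ((cmod (c k))\<^sup>2) * indicator {t0..<t0 + e} t)"
      by (intro sum.cong) (auto simp: fib[OF that] split: split_indicator)
    finally show ?thesis by (simp add: sum_distrib_right[symmetric] sum_ennreal)
  qed
  have int_ind: "(\<integral>\<^sup>+t. a * indicator {t0..<t0 + e} t \<partial>unit_lborel) = a * ennreal e" for a
  proof -
    have "(\<integral>\<^sup>+t. a * indicator {t0..<t0 + e} t \<partial>unit_lborel) = (\<integral>\<^sup>+t. a * indicator {t0..<t0 + e} t * indicator {0..<1} t \<partial>lborel)"
      unfolding unit_lborel_def by (rule nn_integral_restrict_space) simp
    also have "\<dots> = (\<integral>\<^sup>+t. a * indicator {t0..<t0 + e} t \<partial>lborel)"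
      using t0 e by (intro nn_integral_cong) (auto split: split_indicator)
    also have "\<dots> = a * ennreal e" using e by (simp add: nn_integral_cmult)
    finally show ?thesis .
  qed
  have "(\<integral>\<^sup>+x. ennreal ((cmod (f x))\<^sup>2) \<partial>lborel) = (\<integral>\<^sup>+t. ennreal (\<Sum>k\<in>K. (cmod (c k))\<^sup>2) * indicator {t0..<t0 + e} t \<partial>unit_lborel)"
    by (subst nn_integral_periodization) (auto intro!: nn_integral_cong simp: S)
  then have fnorm: "(\<integral>\<^sup>+x. ennreal ((cmod (f x))\<^sup>2) \<partial>lborel) = ennreal ((\<Sum>k\<in>K. (cmod (c k))\<^sup>2) * e)"
    using e by (simp add: int_ind ennreal_mult sum_nonneg)
  have fL2: "f \<in> L2"
    unfolding L2_def mem_Collect_eq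
    by (intro conjI integrableI_bounded) (simp_all add: fnorm)
  have "ennreal (X * e) = ennreal (A * (L2_norm f)\<^sup>2)"
    using fnorm unfolding nn_integral_of_L2[OF fL2]
    using e by (simp add: X_def mult.assoc sum_nonneg)
  also have "\<dots> \<le> (\<integral>\<^sup>+t. \<integral>\<^sup>+j. ennreal ((cmod (synth \<phi> (\<lambda>k. f (t + of_int k)) (t - \<alpha> * of_int j)))\<^sup>2)
        \<partial>count_space UNIV \<partial>unit_lborel)"
    by (rule bound[OF fL2])
  also have "\<dots> \<le> (\<integral>\<^sup>+t. ennreal b * indicator {t0..<t0 + e} t \<partial>unit_lborel)"
  proof (rule nn_integral_mono)
    fix t assume "t \<in> space unit_lborel"
    then have t: "t \<in> {0..<1}" by simp
    have syn: "synth \<phi> (\<lambda>k. f (t + of_int k)) (t - \<alpha> * of_int j)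
      = (\<Sum>k\<in>K. c k * of_real (\<phi> (t - \<alpha> * of_int j + of_int k))) * indicator {t0..<t0 + e} t" for j
    proof -
      have "synth \<phi> (\<lambda>k. f (t + of_int k)) (t - \<alpha> * of_int j)
        = (\<Sum>k\<in>K \<union> {k. \<phi> (t - \<alpha> * of_int j + of_int k) \<noteq> 0}. f (t + of_int k) * of_real (\<phi> (t - \<alpha> * of_int j + of_int k)))"
        using K finite_support_translates by (intro synth_eq_sum) auto
      also have "\<dots> = (\<Sum>k\<in>K. f (t + of_int k) * of_real (\<phi> (t - \<alpha> * of_int j + of_int k)))"
        using K finite_support_translates by (intro sum.mono_neutral_right) (auto simp: fib[OF t])
      also have "\<dots> = (\<Sum>k\<in>K. c k * of_real (\<phi> (t - \<alpha> * of_int j + of_int k))) * indicator {t0..<t0 + e} t"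
        unfolding sum_distrib_right by (intro sum.cong) (auto simp: fib[OF t])
      finally show ?thesis .
    qed
    have "(\<integral>\<^sup>+j. ennreal ((cmod (synth \<phi> (\<lambda>k. f (t + of_int k)) (t - \<alpha> * of_int j)))\<^sup>2) \<partial>count_space UNIV)
      = (\<Sum>j\<in>J. ennreal ((cmod (synth \<phi> (\<lambda>k. f (t + of_int k)) (t - \<alpha> * of_int j)))\<^sup>2))"
    proof (rule nn_integral_count_space'[OF J])
      fix j assume "j \<notin> J"
      then have "(\<Sum>k\<in>K. c k * of_real (\<phi> (t - \<alpha> * of_int j + of_int k))) = 0"
        using JK[OF t] by (intro sum.neutral) auto
      then show "ennreal ((cmod (synth \<phi> (\<lambda>k. f (t + of_int k)) (t - \<alpha> * of_int j)))\<^sup>2) = 0" by (simp add: syn)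
    qed simp
    also have "\<dots> = ennreal (G t) * indicator {t0..<t0 + e} t"
      unfolding syn G_def by (auto simp: sum_ennreal norm_mult split: split_indicator)
    also have "\<dots> \<le> ennreal b * indicator {t0..<t0 + e} t"
      using Gb by (auto split: split_indicator intro: ennreal_leI)
    finally show "(\<integral>\<^sup>+j. ennreal ((cmod (synth \<phi> (\<lambda>k. f (t + of_int k)) (t - \<alpha> * of_int j)))\<^sup>2) \<partial>count_space UNIV)
      \<le> ennreal b * indicator {t0..<t0 + e} t" .
  qed
  also have "\<dots> = ennreal (b * e)" using b0 e by (simp add: int_ind ennreal_mult)
  finally have "X * e \<le> b * e" using b0 e by (subst (asm) ennreal_le_iff) auto
  then show False using b e by simp
qed

text \<open>The samples reached by \<open>N\<close> consecutive translates number at most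
  \<open>(N + D) / \<alpha> + 1\<close>, with \<open>D\<close> the length of the support. For large
  \<open>N\<close> this falls below \<open>N\<close>, and a nonzero vector annihilated at
  \<open>t = 0\<close> contradicts \<open>pointwise_lower_bound\<close>.\<close>

lemma not_gabor_frame_sparse:
  assumes "1 < \<alpha>"
  shows "\<not> gabor_frame window (rect_lattice \<alpha>)"
proof
  assume "gabor_frame window (rect_lattice \<alpha>)"
  then obtain A where A: "0 < A" "\<And>f. f \<in> L2 \<Longrightarrow> ennreal (A * (L2_norm f)\<^sup>2) \<le>
    (\<integral>\<^sup>+t. \<integral>\<^sup>+j. ennreal ((cmod (synth \<phi> (\<lambda>k. f (t + of_int k)) (t - \<alpha> * of_int j)))\<^sup>2)
        \<partial>count_space UNIV \<partial>unit_lborel)"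
    using gabor_frameD[of \<alpha>] assms by auto
  define D where "D = real (n + 2)"
  \<comment> \<open>This solves \<open>(N + D) / \<alpha> + 1 < N\<close> for
    \<open>N\<close>.\<close>
  obtain N :: nat where N: "(D + \<alpha>) / (\<alpha> - 1) < real N" using reals_Archimedean2 by blast
  then have "(real N + D) / \<alpha> + 1 < real N" using assms by (simp add: field_simps)
  define K where "K = {0..<int N}"
  define J where "J = {j::int. - D < \<alpha> * of_int j \<and> \<alpha> * of_int j < real N}"
  have "- D \<le> real N" by (simp add: D_def)
  then have J: "finite J" "real (card J) \<le> (real N + D) / \<alpha> + 1"
    using lattice_points_in_interval[of \<alpha> "- D" "real N"] assms by (simp_all add: J_def)
  then have "card J < card K" using \<open>(real N + D) / \<alpha> + 1 < real N\<close> by (simp add: K_def)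
  then obtain c :: "int \<Rightarrow> real" where c: "\<exists>k\<in>K. c k \<noteq> 0"
    "\<And>j. j \<in> J \<Longrightarrow> (\<Sum>k\<in>K. c k * \<phi> (0 - \<alpha> * of_int j + of_int k)) = 0"
    using underdetermined_homogeneous_system[OF J(1), of K "\<lambda>j k. \<phi> (0 - \<alpha> * of_int j + of_int k)"]
    by (auto simp: K_def)
  have "A * (\<Sum>k\<in>K. (cmod (of_real (c k)))\<^sup>2) \<le>
    (\<Sum>j\<in>J. (cmod (\<Sum>k\<in>K. of_real (c k) * of_real (\<phi> (0 - \<alpha> * of_int j + of_int k))))\<^sup>2)"
  proof (rule pointwise_lower_bound[OF A(2) A(1) _ _ J(1)])
    fix t :: real and j k :: int
    assume t: "t \<in> {0..<1}" and k: "k \<in> K" and "\<phi> (t - \<alpha> * of_int j + of_int k) \<noteq> 0"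
    then have "0 < t - \<alpha> * of_int j + of_int k" "t - \<alpha> * of_int j + of_int k < D"
      using support by (auto simp: D_def)
    moreover have "0 \<le> real_of_int k" "real_of_int k + 1 \<le> real N" using k unfolding K_def atLeastLessThan_iff by linarith+
    ultimately show "j \<in> J" using t by (auto simp: J_def)
  qed (auto simp: K_def)
  also have "\<dots> = (\<Sum>j\<in>J. (cmod (of_real (\<Sum>k\<in>K. c k * \<phi> (0 - \<alpha> * of_int j + of_int k))))\<^sup>2)"
    by simp
  also have "\<dots> = 0" by (intro sum.neutral ballI) (simp only: c(2), simp)
  finally have "A * (\<Sum>k\<in>K. (c k)\<^sup>2) \<le> 0" by simp
  moreover obtain k where "k \<in> K" "c k \<noteq> 0" using c(1) by blast
  then have "0 < (\<Sum>k\<in>K. (c k)\<^sup>2)"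
    by (intro sum_pos2[of K k]) (auto simp: K_def)
  ultimately show False using A(1) by (simp add: mult_le_0_iff)
qed

text \<open>Shifting the alternating sequence by one index reverses its sign, which gives opposite
  values at 0 and 1. A zero found at 1 is moved to 0 to stay in the half-open interval.\<close>

lemma alternating_synth_zero:
  defines "c \<equiv> \<lambda>k::int. (if even k then 1 else - 1 :: complex)"
  shows "\<exists>t\<in>{0..<1}. synth \<phi> c t = 0"
proof -
  define K where "K = {-1..int n + 2}"
  define s where "s t = (\<Sum>k\<in>K. Re (c k) * \<phi> (t + of_int k))" for t
  have syn: "synth \<phi> c t = of_real (s t)" if "t \<in> {0..1}" for t
  proof -
    have "synth \<phi> c t = (\<Sum>k\<in>K. c k * of_real (\<phi> (t + of_int k)))"
    proof (rule synth_eq_sum)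
      fix k :: int assume "\<phi> (t + of_int k) \<noteq> 0"
      then have "-1 < real_of_int k" "real_of_int k < real n + 2" using support that by auto
      then show "k \<in> K" unfolding K_def atLeastAtMost_iff by linarith
    qed (simp add: K_def)
    also have "\<dots> = of_real (s t)"
      unfolding s_def of_real_sum of_real_mult by (intro sum.cong) (auto simp: c_def)
    finally show ?thesis .
  qed
  have "synth \<phi> c 1 = - synth \<phi> (\<lambda>k. c (k + 1)) 1"
    unfolding synth_def sum_negf[symmetric] by (intro sum.cong) (auto simp: c_def)
  then have "synth \<phi> c 1 = - synth \<phi> c 0" by (simp add: synth_translate)
  then have s1: "s 1 = - s 0" using syn[of 0] syn[of 1] by (simp flip: of_real_minus)
  have "continuous_on {0..1} s" unfolding s_def[abs_def] by (intro continuous_intros continuous_compose)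
  then have "\<exists>t\<ge>0. t \<le> 1 \<and> s t = 0"
    using IVT'[of s 0 0 1] IVT2'[of s 1 0 0] s1 by (cases "s 0 \<le> 0") auto
  then obtain t where t: "0 \<le> t" "t \<le> 1" "s t = 0" by blast
  show ?thesis
  proof (cases "t = 1")
    case True
    then show ?thesis using t s1 syn[of 0] by (intro bexI[of _ 0]) auto
  next
    case False
    then show ?thesis using t syn[of t] by (intro bexI[of _ t]) auto
  qed
qed

text \<open>At critical density the alternating sequence, cut off far out, is annihilated up to a bounded
  number of boundary terms, as in the Balian--Low argument with a zero of the Zak transform.\<close>

lemma not_gabor_frame_critical: "\<not> gabor_frame window (rect_lattice 1)"
proof
  assume "gabor_frame window (rect_lattice 1)"
  then obtain A where A: "0 < A" "\<And>f. f \<in> L2 \<Longrightarrow> ennreal (A * (L2_norm f)\<^sup>2) \<le>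
    (\<integral>\<^sup>+t. \<integral>\<^sup>+j. ennreal ((cmod (synth \<phi> (\<lambda>k. f (t + of_int k)) (t - 1 * of_int j)))\<^sup>2)
        \<partial>count_space UNIV \<partial>unit_lborel)"
    using gabor_frameD[of 1] by auto
  define c where "c k = (if even k then 1 else - 1 :: complex)" for k :: int
  obtain t0 where t0: "t0 \<in> {0..<1}" "synth \<phi> c t0 = 0"
    using alternating_synth_zero unfolding c_def[abs_def] by blast
  obtain C where C: "\<And>x. \<bar>\<phi> x\<bar> \<le> C" using bounded by blast
  define E where "E = real (n + 3) * C\<^sup>2 * real (n + 3)"
  \<comment> \<open>The alternating sequence is multiplicative under shifts, so one zero at
    \<open>t0\<close> makes every uncut row vanish.\<close>
  have row0: "synth \<phi> c (t0 - of_int j) = 0" for j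
  proof -
    have "c (k + j) = c j * c k" for k by (auto simp: c_def)
    then have "synth \<phi> c (t0 - of_int j) = c j * synth \<phi> c t0"
      unfolding synth_translate[symmetric] by (simp add: synth_def sum_distrib_left mult.assoc)
    then show ?thesis by (simp add: t0)
  qed
  \<comment> \<open>At most \<open>2 * (n + 2)\<close> boundary rows survive, each costing at most
    \<open>E\<close> independently of \<open>L\<close>, while the left side is
    \<open>A * (2 * L + 1)\<close>.\<close>
  obtain L :: nat where L: "2 * real (n + 2) * E < A * real L"
    using reals_Archimedean3[OF A(1)] by (metis mult.commute)
  define K J where "K = {- int L..int L}" and "J = {- int L - int n - 1..int L}"
  let ?row = "\<lambda>j. \<Sum>k\<in>K. c k * of_real (\<phi> (t0 - 1 * of_int j + of_int k))"
  have supp: "0 \<le> k - j \<and> k - j \<le> int n + 1" if "\<phi> (t - 1 * of_int j + of_int k) \<noteq> 0" "t \<in> {0..<1}" for t j k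
  proof -
    have "- 1 < real_of_int (k - j)" "real_of_int (k - j) < real n + 2" using that support by auto
    then show ?thesis by linarith
  qed
  have "A * (\<Sum>k\<in>K. (cmod (c k))\<^sup>2) \<le> (\<Sum>j\<in>J. (cmod (?row j))\<^sup>2)"
  proof (rule pointwise_lower_bound[OF A(2) A(1) t0(1)])
    show "j \<in> J" if "t \<in> {0..<1}" "k \<in> K" "\<phi> (t - 1 * of_int j + of_int k) \<noteq> 0" for t j k
      using supp[OF that(3,1)] that(2) by (auto simp: K_def J_def)
  qed (auto simp: K_def J_def)
  \<comment> \<open>For the removed \<open>j\<close> all active indices lie in \<open>K\<close>, so
    the cut-off does not touch these rows and they vanish.\<close>
  also have "\<dots> = (\<Sum>j\<in>J - {- int L..int L - int n - 1}. (cmod (?row j))\<^sup>2)"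
  proof (rule sum.mono_neutral_right)
    show "\<forall>j\<in>J - (J - {- int L..int L - int n - 1}). (cmod (?row j))\<^sup>2 = 0"
    proof
      fix j assume "j \<in> J - (J - {- int L..int L - int n - 1})"
      then have "synth \<phi> c (t0 - 1 * of_int j) = ?row j"
        using supp[OF _ t0(1), of j] by (intro synth_eq_sum) (auto simp: K_def, (fastforce)+)
      then show "(cmod (?row j))\<^sup>2 = 0" using row0[of j] by simp
    qed
  qed (auto simp: J_def)
  also have "\<dots> \<le> (\<Sum>j\<in>J - {- int L..int L - int n - 1}. E)"
  proof (rule sum_mono)
    fix j
    let ?S = "{k. \<phi> (t0 - 1 * of_int j + of_int k) \<noteq> 0}"
    let ?cK = "\<lambda>k. if k \<in> K then c k else 0"
    have fin: "finite ?S" by (rule finite_support_translates)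
    have "synth \<phi> ?cK (t0 - 1 * of_int j) = (\<Sum>k\<in>K \<union> ?S. ?cK k * of_real (\<phi> (t0 - 1 * of_int j + of_int k)))"
      using fin by (intro synth_eq_sum) (auto simp: K_def)
    also have "\<dots> = ?row j"
      using fin by (intro sum.mono_neutral_cong_right) (auto simp: K_def)
    finally have "(cmod (?row j))\<^sup>2 \<le> real (n + 3) * C\<^sup>2 * (\<Sum>k\<in>?S. (cmod (?cK k))\<^sup>2)"
      using synth_bound[OF C, of ?cK "t0 - 1 * of_int j"] by simp
    also have "\<dots> \<le> real (n + 3) * C\<^sup>2 * real (n + 3)"
    proof (rule mult_left_mono)
      have "(\<Sum>k\<in>?S. (cmod (?cK k))\<^sup>2) \<le> (\<Sum>k\<in>?S. 1)"
        by (intro sum_mono) (auto simp: c_def)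
      also have "\<dots> = real (card ?S)" by simp
      also have "card ?S \<le> card {j..j + int n + 1}"
        using supp[OF _ t0(1), of j] by (intro card_mono) fastforce+
      also have "real (card {j..j + int n + 1}) \<le> real (n + 3)" by simp
      finally show "(\<Sum>k\<in>?S. (cmod (?cK k))\<^sup>2) \<le> real (n + 3)" by simp
    qed simp
    finally show "(cmod (?row j))\<^sup>2 \<le> E" by (simp add: E_def)
  qed
  also have "\<dots> = real (card (J - {- int L..int L - int n - 1})) * E" by simp
  also have "\<dots> \<le> real (2 * (n + 2)) * E"
  proof (intro mult_right_mono of_nat_mono)
    have "J - {- int L..int L - int n - 1} \<subseteq> {- int L - int n - 1..- int L - 1} \<union> {int L - int n..int L}"
      by (auto simp: J_def)
    then have "card (J - {- int L..int L - int n - 1}) \<le> card ({- int L - int n - 1..- int L - 1} \<union> {int L - int n..int L})"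
      by (intro card_mono) auto
    also have "\<dots> \<le> card {- int L - int n - 1..- int L - 1} + card {int L - int n..int L}"
      by (rule card_Un_le)
    also have "\<dots> \<le> 2 * (n + 2)" by simp
    finally show "card (J - {- int L..int L - int n - 1}) \<le> 2 * (n + 2)" .
  qed (simp add: E_def)
  also have "\<dots> < A * real L" using L by simp
  finally have "A * (\<Sum>k\<in>K. (cmod (c k))\<^sup>2) < A * real L" .
  moreover have "(\<Sum>k\<in>K. (cmod (c k))\<^sup>2) = (\<Sum>k\<in>K. 1)" by (intro sum.cong) (auto simp: c_def)
  then have "(\<Sum>k\<in>K. (cmod (c k))\<^sup>2) = real (nat (2 * int L + 1))" by (simp add: K_def)
  ultimately show False using A(1) by simp
qed

end

theorem corollary8p3:
  fixes m :: nat and \<gamma> :: "nat \<Rightarrow> real" and r :: "nat \<Rightarrow> real \<Rightarrow> real"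
    and \<phi> :: "real \<Rightarrow> real" and \<alpha> :: real
  assumes "m \<ge> 2"
    and "is_PEB_spline m \<gamma> r \<phi>"
    and "\<alpha> > 0"
  shows "gabor_frame (\<lambda>t. complex_of_real (\<phi> t)) (rect_lattice \<alpha>) \<longleftrightarrow> 0 < \<alpha> \<and> \<alpha> < 1"
proof -
  interpret spline_generator "weight \<gamma> r" "m - 2" \<phi>
    using assms(1,2) by (rule PEB_spline_generator)
  show ?thesis
    using gabor_frame_if not_gabor_frame_sparse not_gabor_frame_critical \<open>\<alpha> > 0\<close>
    by (metis linorder_less_linear)
qed

end
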